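(* Let $f_\varepsilon$ be a prepared generic $k$-parameter unfolding of an antiholomorphic parabolic germ of codimension $k\ge1$, with canonical parameter $\varepsilon=(\varepsilon_0,\dots,\varepsilon_{k-1})$. (1) When $k$ is odd, the canonical parameter of the prepared $f_\varepsilon$ is unique: if $(z,\varepsilon)\mapsto(H(z,\varepsilon),\phi(\varepsilon))$ is a mix analytic conjugacy from $f_\varepsilon$ to another prepared family, then $\phi=\mathrm{id}$. (2) When $k$ is even, conjugating $f_\varepsilon$ with $L_{-1}(z)=-z$ yields a second prepared form $\hat f_{\hat\varepsilon}=L_{-1}\circ f_\varepsilon\circ L_{-1}$ with canonical parameter $\hat\varepsilon$ given, listing components in the order of indices $k-1,k-2,\dots,1,0$, by $$\hat\varepsilon=(\varepsilon_{k-1},-\varepsilon_{k-2},\dots,\varepsilon_1,-\varepsilon_0),$$ that is, $\hat\varepsilon_j=(-1)^{j+1}\varepsilon_j$.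
   Context: For an antiholomorphic map $f$ ($\partial f/\partial z=0$), $f'$ denotes $\partial f/\partial\overline z$. A prepared family is a germ of family of antiholomorphic diffeomorphisms near $0\in\mathbb C$, depending real-analytically on $\varepsilon\in(\mathbb R^k,0)$, of the form $$f_\varepsilon(z)=\overline z+P_\varepsilon(\overline z)\left(\tfrac12+Q_\varepsilon(\overline z)+P_\varepsilon(\overline z)R_\varepsilon(\overline z)\right),\qquad P_\varepsilon(z)=z^{k+1}+\sum_{j=0}^{k-1}\varepsilon_jz^j,$$ with $Q_\varepsilon$ a polynomial of degree at most $k$ with coefficients real analytic in $\varepsilon$, $R_\varepsilon$ holomorphic in its variable and real-analytic in $\varepsilon$, $f_0(z)=\overline z+\frac12\overline z^{\,k+1}+o(\overline z^{\,k+1})$, such that: if $z_1,\dots,z_{k+1}$ are the fixed points near $0$ of $g_\varepsilon=f_\varepsilon\circ f_\varepsilon$, then $b(\varepsilon)=\sum_s 1/\log g_\varepsilon'(z_s)$ (extended by continuity to multiple fixed points) is real analytic and real-valued, and with $v_\varepsilon(z)=\frac{P_\varepsilon(z)}{1+b(\varepsilon)z^k}$ one has $\log f_\varepsilon'(z_s)=\frac12\overline{v_\varepsilon'(z_s)}$ for all $s$. The parameter $\varepsilon$ of a prepared family is called canonical. A mix analytic conjugacy from $f_{1,\eta}$ to $f_{2,\varepsilon}$ is a diffeomorphism $(z,\eta)\mapsto(H(z,\eta),\phi(\eta))$ on a neighborhood of $0\in\mathbb C\times\mathbb R^k$, with $H$ holomorphic in $z$ and real-analytic in $\eta$, and $\phi$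 real-analytic, such that $H(f_{1,\eta}(z),\eta)=f_{2,\phi(\eta)}(H(z,\eta))$. *)

theory Defs
  imports
    "HOL-Complex_Analysis.Complex_Analysis"
    "HOL-Library.Landau_Symbols"
    "HOL-Computational_Algebra.Polynomial"
begin

section \<open>Real-analytic and mixed analytic maps\<close>

text \<open>Real-analyticity in several real variables: near each point of the set, the map is the sum
  of a (necessarily absolutely) convergent power series in the coordinates with respect to the
  standard basis. The series is indexed by multi-indices \<open>\<alpha>\<close>, encoded as functions vanishing
  outside \<^term>\<open>Basis\<close>.\<close>

definition real_analytic_on ::
    "('a::euclidean_space \<Rightarrow> 'b::euclidean_space) \<Rightarrow> 'a set \<Rightarrow> bool" where
  "real_analytic_on f S \<longleftrightarrow>
     (\<forall>p\<in>S. \<exists>c r. r > 0 \<and>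
        (\<forall>h. norm h < r \<longrightarrow>
           ((\<lambda>\<alpha>. (\<Prod>i\<in>Basis. (h \<bullet> i) ^ \<alpha> i) *\<^sub>R c \<alpha>) has_sum f (p + h))
             {\<alpha>::'a \<Rightarrow> nat. \<forall>i. i \<notin> Basis \<longrightarrow> \<alpha> i = 0}))"

text \<open>Holomorphic in \<open>z\<close> and real-analytic in the parameter; as usual for families, the analytic
  dependence is joint.\<close>

definition mix_analytic_on ::
    "(complex \<Rightarrow> 'e::euclidean_space \<Rightarrow> complex) \<Rightarrow> (complex \<times> 'e) set \<Rightarrow> bool" where
  "mix_analytic_on F D \<longleftrightarrow>
     real_analytic_on (\<lambda>(z, \<eta>). F z \<eta>) D \<and>
     (\<forall>\<eta>. (\<lambda>z. F z \<eta>) holomorphic_on {z. (z, \<eta>) \<in> D})"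

text \<open>For real-analytic maps, being a diffeomorphism in the sense below (differentiable inverse)
  amounts to having a real-analytic inverse.\<close>

definition diffeomorphism_on ::
    "('a::euclidean_space \<Rightarrow> 'b::euclidean_space) \<Rightarrow> 'a set \<Rightarrow> bool" where
  "diffeomorphism_on f D \<longleftrightarrow>
     open D \<and> open (f ` D) \<and> f differentiable_on D \<and>
     (\<exists>f'. homeomorphism D (f ` D) f f' \<and> f' differentiable_on (f ` D))"


section \<open>Antiholomorphic maps\<close>

definition wirtinger_dz :: "(complex \<Rightarrow> complex) \<Rightarrow> complex \<Rightarrow> complex" where
  "wirtinger_dz f z =
     (frechet_derivative f (at z) 1 - \<i> * frechet_derivative f (at z) \<i>) / 2"

definition wirtinger_dzbar :: "(complex \<Rightarrow> complex) \<Rightarrow> complex \<Rightarrow> complex" where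
  "wirtinger_dzbar f z =
     (frechet_derivative f (at z) 1 + \<i> * frechet_derivative f (at z) \<i>) / 2"

definition antiholomorphic_on :: "(complex \<Rightarrow> complex) \<Rightarrow> complex set \<Rightarrow> bool" where
  "antiholomorphic_on f S \<longleftrightarrow> (\<forall>z\<in>S. f differentiable (at z) \<and> wirtinger_dz f z = 0)"


section \<open>Prepared families\<close>

text \<open>The parameter space is \<^typ>\<open>real ^ 'n\<close> with \<open>k = CARD('n)\<close>; a bijection \<open>idx\<close> from \<^typ>\<open>'n\<close> onto
  \<open>{0, \<dots>, k - 1}\<close> labels the components, so that the component \<open>\<epsilon> $ i\<close> is the parameter with
  index \<open>idx i\<close>. The definitions are only meaningful for such \<open>idx\<close>.\<close>

definition param_poly :: "('n::finite \<Rightarrow> nat) \<Rightarrow> real ^ 'n \<Rightarrow> complex \<Rightarrow> complex" where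
  "param_poly idx \<epsilon> z =
     z ^ (CARD('n) + 1) + (\<Sum>i\<in>UNIV. complex_of_real (\<epsilon> $ i) * z ^ idx i)"

definition canonical_field ::
    "('n::finite \<Rightarrow> nat) \<Rightarrow> (real ^ 'n \<Rightarrow> real) \<Rightarrow> real ^ 'n \<Rightarrow> complex \<Rightarrow> complex" where
  "canonical_field idx b \<epsilon> z =
     param_poly idx \<epsilon> z / (1 + complex_of_real (b \<epsilon>) * z ^ CARD('n))"

definition fixed_points_in ::
    "(complex \<Rightarrow> complex) \<Rightarrow> real \<Rightarrow> complex set" where
  "fixed_points_in g r = {z \<in> ball 0 r. g z = z}"

definition antiholomorphic_diffeo_family ::
    "(real ^ 'n::finite \<Rightarrow> complex \<Rightarrow> complex) \<Rightarrow> bool" where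
  "antiholomorphic_diffeo_family f \<longleftrightarrow>
     (\<exists>r>0. real_analytic_on (\<lambda>(z, \<epsilon>). f \<epsilon> z) (ball 0 r \<times> ball 0 r) \<and>
        (\<forall>\<epsilon>\<in>ball 0 r. antiholomorphic_on (f \<epsilon>) (ball 0 r) \<and>
           diffeomorphism_on (f \<epsilon>) (ball 0 r)))"

definition prepared_form ::
    "('n::finite \<Rightarrow> nat) \<Rightarrow> (real ^ 'n \<Rightarrow> complex \<Rightarrow> complex) \<Rightarrow> bool" where
  "prepared_form idx f \<longleftrightarrow>
     (\<exists>r>0. \<exists>(Q :: real ^ 'n \<Rightarrow> complex poly) (R :: complex \<Rightarrow> real ^ 'n \<Rightarrow> complex).
        (\<forall>\<epsilon>\<in>ball 0 r. degree (Q \<epsilon>) \<le> CARD('n)) \<and>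
        (\<forall>j. real_analytic_on (\<lambda>\<epsilon>. coeff (Q \<epsilon>) j) (ball 0 r)) \<and>
        mix_analytic_on R (ball 0 r \<times> ball 0 r) \<and>
        (\<forall>\<epsilon>\<in>ball 0 r. \<forall>z\<in>ball 0 r.
           f \<epsilon> z = cnj z + param_poly idx \<epsilon> (cnj z) *
             (1 / 2 + poly (Q \<epsilon>) (cnj z) + param_poly idx \<epsilon> (cnj z) * R (cnj z) \<epsilon>)))"

text \<open>The fixed points ``near \<open>0\<close>'' of \<open>g\<^sub>\<epsilon> = f\<^sub>\<epsilon> \<circ> f\<^sub>\<epsilon>\<close> are those in a small disk of radius
  \<open>r\<close>, for \<open>\<epsilon>\<close> small depending on \<open>r\<close>; there are \<open>k + 1\<close> of them with multiplicity, hence they are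
  all simple iff the set has \<open>k + 1\<close> elements. Such \<open>\<epsilon>\<close> are dense near \<open>0\<close>, so the (real-analytic,
  hence continuous) function \<open>b\<close> is the continuous extension of the sum from these \<open>\<epsilon>\<close>, and its
  germ is determined by \<open>f\<close>. All derivatives below are close to 1, so \<^const>\<open>Ln\<close> is the
  branch of the logarithm vanishing at 1.\<close>

definition prepared_family ::
    "('n::finite \<Rightarrow> nat) \<Rightarrow> (real ^ 'n \<Rightarrow> complex \<Rightarrow> complex) \<Rightarrow> bool" where
  "prepared_family idx f \<longleftrightarrow>
     antiholomorphic_diffeo_family f \<and>
     prepared_form idx f \<and>
     (\<lambda>z. f 0 z - (cnj z + cnj z ^ (CARD('n) + 1) / 2)) \<in> o[at 0](\<lambda>z. cnj z ^ (CARD('n) + 1)) \<and>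
     (\<exists>b :: real ^ 'n \<Rightarrow> real.
        (\<exists>\<rho>>0. real_analytic_on b (ball 0 \<rho>)) \<and>
        (\<forall>\<^sub>F r in at_right 0. \<forall>\<^sub>F \<epsilon> in nhds 0.
           (card (fixed_points_in (f \<epsilon> \<circ> f \<epsilon>) r) = CARD('n) + 1 \<longrightarrow>
              complex_of_real (b \<epsilon>) =
                (\<Sum>z\<in>fixed_points_in (f \<epsilon> \<circ> f \<epsilon>) r. 1 / Ln (deriv (f \<epsilon> \<circ> f \<epsilon>) z))) \<and>
           (\<forall>z\<in>fixed_points_in (f \<epsilon> \<circ> f \<epsilon>) r.
              Ln (wirtinger_dzbar (f \<epsilon>) z) = cnj (deriv (canonical_field idx b \<epsilon>) z) / 2)))"


section \<open>Conjugacy of families\<close>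

text \<open>Conjugacies are germs at the origin: the diffeomorphism preserves the origin of
  \<open>\<complex> \<times> \<real>\<^sup>k\<close>, where the families are defined as germs.\<close>

definition mix_analytic_conjugacy ::
    "(real ^ 'n::finite \<Rightarrow> complex \<Rightarrow> complex) \<Rightarrow> (real ^ 'n \<Rightarrow> complex \<Rightarrow> complex) \<Rightarrow>
     (complex \<Rightarrow> real ^ 'n \<Rightarrow> complex) \<Rightarrow> (real ^ 'n \<Rightarrow> real ^ 'n) \<Rightarrow> bool" where
  "mix_analytic_conjugacy f1 f2 H \<phi> \<longleftrightarrow>
     H 0 0 = 0 \<and> \<phi> 0 = 0 \<and>
     (\<exists>D. (0, 0) \<in> D \<and>
        diffeomorphism_on (\<lambda>(z, \<eta>). (H z \<eta>, \<phi> \<eta>)) D \<and>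
        mix_analytic_on H D \<and> real_analytic_on \<phi> (snd ` D)) \<and>
     (\<forall>\<^sub>F (z, \<eta>) in nhds (0, 0). H (f1 \<eta> z) \<eta> = f2 (\<phi> \<eta>) (H z \<eta>))"

definition scaling :: "complex \<Rightarrow> complex \<Rightarrow> complex" where
  "scaling c z = c * z"

definition hat_param :: "('n::finite \<Rightarrow> nat) \<Rightarrow> real ^ 'n \<Rightarrow> real ^ 'n" where
  "hat_param idx \<epsilon> = (\<chi> i. (- 1) ^ (idx i + 1) * \<epsilon> $ i)"

end

theory Submission
  imports Defs "HOL-Computational_Algebra.Fundamental_Theorem_Algebra"
begin

text \<open>For \<open>k\<close> even, \<open>P\<^bsub>\<epsilon>'\<^esub>(z) = -P\<^sub>\<epsilon>(-z)\<close> with \<open>\<epsilon>'\<^sub>j = (-1)\<^sup>j\<^sup>+\<^sup>1 \<epsilon>\<^sub>j\<close>, and the prepared form is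
  preserved by the rotation.

  For \<open>k\<close> odd, a conjugacy maps the roots of \<open>P\<^sub>\<epsilon>\<close> (the fixed points of \<open>g\<^sub>\<epsilon>\<close>, which \<open>f\<^sub>\<epsilon>\<close>
  permutes by complex conjugation) to those of \<open>P\<^bsub>\<phi>(\<epsilon>)\<^esub>\<close>, and preserves the multipliers of \<open>g\<^sub>\<epsilon>\<close>,
  hence the eigenvalues of the canonical fields. Let \<open>W\<^sub>\<epsilon>\<close> be the polynomial of degree at most \<open>k\<close>
  interpolating \<open>H(\<cdot>,\<epsilon>)\<close> at the roots. For simple roots, preservation of eigenvalues says that
  \<open>(1 + b\<^sub>1 X\<^sup>k) P\<^bsub>\<phi>(\<epsilon>)\<^esub>(W\<^sub>\<epsilon>) - P\<^sub>\<epsilon> W\<^sub>\<epsilon>' (1 + b\<^sub>2 W\<^sub>\<epsilon>\<^sup>k)\<close> is divisible by \<open>P\<^sub>\<epsilon>\<^sup>2\<close>. In the limit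
  \<open>\<epsilon> \<rightarrow> 0\<close> this forces \<open>W\<^sub>0 = \<lambda>X\<close> with \<open>\<lambda>\<^sup>k = 1\<close>; as \<open>\<lambda>\<close> is real because \<open>H(\<cdot>,0)\<close> conjugates
  antiholomorphic germs, \<open>\<lambda> = 1\<close>. The linearization of the divisibility condition at \<open>W = X\<close> is
  injective modulo \<open>X\<^sup>2\<^sup>k\<^sup>+\<^sup>2\<close>, so \<open>\<phi>(\<epsilon>) = \<epsilon>\<close> for all small \<open>\<epsilon>\<close> with simple roots, and these
  are dense.\<close>

section \<open>Real-analytic maps\<close>

text \<open>Roots of P collide as \<epsilon> tends to 0, so no argument following individual roots
  survives the limit. Only the values of \<open>H\<close> at the roots matter, and \<open>W\<close>
  packs them into coefficients that do converge. Simple roots serve to turn pointwise eigenvalue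
  identities into divisibility by the square of P, a statement that is uniform in \<epsilon>. The
  unknowns are the k coefficients of the difference of the two parameter polynomials, the k + 1
  coefficients of W - X, and the difference of the two functions b: 2k + 2 in all, the degree of the
  square of P. Invariance of b is thus not presupposed. An implicit function argument is replaced by
  a comparison of orders: if g is the sum of the moduli of the unknowns, divisibility makes each
  unknown o(g), hence g = o(g), and g vanishes for small \<epsilon>. The direction X^(k+1), the
  infinitesimal flow of the limiting field and so a source of non-uniqueness, is excluded because W
  has degree at most k. Since f exchanges a root with its conjugate, a single derivative of f is not
  a conjugacy invariant; the relations at the two roots have to be combined.\<close>

text \<open>Coordinatewise reduction to the real line, where summability is absolute; the norm is
  dominated by the sum of the absolute coordinates.\<close>

lemma summable_on_imp_abs_summable_on_euclidean:
  fixes f :: "'i \<Rightarrow> 'b::euclidean_space"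
  assumes "f summable_on A"
  shows "(\<lambda>x. norm (f x)) summable_on A"
proof (rule Infinite_Sum.abs_summable_on_comparison_test')
  have *: "(\<lambda>x. \<bar>f x \<bullet> b\<bar>) summable_on A" for b
    using iffD1[OF summable_on_iff_abs_summable_on_real
        summable_on_bounded_linear[OF bounded_linear_inner_left assms, of b]] by simp
  have "(\<lambda>x. \<Sum>b\<in>B. \<bar>f x \<bullet> b\<bar>) summable_on A" if "finite B" for B
    using that *
    by (induction B rule: finite_induct) (auto intro: summable_on_add)
  then show "(\<lambda>x. \<Sum>b\<in>Basis. \<bar>f x \<bullet> b\<bar>) summable_on A"
    by simp
qed (rule norm_le_l1)

text \<open>The series at \<open>h\<close> is compared with the series at a point \<open>h0\<close>
  whose coordinates all equal \<open>t\<close>: a nonconstant monomial has a factor bounded by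
  \<open>norm h\<close>, and its other factors are at most \<open>t\<close>. Absolute convergence at
  \<open>h0\<close> then gives a Lipschitz bound at \<open>p\<close>.\<close>

lemma real_analytic_on_isCont:
  fixes f :: "'a::euclidean_space \<Rightarrow> 'b::euclidean_space"
  assumes "real_analytic_on f S" "p \<in> S"
  shows "isCont f p"
proof -
  define I where "I = {\<alpha>::'a \<Rightarrow> nat. \<forall>i. i \<notin> Basis \<longrightarrow> \<alpha> i = 0}"
  obtain c r where r: "r > 0"
    and sum: "\<And>h. norm h < r \<Longrightarrow> ((\<lambda>\<alpha>. (\<Prod>i\<in>Basis. (h \<bullet> i) ^ \<alpha> i) *\<^sub>R c \<alpha>) has_sum f (p + h)) I"
    using assms unfolding real_analytic_on_def I_def by blast
  \<comment> \<open>Chosen so that the diagonal point \<open>h0\<close> has norm at most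
    \<open>r / 2\<close>, inside the domain of convergence.\<close>
  define t where "t = r / (2 * (norm (\<Sum>Basis :: 'a) + 1))"
  have t: "t > 0" using r by (simp add: t_def add_nonneg_pos)
  define h0 :: 'a where "h0 = t *\<^sub>R \<Sum>Basis"
  have "norm h0 = r / 2 * (norm (\<Sum>Basis :: 'a) / (norm (\<Sum>Basis :: 'a) + 1))"
    using r by (simp add: h0_def t_def abs_of_nonneg)
  also have "\<dots> \<le> r / 2 * 1"
    using r by (intro mult_left_mono) (auto simp: field_simps add_nonneg_pos)
  finally have h0: "norm h0 < r" using r by simp
  define T where "T h \<alpha> = (\<Prod>i\<in>Basis. (h \<bullet> i) ^ \<alpha> i) *\<^sub>R c \<alpha>" for h \<alpha>
  have sumT: "(T h has_sum f (p + h)) I" if "norm h < r" for h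
    using sum[OF that] by (simp add: T_def[abs_def])
  define s where "s = infsum (\<lambda>\<alpha>. norm (T h0 \<alpha>)) I"
  have s: "((\<lambda>\<alpha>. norm (T h0 \<alpha>)) has_sum s) I"
    unfolding s_def using sumT[OF h0]
    by (intro has_sum_infsum summable_on_imp_abs_summable_on_euclidean) (auto simp: summable_on_def)
  have T0: "T h \<alpha> = T 0 \<alpha>" if "\<alpha> = (\<lambda>_. 0)" for h \<alpha>
    using that by (simp add: T_def)
  have h0i: "h0 \<bullet> i = t" if "i \<in> Basis" for i
    using that by (simp add: h0_def inner_sum_left_Basis)
  have bound: "norm (T h \<alpha> - T 0 \<alpha>) \<le> (norm h / t) * norm (T h0 \<alpha>)"
    if h: "norm h \<le> t" and \<alpha>: "\<alpha> \<in> I" for h \<alpha>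
  proof (cases "\<alpha> = (\<lambda>_. 0)")
    case True
    then show ?thesis using t by (simp add: T_def)
  next
    case False
    then obtain j where j: "\<alpha> j \<noteq> 0" by auto
    with \<alpha> have jB: "j \<in> Basis" by (auto simp: I_def)
    have "T 0 \<alpha> = 0"
      using j jB by (auto simp: T_def prod_zero_iff intro!: bexI[of _ j])
    have hi: "\<bar>h \<bullet> i\<bar> \<le> norm h" if "i \<in> Basis" for i
      using Basis_le_norm[OF that] .
    have hit: "\<bar>h \<bullet> i\<bar> \<le> t" if "i \<in> Basis" for i
      using hi[OF that] h by simp
    obtain n where n: "\<alpha> j = Suc n" using j not0_implies_Suc by blast
    have "\<bar>\<Prod>i\<in>Basis. (h \<bullet> i) ^ \<alpha> i\<bar> = \<bar>h \<bullet> j\<bar> ^ \<alpha> j * (\<Prod>i\<in>Basis - {j}. \<bar>h \<bullet> i\<bar> ^ \<alpha> i)"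
      using jB by (simp add: prod.remove[of _ j] abs_mult abs_prod power_abs)
    also have "\<bar>h \<bullet> j\<bar> ^ \<alpha> j \<le> norm h * t ^ n"
      unfolding n power_Suc using hi[OF jB] hit[OF jB] by (intro mult_mono power_mono) auto
    also have "(\<Prod>i\<in>Basis - {j}. \<bar>h \<bullet> i\<bar> ^ \<alpha> i) \<le> (\<Prod>i\<in>Basis - {j}. t ^ \<alpha> i)"
      using hit by (intro prod_mono) (auto intro!: power_mono)
    finally have "\<bar>\<Prod>i\<in>Basis. (h \<bullet> i) ^ \<alpha> i\<bar> \<le> norm h * t ^ n * (\<Prod>i\<in>Basis - {j}. t ^ \<alpha> i)"
      using t by (simp add: mult_left_mono mult_right_mono prod_nonneg)
    also have "\<dots> = (norm h / t) * (\<Prod>i\<in>Basis. t ^ \<alpha> i)"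
      using jB t by (simp add: prod.remove[of _ j] n field_simps)
    also have "(\<Prod>i\<in>Basis. t ^ \<alpha> i) = \<bar>\<Prod>i\<in>Basis. (h0 \<bullet> i) ^ \<alpha> i\<bar>"
      using t by (simp add: h0i abs_prod power_abs)
    finally have "\<bar>\<Prod>i\<in>Basis. (h \<bullet> i) ^ \<alpha> i\<bar> * norm (c \<alpha>)
        \<le> (norm h / t) * \<bar>\<Prod>i\<in>Basis. (h0 \<bullet> i) ^ \<alpha> i\<bar> * norm (c \<alpha>)"
      by (intro mult_right_mono) auto
    then show ?thesis
      unfolding \<open>T 0 \<alpha> = 0\<close> by (simp add: T_def)
  qed
  have lip: "norm (f (p + h) - f p) \<le> (norm h / t) * s" if "norm h \<le> t" "norm h < r" for h
  proof (rule norm_infsum_le)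
    show "((\<lambda>\<alpha>. T h \<alpha> - T 0 \<alpha>) has_sum (f (p + h) - f p)) I"
      using has_sum_add[OF sumT[OF that(2)] has_sum_scaleR[OF sumT[of 0], of "-1"]] r by simp
    show "((\<lambda>\<alpha>. (norm h / t) * norm (T h0 \<alpha>)) has_sum (norm h / t) * s) I"
      by (intro has_sum_cmult_right s)
  qed (use bound that in auto)
  have "((\<lambda>h. f (p + h) - f p) \<longlongrightarrow> 0) (at 0)"
  proof (rule Lim_null_comparison)
    show "\<forall>\<^sub>F h in at 0. norm (f (p + h) - f p) \<le> (norm h / t) * s"
      unfolding eventually_at using lip t r by (intro exI[of _ "min t r"]) auto
    show "((\<lambda>h::'a. (norm h / t) * s) \<longlongrightarrow> 0) (at 0)"
      using t by (auto intro!: tendsto_eq_intros)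
  qed
  then show ?thesis
    unfolding isCont_iff using LIM_zero_iff by blast
qed

lemma real_analytic_on_linear:
  fixes f :: "'a::euclidean_space \<Rightarrow> 'b::euclidean_space"
  assumes "linear f"
  shows "real_analytic_on f S"
proof -
  \<comment> \<open>The unit multi-indices. Together with the zero multi-index they carry the whole
    expansion, so the sum is finite and any radius serves.\<close>
  define e :: "'a \<Rightarrow> 'a \<Rightarrow> nat" where "e = (\<lambda>i j. if j = i then 1 else 0)"
  have inj: "inj e" unfolding e_def inj_def by (metis zero_neq_one)
  have e0: "e i \<noteq> (\<lambda>_. 0)" for i unfolding e_def fun_eq_iff by (auto intro!: exI[of _ i])
  then have n0: "(\<lambda>_. 0) \<notin> e ` Basis" by (metis imageE)
  show ?thesis
    unfolding real_analytic_on_def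
  proof (intro ballI exI conjI allI impI)
    fix p h :: 'a
    let ?c = "\<lambda>\<alpha>. if \<alpha> = (\<lambda>_. 0) then f p else if \<alpha> \<in> e ` Basis then f (inv e \<alpha>) else 0"
    have pr: "(\<Prod>i\<in>Basis. (h \<bullet> i) ^ e j i) = h \<bullet> j" if "j \<in> Basis" for j
      using that by (simp add: e_def if_distrib prod.remove[of _ j] cong: if_cong)
    have "f (p + h) = f p + (\<Sum>i\<in>Basis. (h \<bullet> i) *\<^sub>R f i)"
      unfolding linear_add[OF assms]
      by (subst (1) euclidean_representation[of h, symmetric])
        (simp only: linear_sum[OF assms] linear_scale[OF assms])
    also have "(\<Sum>i\<in>Basis. (h \<bullet> i) *\<^sub>R f i) =
        (\<Sum>\<alpha>\<in>e ` Basis. (\<Prod>i\<in>Basis. (h \<bullet> i) ^ \<alpha> i) *\<^sub>R ?c \<alpha>)"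
      using inj by (subst sum.reindex) (auto simp: pr e0 inj_on_def inj_def intro!: sum.cong)
    also have "f p + \<dots> = (\<Sum>\<alpha>\<in>insert (\<lambda>_. 0) (e ` Basis). (\<Prod>i\<in>Basis. (h \<bullet> i) ^ \<alpha> i) *\<^sub>R ?c \<alpha>)"
      using n0 by (subst sum.insert) auto
    finally show "((\<lambda>\<alpha>. (\<Prod>i\<in>Basis. (h \<bullet> i) ^ \<alpha> i) *\<^sub>R ?c \<alpha>) has_sum f (p + h))
        {\<alpha>. \<forall>i. i \<notin> Basis \<longrightarrow> \<alpha> i = 0}"
      by (intro has_sum_finite_neutralI[of "insert (\<lambda>_. 0) (e ` Basis)"]) (auto simp: e_def)
  qed (rule zero_less_one)
qed

lemma real_analytic_on_scaleR:
  assumes "real_analytic_on f S"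
  shows "real_analytic_on (\<lambda>x. a *\<^sub>R f x) S"
  unfolding real_analytic_on_def
proof
  fix p assume "p \<in> S"
  then obtain c r where "r > 0" and *: "\<And>h. norm h < r \<Longrightarrow>
     ((\<lambda>\<alpha>. (\<Prod>i\<in>Basis. (h \<bullet> i) ^ \<alpha> i) *\<^sub>R c \<alpha>) has_sum f (p + h)) {\<alpha>. \<forall>i. i \<notin> Basis \<longrightarrow> \<alpha> i = 0}"
    using assms unfolding real_analytic_on_def by blast
  show "\<exists>c r. r > 0 \<and> (\<forall>h. norm h < r \<longrightarrow>
     ((\<lambda>\<alpha>. (\<Prod>i\<in>Basis. (h \<bullet> i) ^ \<alpha> i) *\<^sub>R c \<alpha>) has_sum a *\<^sub>R f (p + h)) {\<alpha>. \<forall>i. i \<notin> Basis \<longrightarrow> \<alpha> i = 0})"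
    using \<open>r > 0\<close> has_sum_scaleR[OF *, of _ a]
    by (intro exI[of _ "\<lambda>\<alpha>. a *\<^sub>R c \<alpha>"] exI[of _ r]) (auto simp: mult.commute)
qed

text \<open>A diagonal substitution only multiplies the coefficient of each monomial by a product of
  powers of the \<open>s i\<close>, so the series need not be rearranged;
  \<open>\<bar>s i\<bar> \<le> 1\<close> preserves the radius. The sign changes of the rotation are
  of this kind.\<close>

lemma real_analytic_on_diagonal:
  fixes f :: "'a::euclidean_space \<Rightarrow> 'b::euclidean_space"
  assumes "real_analytic_on f S" "linear L" "L ` S' \<subseteq> S"
    and L: "\<And>h i. i \<in> Basis \<Longrightarrow> L h \<bullet> i = s i * (h \<bullet> i)" and s: "\<And>i. i \<in> Basis \<Longrightarrow> \<bar>s i\<bar> \<le> 1"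
  shows "real_analytic_on (\<lambda>x. f (L x)) S'"
  unfolding real_analytic_on_def
proof
  fix p assume "p \<in> S'"
  then obtain c r where "r > 0" and *: "\<And>h. norm h < r \<Longrightarrow>
     ((\<lambda>\<alpha>. (\<Prod>i\<in>Basis. (h \<bullet> i) ^ \<alpha> i) *\<^sub>R c \<alpha>) has_sum f (L p + h)) {\<alpha>. \<forall>i. i \<notin> Basis \<longrightarrow> \<alpha> i = 0}"
    using assms unfolding real_analytic_on_def by blast
  have "norm (L h) \<le> norm h" for h
    using L s by (intro norm_le_componentwise) (auto simp: abs_mult mult_left_le_one_le)
  moreover have "(\<Prod>i\<in>Basis. (L h \<bullet> i) ^ \<alpha> i) =
      (\<Prod>i\<in>Basis. (h \<bullet> i) ^ \<alpha> i) * (\<Prod>i\<in>Basis. s i ^ \<alpha> i)" for h \<alpha>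
    by (subst prod.distrib[symmetric], rule prod.cong) (auto simp: L power_mult_distrib)
  ultimately have "((\<lambda>\<alpha>. (\<Prod>i\<in>Basis. (h \<bullet> i) ^ \<alpha> i) *\<^sub>R ((\<Prod>i\<in>Basis. s i ^ \<alpha> i) *\<^sub>R c \<alpha>))
      has_sum f (L (p + h))) {\<alpha>. \<forall>i. i \<notin> Basis \<longrightarrow> \<alpha> i = 0}" if "norm h < r" for h
    using *[of "L h"] that by (simp add: linear_add[OF \<open>linear L\<close>] le_less_trans[of "norm (L h)" "norm h"])
  then show "\<exists>c r. r > 0 \<and> (\<forall>h. norm h < r \<longrightarrow>
     ((\<lambda>\<alpha>. (\<Prod>i\<in>Basis. (h \<bullet> i) ^ \<alpha> i) *\<^sub>R c \<alpha>) has_sum f (L (p + h))) {\<alpha>. \<forall>i. i \<notin> Basis \<longrightarrow> \<alpha> i = 0})"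
    using \<open>r > 0\<close>
    by (intro exI[of _ "\<lambda>\<alpha>. (\<Prod>i\<in>Basis. s i ^ \<alpha> i) *\<^sub>R c \<alpha>"] exI[of _ r] conjI allI impI)
qed

lemma isCont_tendsto_nhds: "isCont f x \<Longrightarrow> (f \<longlongrightarrow> f x) (nhds x)"
  unfolding isCont_def by (subst (asm) tendsto_at_iff_tendsto_nhds)

section \<open>Coefficientwise asymptotics of polynomials\<close>

text \<open>Each coefficient is estimated separately, with no bound on the degree: a coefficient of
  a product is a finite sum, so the usual product rules survive. The gauge \<open>g\<close> is
  complex because Landau symbols compare functions with the same codomain.\<close>

definition coeff_bigo :: "'a filter \<Rightarrow> ('a \<Rightarrow> complex) \<Rightarrow> ('a \<Rightarrow> complex poly) set" where
  "coeff_bigo F g = {X. \<forall>m. (\<lambda>a. coeff (X a) m) \<in> O[F](g)}"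

definition coeff_smallo :: "'a filter \<Rightarrow> ('a \<Rightarrow> complex) \<Rightarrow> ('a \<Rightarrow> complex poly) set" where
  "coeff_smallo F g = {X. \<forall>m. (\<lambda>a. coeff (X a) m) \<in> o[F](g)}"

lemma coeff_smallo_imp_bigo: "X \<in> coeff_smallo F g \<Longrightarrow> X \<in> coeff_bigo F g"
  by (auto simp: coeff_smallo_def coeff_bigo_def intro: landau_o.small_imp_big)

lemma coeff_bigo_add:
  "X \<in> coeff_bigo F g \<Longrightarrow> Y \<in> coeff_bigo F g \<Longrightarrow> (\<lambda>a. X a + Y a) \<in> coeff_bigo F g"
  by (simp add: coeff_bigo_def sum_in_bigo)

lemma coeff_bigo_diff:
  "X \<in> coeff_bigo F g \<Longrightarrow> Y \<in> coeff_bigo F g \<Longrightarrow> (\<lambda>a. X a - Y a) \<in> coeff_bigo F g"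
  by (simp add: coeff_bigo_def sum_in_bigo)

lemma coeff_smallo_add:
  "X \<in> coeff_smallo F g \<Longrightarrow> Y \<in> coeff_smallo F g \<Longrightarrow> (\<lambda>a. X a + Y a) \<in> coeff_smallo F g"
  by (simp add: coeff_smallo_def sum_in_smallo)

lemma coeff_smallo_diff:
  "X \<in> coeff_smallo F g \<Longrightarrow> Y \<in> coeff_smallo F g \<Longrightarrow> (\<lambda>a. X a - Y a) \<in> coeff_smallo F g"
  by (simp add: coeff_smallo_def sum_in_smallo)

lemma coeff_smallo_sum:
  "(\<And>i. i \<in> A \<Longrightarrow> X i \<in> coeff_smallo F g) \<Longrightarrow> (\<lambda>a. \<Sum>i\<in>A. X i a) \<in> coeff_smallo F g"
  by (simp add: coeff_smallo_def coeff_sum big_sum_in_smallo)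

lemma coeff_bigo_mult:
  assumes "X \<in> coeff_bigo F (\<lambda>_. 1)" "Y \<in> coeff_bigo F g"
  shows "(\<lambda>a. X a * Y a) \<in> coeff_bigo F g"
  using assms landau_o.big.mult[of _ F "\<lambda>_. 1" _ g]
  by (auto simp: coeff_bigo_def coeff_mult intro!: big_sum_in_bigo)

lemma coeff_smallo_bigo_mult:
  assumes "X \<in> coeff_smallo F (\<lambda>_. 1)" "Y \<in> coeff_bigo F g"
  shows "(\<lambda>a. X a * Y a) \<in> coeff_smallo F g"
  using assms landau_o.small_big_mult[of _ F "\<lambda>_. 1" _ g]
  by (auto simp: coeff_bigo_def coeff_smallo_def coeff_mult intro!: big_sum_in_smallo)

lemma coeff_bigo_smallo_mult:
  assumes "X \<in> coeff_bigo F (\<lambda>_. 1)" "Y \<in> coeff_smallo F g"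
  shows "(\<lambda>a. X a * Y a) \<in> coeff_smallo F g"
  using assms landau_o.big_small_mult[of _ F "\<lambda>_. 1" _ g]
  by (auto simp: coeff_bigo_def coeff_smallo_def coeff_mult intro!: big_sum_in_smallo)

lemma coeff_bigo_const: "(\<lambda>_. p) \<in> coeff_bigo F (\<lambda>_. 1)"
  by (simp add: coeff_bigo_def)

lemma coeff_bigo_power:
  "X \<in> coeff_bigo F (\<lambda>_. 1) \<Longrightarrow> (\<lambda>a. X a ^ n) \<in> coeff_bigo F (\<lambda>_. 1)"
  by (induction n) (auto intro: coeff_bigo_const coeff_bigo_mult)

lemma coeff_bigo_pderiv: "X \<in> coeff_bigo F g \<Longrightarrow> (\<lambda>a. pderiv (X a)) \<in> coeff_bigo F g"
  by (simp add: coeff_bigo_def coeff_pderiv)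

lemma coeff_smallo_pderiv: "X \<in> coeff_smallo F g \<Longrightarrow> (\<lambda>a. pderiv (X a)) \<in> coeff_smallo F g"
  by (simp add: coeff_smallo_def coeff_pderiv)

lemma coeff_bigo_monom:
  assumes "c \<in> O[F](g)"
  shows "(\<lambda>a. monom (c a) n) \<in> coeff_bigo F g"
proof -
  have "(\<lambda>a. coeff (monom (c a) n) m) \<in> O[F](g)" for m
    using assms by (cases "n = m") auto
  then show ?thesis by (simp add: coeff_bigo_def)
qed

lemma coeff_smallo_monom:
  assumes "c \<in> o[F](g)"
  shows "(\<lambda>a. monom (c a) n) \<in> coeff_smallo F g"
proof -
  have "(\<lambda>a. coeff (monom (c a) n) m) \<in> o[F](g)" for m
    using assms by (cases "n = m") auto
  then show ?thesis by (simp add: coeff_smallo_def)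
qed

text \<open>Only the coefficients of index at least \<open>n\<close> of the multiple enter the recursion for the quotient,
  and the remaining ones are then small because \<open>B\<close> degenerates to \<open>X\<^sup>n\<close>.\<close>

lemma low_coeffs_smallo_of_dvd:
  fixes B E :: "'a \<Rightarrow> complex poly"
  assumes B: "(\<lambda>a. B a - monom 1 n) \<in> coeff_smallo F (\<lambda>_. 1)"
    and degB: "\<And>a. degree (B a) = n" "\<And>a. lead_coeff (B a) = 1"
    and E: "E \<in> coeff_bigo F g" "\<And>a. degree (E a) \<le> N"
    and dvd: "\<forall>\<^sub>F a in F. B a dvd E a" and "m < n"
  shows "(\<lambda>a. coeff (E a) m) \<in> o[F](g)"
proof -
  define K where "K a = E a div B a" for a
  have EK: "\<forall>\<^sub>F a in F. E a = B a * K a"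
    using dvd by eventually_elim (simp add: K_def)
  have Bn: "coeff (B a) n = 1" for a
    using degB[of a] by simp
  have Bi: "(\<lambda>a. coeff (B a) i) \<in> o[F](\<lambda>_. 1)" if "i < n" for i
    using B that by (auto simp: coeff_smallo_def dest: spec[of _ i])
  have degK: "coeff (K a) j = 0" if "j > N" for a j
  proof (cases "K a = 0")
    case False
    have "B a \<noteq> 0" using degB(2)[of a] by auto
    have "degree (K a) \<le> degree (E a)"
    proof (cases "degree (E a) < degree (B a)")
      case True
      then show ?thesis using False by (simp add: K_def div_poly_less)
    next
      case nless: False
      have "degree (B a * K a) = degree (B a) + degree (K a)"
        using \<open>B a \<noteq> 0\<close> False by (rule degree_mult_eq)
      moreover have "degree (B a * K a) \<le> degree (E a)"
        using minus_mod_eq_mult_div[of "E a" "B a"] degree_mod_less[OF \<open>B a \<noteq> 0\<close>, of "E a"] nless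
          degree_diff_le[of "E a" "degree (E a)" "E a mod B a"]
        by (auto simp: K_def)
      ultimately show ?thesis by simp
    qed
    then show ?thesis using that E(2)[of a] by (intro coeff_eq_0) simp
  qed simp
  \<comment> \<open>Downward induction on \<open>j\<close>, starting above \<open>N\<close>, where
    the coefficients vanish. As \<open>B\<close> is monic, coefficient \<open>j\<close> of the
    quotient is obtained from coefficient \<open>n + j\<close> of \<open>E\<close> and higher
    coefficients of \<open>K\<close> without any division.\<close>
  have K: "(\<lambda>a. coeff (K a) j) \<in> O[F](g)" for j
  proof (induction "N - j" arbitrary: j rule: less_induct)
    case less
    show ?case
    proof (cases "j > N")
      case True
      then show ?thesis by (simp add: degK)
    next
      case False
      have IH: "(\<lambda>a. coeff (K a) (n + j - i)) \<in> O[F](g)" if "i < n" for i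
        using less[of "n + j - i"] that False by (cases "n + j - i > N") (simp_all add: degK)
      have "\<forall>\<^sub>F a in F. coeff (K a) j = coeff (E a) (n + j) - (\<Sum>i<n. coeff (B a) i * coeff (K a) (n + j - i))"
        using EK
      proof eventually_elim
        case (elim a)
        have "coeff (E a) (n + j) = (\<Sum>i\<le>n + j. coeff (B a) i * coeff (K a) (n + j - i))"
          by (simp add: elim coeff_mult)
        also have "\<dots> = (\<Sum>i\<le>n. coeff (B a) i * coeff (K a) (n + j - i))"
          by (intro sum.mono_neutral_right) (auto simp: coeff_eq_0 degB)
        also have "\<dots> = (\<Sum>i<n. coeff (B a) i * coeff (K a) (n + j - i)) + coeff (K a) j"
          by (simp add: Bn flip: lessThan_Suc_atMost)
        finally show ?case by simp
      qed
      moreover have "(\<lambda>a. coeff (E a) (n + j) - (\<Sum>i<n. coeff (B a) i * coeff (K a) (n + j - i))) \<in> O[F](g)"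
        using E(1) landau_o.big.mult[OF landau_o.small_imp_big[OF Bi] IH]
        by (intro sum_in_bigo big_sum_in_bigo) (auto simp: coeff_bigo_def)
      ultimately show ?thesis
        by (subst landau_o.big.in_cong)
    qed
  qed
  have "\<forall>\<^sub>F a in F. coeff (E a) m = (\<Sum>i\<le>m. coeff (B a) i * coeff (K a) (m - i))"
    using EK by eventually_elim (simp add: coeff_mult)
  moreover have "(\<lambda>a. \<Sum>i\<le>m. coeff (B a) i * coeff (K a) (m - i)) \<in> o[F](g)"
    using landau_o.small_big_mult[OF Bi K] \<open>m < n\<close> by (intro big_sum_in_smallo) auto
  ultimately show ?thesis
    by (subst landau_o.small.in_cong)
qed

lemma coeff_bigo_power_diff:
  assumes "W \<in> coeff_bigo F (\<lambda>_. 1)" "V \<in> coeff_bigo F (\<lambda>_. 1)" "(\<lambda>a. W a - V a) \<in> coeff_bigo F g"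
  shows "(\<lambda>a. W a ^ n - V a ^ n) \<in> coeff_bigo F g"
proof (induction n)
  case (Suc n)
  have "(\<lambda>a. W a * (W a ^ n - V a ^ n) + V a ^ n * (W a - V a)) \<in> coeff_bigo F g"
    by (intro coeff_bigo_add coeff_bigo_mult coeff_bigo_power assms Suc)
  then show ?case by (simp add: algebra_simps)
qed (simp add: coeff_bigo_def)

lemma coeff_smallo_power_diff:
  assumes "W \<in> coeff_bigo F (\<lambda>_. 1)" "V \<in> coeff_bigo F (\<lambda>_. 1)" "(\<lambda>a. W a - V a) \<in> coeff_smallo F g"
  shows "(\<lambda>a. W a ^ n - V a ^ n) \<in> coeff_smallo F g"
proof (induction n)
  case (Suc n)
  have "(\<lambda>a. W a * (W a ^ n - V a ^ n) + V a ^ n * (W a - V a)) \<in> coeff_smallo F g"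
    by (intro coeff_smallo_add coeff_bigo_smallo_mult coeff_bigo_power assms Suc)
  then show ?case by (simp add: algebra_simps)
qed (simp add: coeff_smallo_def)

text \<open>The remainder for \<open>Suc n\<close> is \<open>W\<close> times the remainder for
  \<open>n\<close> plus \<open>n V^(n-1) (W - V)^2\<close>. The square is o(1) times O(g), which is
  how quadratic terms disappear against the gauge.\<close>

lemma coeff_smallo_power_linearization:
  assumes W: "(\<lambda>a. W a - V) \<in> coeff_smallo F (\<lambda>_. 1)" "(\<lambda>a. W a - V) \<in> coeff_bigo F g"
  shows "(\<lambda>a. W a ^ n - V ^ n - of_nat n * V ^ (n - 1) * (W a - V)) \<in> coeff_smallo F g"
proof (induction n)
  case (Suc n)
  have WO: "W \<in> coeff_bigo F (\<lambda>_. 1)"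
    using coeff_bigo_add[OF coeff_smallo_imp_bigo[OF W(1)] coeff_bigo_const[of V]] by simp
  have "(\<lambda>a. W a * (W a ^ n - V ^ n - of_nat n * V ^ (n - 1) * (W a - V))
      + (of_nat n * V ^ (n - 1)) * ((W a - V) * (W a - V))) \<in> coeff_smallo F g"
    by (intro coeff_smallo_add coeff_bigo_smallo_mult[OF WO Suc]
        coeff_bigo_smallo_mult[OF coeff_bigo_const coeff_smallo_bigo_mult[OF W]])
  moreover have "W a * (W a ^ n - V ^ n - of_nat n * V ^ (n - 1) * (W a - V))
      + (of_nat n * V ^ (n - 1)) * ((W a - V) * (W a - V))
      = W a ^ Suc n - V ^ Suc n - of_nat (Suc n) * V ^ (Suc n - 1) * (W a - V)" for a
    by (cases n) (simp_all add: algebra_simps)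
  ultimately show ?case by simp
qed (simp add: coeff_smallo_def)

text \<open>With a degree bound fixed in advance, the number of summands does not vary along a
  family and the Landau rules apply term by term.\<close>

lemma pcompose_eq_sum:
  fixes p q :: "'a::comm_ring_1 poly"
  assumes "degree p < k"
  shows "pcompose p q = (\<Sum>j<k. [:coeff p j:] * q ^ j)"
proof -
  have "p = (\<Sum>j<k. monom (coeff p j) j)"
    using poly_as_sum_of_monoms'[of p "k - 1"] assms by (simp add: lessThan_Suc_atMost[symmetric] flip: lessThan_Suc_atMost)
  then have "pcompose p q = pcompose (\<Sum>j<k. monom (coeff p j) j) q" by simp
  also have "\<dots> = (\<Sum>j<k. pcompose (monom (coeff p j) j) q)"
    by (simp add: pcompose_sum)
  also have "\<dots> = (\<Sum>j<k. [:coeff p j:] * q ^ j)"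
    by (simp add: pcompose_altdef map_poly_monom poly_monom)
  finally show ?thesis .
qed

text \<open>For \<open>V = 1 + v X^m + ...\<close> only the two extreme terms of the Cauchy product
  \<open>V * V^n\<close> reach index \<open>m\<close>.\<close>

lemma coeff_power_first_nonzero:
  fixes V :: "'a::comm_ring_1 poly"
  assumes "coeff V 0 = 1" "\<And>i. 0 < i \<Longrightarrow> i < m \<Longrightarrow> coeff V i = 0" "m > 0"
  shows "coeff (V ^ n) m = of_nat n * coeff V m"
proof (induction n)
  case (Suc n)
  have "coeff (V ^ Suc n) m = (\<Sum>i\<le>m. coeff V i * coeff (V ^ n) (m - i))"
    by (simp add: coeff_mult)
  also have "\<dots> = (\<Sum>i\<in>{0, m}. coeff V i * coeff (V ^ n) (m - i))"
    using assms(2) by (intro sum.mono_neutral_right) auto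
  also have "\<dots> = of_nat (Suc n) * coeff V m"
    using assms(1,3) by (simp add: Suc coeff_0_power algebra_simps)
  finally show ?case .
qed (use assms(3) in simp)

text \<open>The limiting case: \<open>W\<close> carries the field
  \<open>X^(k+1) / (1 + c X^k)\<close> to the one with \<open>d\<close>, modulo
  \<open>X^(2k+2)\<close>. With \<open>W = X V\<close>, removing the common factor
  \<open>X^(k+1)\<close> leaves k + 1 conditions: index 0 gives \<open>V(0)^k = 1\<close>, index
  \<open>m < k\<close> gives \<open>(k - m) v_m = 0\<close>, and index k gives
  \<open>c = d\<close>.\<close>

lemma jet_of_conjugacy_of_monomials:
  fixes W :: "complex poly"
  assumes "k > 0" and deg: "degree W \<le> k"
    and W1: "coeff W 1 \<noteq> 0" "coeff W 1 ^ k = 1 \<Longrightarrow> coeff W 1 = 1"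
    and low: "\<And>m. m < 2 * k + 2 \<Longrightarrow> coeff ((1 + monom c k) * W ^ (k + 1)
        - monom 1 (k + 1) * pderiv W * (1 + [:d:] * W ^ k)) m = 0"
  shows "W = monom 1 1" and "c = d"
proof -
  have "coeff W 0 ^ (k + 1) = 0"
    using low[of 0] \<open>k > 0\<close> by (simp add: coeff_mult_0 coeff_0_power mult.assoc)
  then have W0: "coeff W 0 = 0" by auto
  then obtain V where V: "W = pCons 0 V"
    by (metis coeff_pCons_0 pCons_cases)
  then have WV: "W = monom 1 1 * V" by (simp add: monom_Suc)
  define B where "B = (1 + monom c k) * V ^ (k + 1) - (V + monom 1 1 * pderiv V) * (1 + monom d k * V ^ k)"
  have "(1 + monom c k) * W ^ (k + 1) - monom 1 (k + 1) * pderiv W * (1 + [:d:] * W ^ k)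
      = monom 1 (k + 1) * B"
  proof -
    have "pderiv W = V + monom 1 1 * pderiv V"
      by (simp add: V pderiv_pCons monom_Suc)
    moreover have "W ^ (k + 1) = monom 1 (k + 1) * V ^ (k + 1)"
      by (simp add: WV power_mult_distrib monom_power flip: power_Suc)
    moreover have "[:d:] * W ^ k = monom d k * V ^ k"
    proof -
      have "[:d:] * W ^ k = ([:d:] * monom 1 k) * V ^ k"
        unfolding WV power_mult_distrib monom_power mult.assoc by simp
      then show ?thesis by (simp add: smult_monom)
    qed
    ultimately show ?thesis
      by (simp only: B_def) (simp add: algebra_simps)
  qed
  then have B: "coeff B m = 0" if "m \<le> k" for m
    using low[of "m + k + 1"] that by (simp add: coeff_monom_mult)
  have VX: "coeff (V + monom 1 1 * pderiv V) m = of_nat (Suc m) * coeff V m" for m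
    by (cases m) (simp_all add: monom_Suc monom_0 coeff_pderiv ring_distribs)
  have V0: "coeff V 0 = 1"
  proof -
    have "coeff B 0 = coeff V 0 ^ (k + 1) - coeff V 0"
      using \<open>k > 0\<close> by (simp add: B_def coeff_mult_0 coeff_0_power)
    then have "coeff W 1 ^ k = 1" using B[of 0] W1(1) by (simp add: V)
    then show ?thesis using W1(2) by (simp add: V)
  qed
  have B_eq: "B = V ^ (k + 1) + monom c k * V ^ (k + 1)
      - (V + monom 1 1 * pderiv V + monom d k * ((V + monom 1 1 * pderiv V) * V ^ k))"
    unfolding B_def by algebra
  have V: "coeff V m = 0" if "0 < m" "m < k" for m
    using that
  proof (induction m rule: less_induct)
    case (less m)
    have "coeff B m = coeff (V ^ (k + 1)) m - coeff (V + monom 1 1 * pderiv V) m"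
      using less.prems by (simp only: B_eq coeff_add coeff_diff coeff_monom_mult) simp
    also have "\<dots> = of_nat (k + 1) * coeff V m - of_nat (Suc m) * coeff V m"
      unfolding VX using less by (subst coeff_power_first_nonzero[OF V0]) auto
    also have "\<dots> = of_nat (k - m) * coeff V m"
      using less.prems by (simp add: of_nat_diff algebra_simps)
    finally show ?case using B[of m] less.prems by simp
  qed
  \<comment> \<open>The factor \<open>k - m\<close> gives no information at \<open>m = k\<close>,
    the resonance coming from the flow of the field. There the bound \<open>degree W \<le> k\<close>
    takes over.\<close>
  have "coeff V m = (if m = 0 then 1 else 0)" for m
    using V[of m] V0 coeff_eq_0[of W "Suc m"] deg \<open>W = pCons 0 V\<close> \<open>k > 0\<close>
    by (cases "m < k") auto
  then have "V = 1" by (simp add: poly_eq_iff)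
  then show "W = monom 1 1" using WV by simp
  have "B = monom c k - monom d k" using \<open>V = 1\<close> by (simp add: B_def algebra_simps)
  then show "c = d" using B[of k] by simp
qed

text \<open>Modulo the square of \<open>P = X\<^sup>k\<^sup>+\<^sup>1 + p\<close>, the divisibility hypothesis says that \<open>W\<close> maps the zeros of
  \<open>P/(1 + b1 X\<^sup>k)\<close> to zeros of \<open>(X\<^sup>k\<^sup>+\<^sup>1 + p')/(1 + b2 X\<^sup>k)\<close> with the same eigenvalues. Linearized at
  \<open>p = p' = 0\<close>, \<open>W = X\<close>, it determines \<open>p' - p\<close>, \<open>W - X\<close> and \<open>b1 - b2\<close> injectively: they
  appear in the coefficients of index \<open>0, \<dots>, k - 1\<close>, then \<open>k, \<dots>, 2k\<close>, then \<open>2k + 1\<close>.\<close>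

lemma eventually_eq_of_square_dvd:
  fixes p p' W :: "'a \<Rightarrow> complex poly" and F :: "'a filter"
  assumes "F \<noteq> bot" "k > 0"
    and deg: "\<And>a. degree (p a) < k" "\<And>a. degree (p' a) < k" "\<And>a. degree (W a) \<le> k"
    and p: "p \<in> coeff_smallo F (\<lambda>_. 1)" and p': "p' \<in> coeff_smallo F (\<lambda>_. 1)"
    and W: "\<And>j. ((\<lambda>a. coeff (W a) j) \<longlongrightarrow> \<omega> j) F" "\<omega> 1 \<noteq> 0" "\<omega> 1 ^ k = 1 \<Longrightarrow> \<omega> 1 = 1"
    and b: "(b1 \<longlongrightarrow> c1) F" "(b2 \<longlongrightarrow> c2) F"
    and dvd: "\<forall>\<^sub>F a in F. (monom 1 (k + 1) + p a) ^ 2 dvd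
      (1 + monom (b1 a) k) * (W a ^ (k + 1) + pcompose (p' a) (W a))
        - (monom 1 (k + 1) + p a) * pderiv (W a) * (1 + [:b2 a:] * W a ^ k)"
  shows "\<forall>\<^sub>F a in F. p a = p' a"
proof -
  define E where "E a = (1 + monom (b1 a) k) * (W a ^ (k + 1) + pcompose (p' a) (W a))
        - (monom 1 (k + 1) + p a) * pderiv (W a) * (1 + [:b2 a:] * W a ^ k)" for a
  \<comment> \<open>Any bound uniform in \<open>a\<close> would do. The first product has degree at
    most \<open>k + (k + 1) * k\<close>; the last \<open>k\<close> makes room for the second, of
    degree at most \<open>(k + 1) + k + k * k\<close>.\<close>
  define N where "N = k + (k + 1) * k + k"
  have degE: "degree (E a) \<le> N" for a
  proof -
    have 1: "degree (1 + monom (b1 a) k) \<le> k"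
      by (intro degree_add_le) (auto intro: degree_monom_le)
    have pw: "degree (W a ^ j) \<le> j * k" for j
      using order.trans[OF degree_power_le[of "W a" j] mult_le_mono1[OF deg(3)[of a]]]
      by (simp add: mult.commute)
    have 2: "degree (W a ^ (k + 1) + pcompose (p' a) (W a)) \<le> (k + 1) * k"
      using order.trans[OF degree_pcompose_le mult_le_mono[of "degree (p' a)" "k + 1" "degree (W a)" k]]
        deg(2)[of a] deg(3)[of a] pw[of "k + 1"]
      by (intro degree_add_le) simp_all
    have 3: "degree ((monom 1 (k + 1) + p a) * pderiv (W a)) \<le> (k + 1) + k"
      using deg(1)[of a] deg(3)[of a]
      by (intro order.trans[OF degree_mult_le] add_mono degree_add_le)
        (use \<open>k > 0\<close> in \<open>auto simp: degree_monom_eq degree_pderiv\<close>)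
    have 4: "degree (1 + [:b2 a:] * W a ^ k) \<le> k * k"
      using pw[of k] by (intro degree_add_le) (auto intro: order.trans[OF degree_smult_le])
    show ?thesis
      unfolding E_def N_def
      by (intro degree_diff_le order.trans[OF degree_mult_le] order.trans[OF add_mono[OF 1 2]]
          order.trans[OF add_mono[OF 3 4]]) (use \<open>k > 0\<close> in \<open>simp_all add: algebra_simps\<close>)
  qed
  let ?B = "\<lambda>a. (monom 1 (k + 1) + p a) ^ 2"
  have P: "degree (monom 1 (k + 1) + p a) = k + 1" "lead_coeff (monom 1 (k + 1) + p a) = 1" for a
  proof -
    show d: "degree (monom 1 (k + 1) + p a) = k + 1"
      using deg(1)[of a] by (subst degree_add_eq_left) (auto simp: degree_monom_eq)
    show "lead_coeff (monom 1 (k + 1) + p a) = 1"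
      unfolding d using deg(1)[of a] by (simp add: coeff_eq_0)
  qed
  have B: "degree (?B a) = 2 * k + 2" "lead_coeff (?B a) = 1" for a
  proof -
    show "degree (?B a) = 2 * k + 2"
      using P(1)[of a] by (subst degree_power_eq) (metis add_is_0 degree_0 one_neq_zero, simp)
    show "lead_coeff (?B a) = 1"
      by (simp only: lead_coeff_power P(2) power_one)
  qed
  have PO: "(\<lambda>a. monom 1 (k + 1) + p a) \<in> coeff_bigo F (\<lambda>_. 1)"
    by (intro coeff_bigo_add coeff_bigo_const coeff_smallo_imp_bigo p)
  have B0: "(\<lambda>a. ?B a - monom 1 (2 * k + 2)) \<in> coeff_smallo F (\<lambda>_. 1)"
    using coeff_smallo_power_diff[OF PO coeff_bigo_const[of "monom 1 (k + 1)"], where n = 2] p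
    by (simp add: monom_power mult.commute)
  note low = low_coeffs_smallo_of_dvd[OF B0 B _ degE dvd[folded E_def]]

  have \<omega>0: "\<omega> j = 0" if "j > k" for j
  proof -
    have "coeff (W a) j = 0" for a
      using deg(3)[of a] that by (simp add: coeff_eq_0)
    then show ?thesis
      using W(1)[of j] \<open>F \<noteq> bot\<close> by (simp add: tendsto_const_iff)
  qed
  define W0 where "W0 = Poly (map \<omega> [0..<k + 1])"
  have W0: "coeff W0 j = \<omega> j" for j
    using \<omega>0[of j] by (auto simp: W0_def nth_default_def simp del: upt_Suc)
  have degW0: "degree W0 \<le> k"
    using \<omega>0 by (intro degree_le) (simp add: W0)
  have WW0: "(\<lambda>a. W a - W0) \<in> coeff_smallo F (\<lambda>_. 1)"
    using LIM_zero[OF W(1)] by (auto simp: coeff_smallo_def W0 intro!: smalloI_tendsto)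
  have WO: "W \<in> coeff_bigo F (\<lambda>_. 1)"
    using coeff_bigo_add[OF coeff_smallo_imp_bigo[OF WW0] coeff_bigo_const[of W0]] by simp
  have bO: "b1 \<in> O[F](\<lambda>_. 1)" "b2 \<in> O[F](\<lambda>_. 1)"
    using b by (auto intro!: bigoI_tendsto)
  have bo: "(\<lambda>a. b1 a - c1) \<in> o[F](\<lambda>_. 1)" "(\<lambda>a. b2 a - c2) \<in> o[F](\<lambda>_. 1)"
    using b by (auto intro!: smalloI_tendsto simp: LIM_zero_iff)
  have bO1: "(\<lambda>a. 1 + monom (b1 a) k) \<in> coeff_bigo F (\<lambda>_. 1)"
    and bO2: "(\<lambda>a. [:b2 a:]) \<in> coeff_bigo F (\<lambda>_. 1)"
    using coeff_bigo_monom[OF bO(2), of 0]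
    by (auto intro!: coeff_bigo_add coeff_bigo_const coeff_bigo_monom bO simp: monom_0)
  have bO3: "(\<lambda>a. 1 + [:b2 a:] * W a ^ k) \<in> coeff_bigo F (\<lambda>_. 1)"
    by (intro coeff_bigo_add coeff_bigo_const coeff_bigo_mult coeff_bigo_power bO2 WO)
  have pcO: "(\<lambda>a. pcompose (p' a) (W a)) \<in> coeff_smallo F (\<lambda>_. 1)"
    unfolding pcompose_eq_sum[OF deg(2)]
  proof (intro coeff_smallo_sum coeff_smallo_bigo_mult coeff_bigo_power WO)
    fix j
    show "(\<lambda>a. [:coeff (p' a) j:]) \<in> coeff_smallo F (\<lambda>_. 1)"
      using coeff_smallo_monom[of "\<lambda>a. coeff (p' a) j" F "\<lambda>_. 1" 0] p'
      by (simp add: monom_0 coeff_smallo_def)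
  qed

  \<comment> \<open>The limit of \<open>E\<close>. Divisibility makes the coefficients of
    \<open>E\<close> below \<open>2 * k + 2\<close> small, so those of the constant polynomial
    \<open>E0\<close> vanish and the limiting case identifies \<open>W0\<close>.\<close>
  define E0 where "E0 = (1 + monom c1 k) * W0 ^ (k + 1)
        - monom 1 (k + 1) * pderiv W0 * (1 + [:c2:] * W0 ^ k)"
  \<comment> \<open>This is \<open>E a - E0\<close>, telescoped so that every summand contains a
    factor tending to 0 and otherwise bounded ones.\<close>
  have "(\<lambda>a. (1 + monom (b1 a) k) * ((W a ^ (k + 1) - W0 ^ (k + 1)) + pcompose (p' a) (W a))
      + monom (b1 a - c1) k * W0 ^ (k + 1)
      - (p a * (pderiv (W a) * (1 + [:b2 a:] * W a ^ k))
        + monom 1 (k + 1) * (pderiv (W a - W0) * (1 + [:b2 a:] * W a ^ k)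
        + pderiv W0 * ([:b2 a:] * (W a ^ k - W0 ^ k) + monom (b2 a - c2) 0 * W0 ^ k))))
      \<in> coeff_smallo F (\<lambda>_. 1)"
    by (intro coeff_smallo_diff coeff_smallo_add coeff_bigo_smallo_mult[OF bO1]
        coeff_bigo_smallo_mult[OF coeff_bigo_const] coeff_bigo_smallo_mult[OF bO2]
        coeff_smallo_power_diff[OF WO coeff_bigo_const WW0] pcO
        coeff_smallo_bigo_mult[OF p] coeff_bigo_mult[OF coeff_bigo_pderiv[OF WO] bO3]
        coeff_smallo_bigo_mult[OF coeff_smallo_monom[OF bo(1)]] coeff_bigo_const
        coeff_smallo_bigo_mult[OF coeff_smallo_pderiv[OF WW0] bO3]
        coeff_smallo_bigo_mult[OF coeff_smallo_monom[OF bo(2)]])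
  moreover have "(1 + monom (b1 a) k) * ((W a ^ (k + 1) - W0 ^ (k + 1)) + pcompose (p' a) (W a))
      + monom (b1 a - c1) k * W0 ^ (k + 1)
      - (p a * (pderiv (W a) * (1 + [:b2 a:] * W a ^ k))
        + monom 1 (k + 1) * (pderiv (W a - W0) * (1 + [:b2 a:] * W a ^ k)
        + pderiv W0 * ([:b2 a:] * (W a ^ k - W0 ^ k) + monom (b2 a - c2) 0 * W0 ^ k))) = E a - E0" for a
  proof -
    have "monom (b1 a - c1) k = monom (b1 a) k - monom c1 k" "monom (b2 a - c2) 0 = [:b2 a:] - [:c2:]"
      by (simp_all add: diff_monom monom_0)
    moreover have "(1 + B) * ((u - u0) + c) + (B - C) * u0
        - (q * (d * (1 + b * v)) + x * ((d - d0) * (1 + b * v) + d0 * (b * (v - v0) + (b - e) * v0)))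
        = (1 + B) * (u + c) - (x + q) * d * (1 + b * v) - ((1 + C) * u0 - x * d0 * (1 + e * v0))"
      for B C u u0 c q d b v x d0 v0 e :: "complex poly"
      by algebra
    ultimately show ?thesis
      unfolding E_def E0_def pderiv_diff by (simp only:)
  qed
  ultimately have EE0: "(\<lambda>a. E a - E0) \<in> coeff_smallo F (\<lambda>_. 1)" by simp
  then have EO: "E \<in> coeff_bigo F (\<lambda>_. 1)"
    using coeff_bigo_add[OF coeff_smallo_imp_bigo[OF EE0] coeff_bigo_const[of E0]] by simp
  have E0: "coeff E0 m = 0" if "m < 2 * k + 2" for m
  proof -
    have "(\<lambda>a. coeff (E a - E0) m) \<in> o[F](\<lambda>_. 1)" "(\<lambda>a. coeff (E a) m) \<in> o[F](\<lambda>_. 1)"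
      using EE0 low[OF EO that] by (auto simp: coeff_smallo_def)
    then have "(\<lambda>a. coeff (E a) m - coeff (E a - E0) m) \<in> o[F](\<lambda>_. 1)"
      by (intro sum_in_smallo)
    then have "((\<lambda>a. coeff E0 m) \<longlongrightarrow> 0) F"
      using smalloD_tendsto by fastforce
    then show ?thesis using \<open>F \<noteq> bot\<close> by (simp add: tendsto_const_iff)
  qed
  have X: "W0 = monom 1 1" and c: "c1 = c2"
    using jet_of_conjugacy_of_monomials[OF \<open>k > 0\<close> degW0, of c1 c2] E0 W(2,3)
    by (auto simp: W0 E0_def)

  define \<psi> where "\<psi> a = W a - monom 1 1" for a
  define \<delta> where "\<delta> a = p' a - p a" for a
  define \<beta> where "\<beta> a = b1 a - b2 a" for a
  \<comment> \<open>\<open>M\<close> measures the distance to the trivial solution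
    \<open>p' = p\<close>, \<open>W = X\<close>, \<open>b1 = b2\<close>, at which \<open>E\<close>
    vanishes identically. It is the gauge for all later estimates, so no relation between the sizes
    of \<open>p\<close> and of the unknowns is required.\<close>
  define M :: "'a \<Rightarrow> real" where
    "M a = (\<Sum>j\<le>k. norm (coeff (\<psi> a) j)) + (\<Sum>j<k. norm (coeff (\<delta> a) j)) + norm (\<beta> a)" for a
  define g where "g a = complex_of_real (M a)" for a
  have nonneg: "0 \<le> (\<Sum>j\<le>k. norm (coeff (\<psi> a) j))" "0 \<le> (\<Sum>j<k. norm (coeff (\<delta> a) j))" for a
    by (simp_all add: sum_nonneg)
  have \<psi>M: "norm (coeff (\<psi> a) j) \<le> M a" if "j \<le> k" for a j
  proof -
    have "norm (coeff (\<psi> a) j) \<le> (\<Sum>j\<le>k. norm (coeff (\<psi> a) j))"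
      using that by (intro member_le_sum) auto
    then show ?thesis
      using nonneg[of a] norm_ge_zero[of "\<beta> a"] unfolding M_def by linarith
  qed
  have \<delta>M: "norm (coeff (\<delta> a) j) \<le> M a" if "j < k" for a j
  proof -
    have "norm (coeff (\<delta> a) j) \<le> (\<Sum>j<k. norm (coeff (\<delta> a) j))"
      using that by (intro member_le_sum) auto
    then show ?thesis
      using nonneg[of a] norm_ge_zero[of "\<beta> a"] unfolding M_def by linarith
  qed
  have \<beta>M: "norm (\<beta> a) \<le> M a" for a
    using nonneg[of a] by (simp add: M_def)
  have M0: "M a \<ge> 0" for a using \<beta>M[of a] norm_ge_zero order_trans by blast
  have \<psi>k: "coeff (\<psi> a) j = 0" if "j > k" for a j
    using that deg(3)[of a] \<open>k > 0\<close> by (simp add: \<psi>_def coeff_eq_0)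
  have \<delta>k: "coeff (\<delta> a) j = 0" if "j \<ge> k" for a j
    using that deg(1,2)[of a] by (simp add: \<delta>_def coeff_eq_0)
  have \<psi>O: "\<psi> \<in> coeff_bigo F g"
  proof -
    have "(\<lambda>a. coeff (\<psi> a) j) \<in> O[F](g)" for j
    proof (cases "j \<le> k")
      case True
      then show ?thesis
        using \<psi>M M0 by (intro bigoI[where c = 1] always_eventually) (simp add: g_def)
    qed (simp add: \<psi>k)
    then show ?thesis by (simp add: coeff_bigo_def)
  qed
  have \<delta>O: "\<delta> \<in> coeff_bigo F g"
  proof -
    have "(\<lambda>a. coeff (\<delta> a) j) \<in> O[F](g)" for j
    proof (cases "j < k")
      case True
      then show ?thesis
        using \<delta>M M0 by (intro bigoI[where c = 1] always_eventually) (simp add: g_def)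
    qed (simp add: \<delta>k)
    then show ?thesis by (simp add: coeff_bigo_def)
  qed
  have \<beta>O: "\<beta> \<in> O[F](g)"
    using \<beta>M M0 by (intro bigoI[where c = 1] always_eventually) (simp add: g_def)
  have \<psi>o: "\<psi> \<in> coeff_smallo F (\<lambda>_. 1)"
    using WW0 by (simp add: \<psi>_def[abs_def] X)
  have WX: "(\<lambda>a. W a ^ n - monom 1 1 ^ n - of_nat n * monom 1 1 ^ (n - 1) * \<psi> a) \<in> coeff_smallo F g" for n
    using \<psi>o \<psi>O unfolding \<psi>_def[abs_def] by (rule coeff_smallo_power_linearization)
  have WXO: "(\<lambda>a. W a ^ n - monom 1 1 ^ n) \<in> coeff_bigo F g" for n
    using coeff_bigo_power_diff[OF WO coeff_bigo_const \<psi>O[unfolded \<psi>_def[abs_def]]] .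
  have pco: "(\<lambda>a. pcompose (p' a) (W a) - p' a) \<in> coeff_smallo F g"
  proof -
    have "(\<lambda>a. \<Sum>j<k. [:coeff (p' a) j:] * (W a ^ j - monom 1 1 ^ j)) \<in> coeff_smallo F g"
    proof (intro coeff_smallo_sum coeff_smallo_bigo_mult WXO)
      fix j
      show "(\<lambda>a. [:coeff (p' a) j:]) \<in> coeff_smallo F (\<lambda>_. 1)"
        using coeff_smallo_monom[of "\<lambda>a. coeff (p' a) j" F "\<lambda>_. 1" 0] p'
        by (simp add: monom_0 coeff_smallo_def)
    qed
    moreover have "(\<Sum>j<k. [:coeff (p' a) j:] * (W a ^ j - monom 1 1 ^ j)) = pcompose (p' a) (W a) - p' a" for a
    proof -
      have "monom 1 1 = [:0, 1::complex:]"
        by (simp add: monom_Suc one_pCons)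
      then have "p' a = pcompose (p' a) (monom 1 1)"
        by (simp only: pcompose_idR)
      then show ?thesis
        using pcompose_eq_sum[OF deg(2)[of a], of "W a"] pcompose_eq_sum[OF deg(2)[of a], of "monom 1 1"]
        by (simp only: right_diff_distrib sum_subtractf)
    qed
    ultimately show ?thesis by simp
  qed

  \<comment> \<open>The part of \<open>E\<close> linear in \<open>\<delta>\<close>,
    \<open>\<psi>\<close>, \<open>\<beta>\<close> when \<open>p\<close> is dropped. The bounded
    functions \<open>b1\<close>, \<open>b2\<close> stay as coefficients instead of being replaced by
    their limits; they occur only off the diagonal of a triangular system.\<close>
  define L where "L a = \<delta> a + monom (b1 a) k * \<delta> a + monom (\<beta> a) (2 * k + 1)
      + monom (of_nat (k + 1)) k * \<psi> a + monom (of_nat (k + 1) * b1 a) (2 * k) * \<psi> a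
      - monom 1 (k + 1) * pderiv (\<psi> a) - monom (b2 a) (2 * k + 1) * pderiv (\<psi> a)
      - monom (of_nat k * b2 a) (2 * k) * \<psi> a" for a
  define A where "A a = W a ^ (k + 1) - monom 1 1 ^ (k + 1) - of_nat (k + 1) * monom 1 1 ^ k * \<psi> a" for a
  define D where "D a = W a ^ k - monom 1 1 ^ k - of_nat k * monom 1 1 ^ (k - 1) * \<psi> a" for a
  define C where "C a = pcompose (p' a) (W a) - p' a" for a
  \<comment> \<open>This is \<open>E a - L a\<close>. \<open>A\<close>, \<open>C\<close> and
    \<open>D\<close> are Taylor remainders; each other summand pairs an O(g) factor with a factor
    \<open>p a\<close> or \<open>pderiv (\<psi> a)\<close> that is o(1).\<close>
  have "(\<lambda>a. (1 + monom (b1 a) k) * (A a + C a) + p a * monom (\<beta> a) k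
      - ([:b2 a:] * (monom 1 (k + 1) * D a)
        + monom 1 (k + 1) * (pderiv (\<psi> a) * ([:b2 a:] * (W a ^ k - monom 1 1 ^ k)))
        + p a * ([:b2 a:] * (W a ^ k - monom 1 1 ^ k))
        + p a * ((1 + [:b2 a:] * W a ^ k) * pderiv (\<psi> a)))) \<in> coeff_smallo F g"
    using WX[of "k + 1"] WX[of k] pco
    by (intro coeff_smallo_diff coeff_smallo_add coeff_bigo_smallo_mult[OF bO1]
        coeff_bigo_smallo_mult[OF coeff_bigo_const] coeff_bigo_smallo_mult[OF bO2]
        coeff_smallo_bigo_mult[OF p] coeff_bigo_mult[OF bO3] coeff_bigo_mult[OF bO2]
        coeff_bigo_pderiv[OF \<psi>O] coeff_bigo_monom[OF \<beta>O] WXO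
        coeff_smallo_bigo_mult[OF coeff_smallo_pderiv[OF \<psi>o]])
      (simp_all add: A_def[abs_def] D_def[abs_def] C_def[abs_def])
  moreover have "(1 + monom (b1 a) k) * (A a + C a) + p a * monom (\<beta> a) k
      - ([:b2 a:] * (monom 1 (k + 1) * D a)
        + monom 1 (k + 1) * (pderiv (\<psi> a) * ([:b2 a:] * (W a ^ k - monom 1 1 ^ k)))
        + p a * ([:b2 a:] * (W a ^ k - monom 1 1 ^ k))
        + p a * ((1 + [:b2 a:] * W a ^ k) * pderiv (\<psi> a))) = E a - L a" for a
  proof -
    \<comment> \<open>Writing \<open>X^k = x * y\<close> removes all symbolic exponents, including
      the \<open>X^(k-1)\<close> of the derivative of a power. The claim becomes an identity in
      finitely many variables, within reach of \<open>algebra\<close>.\<close>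
    define x y :: "complex poly" where "x = monom 1 1" and "y = monom 1 (k - 1)"
    have mc: "monom c n = [:c:] * monom 1 n" for c :: complex and n
      by (simp add: smult_monom)
    have xk: "monom 1 k = x * y" "monom 1 (k + 1) = x * (x * y)" "monom 1 (2 * k) = (x * y) * (x * y)"
        "monom 1 (2 * k + 1) = x * ((x * y) * (x * y))"
      using \<open>k > 0\<close> by (simp_all add: x_def y_def mult_monom mult_2)
    have xp: "x ^ n = monom 1 n" for n by (simp add: x_def monom_power)
    have xpk: "x ^ k = x * y" "x ^ (k + 1) = x * (x * y)" "x ^ (k - 1) = y"
      unfolding xp xk by (simp_all add: y_def)
    have cc: "[:of_nat (k + 1):] = (of_nat k + 1 :: complex poly)"
      by (simp add: of_nat_poly one_pCons)
    have cb: "[:of_nat (k + 1) * b1 a:] = (of_nat k + 1) * [:b1 a:]" "[:of_nat k * b2 a:] = of_nat k * [:b2 a:]"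
      unfolding cc[symmetric] by (simp_all add: of_nat_poly)
    have cd: "[:\<beta> a:] = [:b1 a:] - [:b2 a:]"
      by (simp add: \<beta>_def)
    note mm = mc[of "b1 a" "k", unfolded cd cc cb xk]
      mc[of "\<beta> a" "k", unfolded cd cc cb xk]
      mc[of "\<beta> a" "2 * k + 1", unfolded cd cc cb xk]
      mc[of "of_nat (k + 1)" "k", unfolded cd cc cb xk]
      mc[of "of_nat (k + 1) * b1 a" "2 * k", unfolded cd cc cb xk]
      mc[of "b2 a" "2 * k + 1", unfolded cd cc cb xk]
      mc[of "of_nat k * b2 a" "2 * k", unfolded cd cc cb xk]
    have id: "(1 + B * (x * y)) * ((u - x * (x * y) - (K + 1) * (x * y) * s) + (c - q')) + q * ((B - b) * (x * y))
        - (b * (x * (x * y) * (v - x * y - K * y * s)) + x * (x * y) * (ds * (b * (v - x * y)))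
          + q * (b * (v - x * y)) + q * ((1 + b * v) * ds))
        = (1 + B * (x * y)) * (u + c) - (x * (x * y) + q) * (1 + ds) * (1 + b * v)
          - (q' - q + B * (x * y) * (q' - q) + (B - b) * (x * ((x * y) * (x * y)))
            + (K + 1) * (x * y) * s + (K + 1) * B * ((x * y) * (x * y)) * s
            - x * (x * y) * ds - b * (x * ((x * y) * (x * y))) * ds - K * b * ((x * y) * (x * y)) * s)"
      for B x y u K s c q' q b v ds :: "complex poly"
      by algebra
    have of: "of_nat (k + 1) = (of_nat k + 1 :: complex poly)" by simp
    have W: "W a = x + \<psi> a" by (simp add: \<psi>_def x_def)
    have dW: "pderiv (W a) = 1 + pderiv (\<psi> a)"
      unfolding W pderiv_add by (simp add: x_def pderiv_monom)
    show ?thesis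
      unfolding E_def L_def A_def C_def D_def \<delta>_def dW
      unfolding mm xk(2) x_def[symmetric] xpk of by (rule id)
  qed
  ultimately have EL: "(\<lambda>a. E a - L a) \<in> coeff_smallo F g" by simp
  have "L \<in> coeff_bigo F g"
    unfolding L_def[abs_def]
    by (intro coeff_bigo_diff coeff_bigo_add coeff_bigo_mult coeff_bigo_monom \<psi>O \<delta>O \<beta>O bO
        coeff_bigo_pderiv) (use bO in auto)
  then have "E \<in> coeff_bigo F g"
    using coeff_bigo_add[OF coeff_smallo_imp_bigo[OF EL]] by fastforce
  note lowE = low[OF this]
  have lowL: "(\<lambda>a. coeff (L a) m) \<in> o[F](g)" if "m < 2 * k + 2" for m
  proof -
    have "(\<lambda>a. coeff (E a) m - coeff (E a - L a) m) \<in> o[F](g)"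
      using EL lowE[OF that] by (intro sum_in_smallo) (auto simp: coeff_smallo_def)
    then show ?thesis by simp
  qed
  note coeffs = coeff_monom_mult coeff_pderiv
  \<comment> \<open>Start of the triangular solution: below index k every other term of
    \<open>L\<close> carries a factor \<open>X^k\<close> or higher.\<close>
  have \<delta>_small: "(\<lambda>a. coeff (\<delta> a) m) \<in> o[F](g)" if "m < k" for m
    using lowL[of m] that by (simp add: L_def coeffs)
  have bs: "(\<lambda>a. c * b1 a * f a) \<in> o[F](g)" "(\<lambda>a. c * b2 a * f a) \<in> o[F](g)" if "f \<in> o[F](g)" for c f
    using landau_o.big_small_mult[OF landau_o.big.mult[of "\<lambda>_. c" F "\<lambda>_. 1", OF _ bO(1)] that]
      landau_o.big_small_mult[OF landau_o.big.mult[of "\<lambda>_. c" F "\<lambda>_. 1", OF _ bO(2)] that]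
    by simp_all
  have nz: "f \<in> o[F](g)" if "(\<lambda>a. c * f a) \<in> o[F](g)" "c \<noteq> 0" for c f
    using that by simp
  \<comment> \<open>At index k the translation coefficient of \<open>\<psi>\<close> stands without a
    competing \<open>\<delta>\<close> coefficient because the parameter polynomials have no term of
    degree k.\<close>
  have \<psi>_0: "(\<lambda>a. coeff (\<psi> a) 0) \<in> o[F](g)"
  proof -
    have "coeff (L a) k - 1 * b1 a * coeff (\<delta> a) 0 = of_nat (k + 1) * coeff (\<psi> a) 0" for a
      using \<open>k > 0\<close> by (simp add: L_def coeffs \<delta>k)
    moreover have "(\<lambda>a. coeff (L a) k - 1 * b1 a * coeff (\<delta> a) 0) \<in> o[F](g)"
      using \<open>k > 0\<close> by (intro sum_in_smallo lowL bs \<delta>_small) auto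
    ultimately have "(\<lambda>a. of_nat (k + 1) * coeff (\<psi> a) 0) \<in> o[F](g)"
      by (simp only:)
    then show ?thesis
      by (rule nz) (unfold of_nat_eq_0_iff, simp)
  qed
  have \<psi>_small: "(\<lambda>a. coeff (\<psi> a) j) \<in> o[F](g)" if j: "j \<le> k" for j
  proof -
    \<comment> \<open>The diagonal entry at index \<open>k + j\<close> is
      \<open>(k + 1) - j\<close>, from \<open>(k + 1) X^k \<psi> - X^(k+1) \<psi>'\<close>; it is
      nonzero exactly because \<open>j \<le> k\<close>. The case \<open>j = k\<close> is separate
      since index \<open>2 * k\<close> also receives multiples of \<open>coeff (\<psi> a) 0\<close>
      through \<open>b1\<close> and \<open>b2\<close>.\<close>
    consider "j = 0" | "0 < j" "j < k" | "j = k" using j by linarith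
    then show ?thesis
    proof cases
      case 1
      then show ?thesis using \<psi>_0 by simp
    next
      case 2
      obtain i where i: "j = Suc i" using 2 not0_implies_Suc by blast
      have "coeff (L a) (k + j) - 1 * b1 a * coeff (\<delta> a) j = of_nat (k + 1 - j) * coeff (\<psi> a) j" for a
        using 2 by (simp add: L_def coeffs \<delta>k i) (simp add: of_nat_diff algebra_simps)
      moreover have "(\<lambda>a. coeff (L a) (k + j) - 1 * b1 a * coeff (\<delta> a) j) \<in> o[F](g)"
        using 2 by (intro sum_in_smallo lowL bs \<delta>_small) auto
      ultimately have "(\<lambda>a. of_nat (k + 1 - j) * coeff (\<psi> a) j) \<in> o[F](g)"
        by (simp only:)
      then show ?thesis
        by (rule nz) (unfold of_nat_eq_0_iff, use 2 in simp)
    next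
      case 3
      obtain i where i: "k = Suc i" using \<open>k > 0\<close> not0_implies_Suc by blast
      have "coeff (L a) (2 * k) - of_nat (k + 1) * b1 a * coeff (\<psi> a) 0
          + of_nat k * b2 a * coeff (\<psi> a) 0 = coeff (\<psi> a) k" for a
        using \<open>k > 0\<close> by (simp add: L_def coeffs \<delta>k mult_2) (simp add: i algebra_simps)
      moreover have "(\<lambda>a. coeff (L a) (2 * k) - of_nat (k + 1) * b1 a * coeff (\<psi> a) 0
          + of_nat k * b2 a * coeff (\<psi> a) 0) \<in> o[F](g)"
        by (intro sum_in_smallo lowL bs \<psi>_0) auto
      ultimately show ?thesis using 3 by simp
    qed
  qed
  have \<beta>_small: "\<beta> \<in> o[F](g)"
  proof -
    have "coeff (L a) (2 * k + 1) - of_nat (k + 1) * b1 a * coeff (\<psi> a) 1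
        + of_nat (k + 1) * b2 a * coeff (\<psi> a) 1 = \<beta> a" for a
      using \<open>k > 0\<close> by (simp add: L_def coeffs \<delta>k \<psi>k mult_2) (simp add: algebra_simps)
    moreover have "(\<lambda>a. coeff (L a) (2 * k + 1) - of_nat (k + 1) * b1 a * coeff (\<psi> a) 1
        + of_nat (k + 1) * b2 a * coeff (\<psi> a) 1) \<in> o[F](g)"
      using \<open>k > 0\<close> by (intro sum_in_smallo lowL bs \<psi>_small) auto
    ultimately show ?thesis by simp
  qed
  have norm_small: "(\<lambda>a. complex_of_real (norm (f a))) \<in> o[F](g)" if "f \<in> o[F](g)" for f :: "'a \<Rightarrow> complex"
    using that by (simp add: smallo_def)
  \<comment> \<open>All unknowns are o(g), hence so is the sum \<open>g\<close> of their moduli; a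
    function that is o of itself vanishes eventually.\<close>
  have "(\<lambda>a. (\<Sum>j\<le>k. complex_of_real (norm (coeff (\<psi> a) j)))
      + (\<Sum>j<k. complex_of_real (norm (coeff (\<delta> a) j))) + complex_of_real (norm (\<beta> a))) \<in> o[F](g)"
    by (intro sum_in_smallo big_sum_in_smallo norm_small \<psi>_small \<delta>_small \<beta>_small) auto
  also have "(\<lambda>a. (\<Sum>j\<le>k. complex_of_real (norm (coeff (\<psi> a) j)))
      + (\<Sum>j<k. complex_of_real (norm (coeff (\<delta> a) j))) + complex_of_real (norm (\<beta> a))) = g"
    by (simp add: g_def[abs_def] M_def)
  finally have "g \<in> o[F](g)" .
  then have "\<forall>\<^sub>F a in F. g a = 0"
    by (simp add: landau_o.small_refl_iff)
  then show ?thesis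
  proof eventually_elim
    case (elim a)
    then have "M a = 0" by (simp add: g_def)
    then have "coeff (\<delta> a) j = 0" for j
      using \<delta>M[of j a] \<delta>k[of j a] by (cases "j < k") auto
    then show ?case by (simp add: \<delta>_def poly_eq_iff)
  qed
qed

section \<open>Interpolation at the roots of the parameter polynomial\<close>

text \<open>Uniform continuity on a compact product; it allows passing to the limit under the Cauchy
  integrals.\<close>

lemma uniform_limit_of_continuous_on_Times:
  fixes G :: "'a::metric_space \<Rightarrow> 'e::euclidean_space \<Rightarrow> 'c::metric_space"
  assumes "compact K" "s > 0"
    and "continuous_on (K \<times> cball 0 s) (\<lambda>(z, e). G z e)"
  shows "uniform_limit K (\<lambda>e z. G z e) (\<lambda>z. G z 0) (nhds 0)"
proof (rule uniform_limitI)
  fix \<epsilon> :: real assume "\<epsilon> > 0"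
  have "uniformly_continuous_on (K \<times> cball 0 s) (\<lambda>(z, e). G z e)"
    using assms by (intro compact_uniformly_continuous compact_Times compact_cball)
  then obtain d where "d > 0" and d: "\<And>x y. x \<in> K \<times> cball 0 s \<Longrightarrow> y \<in> K \<times> cball 0 s \<Longrightarrow>
      dist y x < d \<Longrightarrow> dist (case y of (z, e) \<Rightarrow> G z e) (case x of (z, e) \<Rightarrow> G z e) < \<epsilon>"
    using \<open>\<epsilon> > 0\<close> unfolding uniformly_continuous_on_def by metis
  have "\<forall>\<^sub>F e in nhds 0. e \<in> ball (0::'e) (min s d)"
    using \<open>s > 0\<close> \<open>d > 0\<close> by (intro eventually_nhds_in_open) auto
  then show "\<forall>\<^sub>F e in nhds 0. \<forall>z\<in>K. dist (G z e) (G z 0) < \<epsilon>"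
  proof eventually_elim
    case (elim e)
    show ?case
    proof
      fix z assume "z \<in> K"
      then show "dist (G z e) (G z 0) < \<epsilon>"
        using d[of "(z, 0)" "(z, e)"] elim \<open>s > 0\<close> by (auto simp: dist_Pair_Pair)
    qed
  qed
qed

text \<open>The coefficients of the interpolating polynomial are Cauchy integrals, by the identity
  \<open>(P(\<zeta>) - P(x)) / (\<zeta> - x) = \<Sum>\<^sub>j q\<^sub>j(\<zeta>) x\<^sup>j\<close>; this makes them continuous across multiple roots.\<close>

lemma interpolating_polynomial:
  fixes H :: "complex \<Rightarrow> 'e::euclidean_space \<Rightarrow> complex" and P :: "'e \<Rightarrow> complex poly"
  assumes "r > 0" "s > 0" "k > 0"
    and contH: "continuous_on (cball 0 r \<times> cball 0 s) (\<lambda>(z, \<epsilon>). H z \<epsilon>)"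
    and holH: "\<And>\<epsilon>. \<epsilon> \<in> cball 0 s \<Longrightarrow> (\<lambda>z. H z \<epsilon>) holomorphic_on ball 0 r"
    and degP: "\<And>\<epsilon>. degree (P \<epsilon>) = k + 1"
    and contP: "\<And>j. continuous_on (cball 0 s) (\<lambda>\<epsilon>. coeff (P \<epsilon>) j)"
    and roots: "\<And>\<epsilon> z. \<epsilon> \<in> cball 0 s \<Longrightarrow> poly (P \<epsilon>) z = 0 \<Longrightarrow> norm z < r"
    and P0: "P 0 = monom 1 (k + 1)"
  obtains W where "\<And>\<epsilon>. degree (W \<epsilon>) \<le> k"
    and "\<And>\<epsilon> z. \<epsilon> \<in> cball 0 s \<Longrightarrow> poly (P \<epsilon>) z = 0 \<Longrightarrow> poly (W \<epsilon>) z = H z \<epsilon>"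
    and "\<And>j. ((\<lambda>\<epsilon>. coeff (W \<epsilon>) j) \<longlongrightarrow> coeff (W 0) j) (nhds 0)"
    and "coeff (W 0) 1 = deriv (\<lambda>z. H z 0) 0"
proof -
  define q where "q j \<epsilon> \<zeta> = (\<Sum>i = Suc j..k + 1. coeff (P \<epsilon>) i * \<zeta> ^ (i - j - 1))" for j \<epsilon> \<zeta>
  define G where "G j \<zeta> \<epsilon> = H \<zeta> \<epsilon> * q j \<epsilon> \<zeta> / poly (P \<epsilon>) \<zeta>" for j \<zeta> \<epsilon>
  \<comment> \<open>Hermite's interpolation formula: \<open>W(x)\<close> is the Cauchy integral of
    \<open>H(\<zeta>) (P(\<zeta>) - P(x)) / ((\<zeta> - x) P(\<zeta>))\<close>. At a root
    \<open>x\<close> of P the kernel collapses to \<open>H(\<zeta>) / (\<zeta> - x)\<close>, and P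
    has no zero on the circle.\<close>
  define w where "w j \<epsilon> = contour_integral (circlepath 0 r) (\<lambda>\<zeta>. G j \<zeta> \<epsilon>) / (2 * of_real pi * \<i>)" for j \<epsilon>
  define W where "W \<epsilon> = (\<Sum>j<k + 1. monom (w j \<epsilon>) j)" for \<epsilon>
  have W: "coeff (W \<epsilon>) j = (if j < k + 1 then w j \<epsilon> else 0)" for \<epsilon> j
    by (auto simp: W_def coeff_sum simp del: sum.lessThan_Suc)
  have Psum: "poly (P \<epsilon>) \<zeta> = (\<Sum>i\<le>k + 1. coeff (P \<epsilon>) i * \<zeta> ^ i)" for \<epsilon> \<zeta>
    by (simp only: poly_altdef degP)
  have Pnz: "poly (P \<epsilon>) \<zeta> \<noteq> 0" if "\<epsilon> \<in> cball 0 s" "\<zeta> \<in> sphere 0 r" for \<epsilon> \<zeta>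
    using roots[OF that(1)] that(2) by force
  have contc: "continuous_on (sphere 0 r \<times> cball 0 s) (\<lambda>x. coeff (P (snd x)) j)" for j
    by (rule continuous_on_compose2[OF contP]) (auto intro: continuous_intros)
  have contG: "continuous_on (sphere 0 r \<times> cball 0 s) (\<lambda>(\<zeta>, \<epsilon>). G j \<zeta> \<epsilon>)" for j
  proof -
    have "continuous_on (sphere 0 r \<times> cball 0 s) (\<lambda>x. H (fst x) (snd x))"
      using continuous_on_subset[OF contH Sigma_mono[OF sphere_cball order_refl]]
      by (simp add: case_prod_unfold)
    moreover have contP': "continuous_on (sphere 0 r \<times> cball 0 s) (\<lambda>x. poly (P (snd x)) (fst x))"
      unfolding Psum
      by (intro continuous_on_mult continuous_on_sum contc continuous_on_power
          continuous_on_fst continuous_on_id)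
    ultimately show ?thesis
      unfolding G_def q_def case_prod_unfold
      by (intro continuous_on_divide continuous_on_mult continuous_on_sum contc continuous_on_power
          continuous_on_fst continuous_on_id continuous_on_const contP') (use Pnz in auto)
  qed
  have contG1: "continuous_on (sphere 0 r) (\<lambda>\<zeta>. G j \<zeta> \<epsilon>)" if "\<epsilon> \<in> cball 0 s" for j \<epsilon>
    using continuous_on_compose2[OF contG[of j], of "sphere 0 r" "\<lambda>\<zeta>. (\<zeta>, \<epsilon>)"] that
    by (simp add: continuous_on_Pair image_subset_iff)
  have contH1: "continuous_on (cball 0 r) (\<lambda>\<zeta>. H \<zeta> \<epsilon>)" if "\<epsilon> \<in> cball 0 s" for \<epsilon>
    using continuous_on_compose2[OF contH, of "cball 0 r" "\<lambda>\<zeta>. (\<zeta>, \<epsilon>)"] that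
    by (simp add: continuous_on_Pair image_subset_iff)
  have intG: "(\<lambda>\<zeta>. G j \<zeta> \<epsilon>) contour_integrable_on circlepath 0 r" if "\<epsilon> \<in> cball 0 s" for j \<epsilon>
    using contG1[OF that] \<open>r > 0\<close> by (intro contour_integrable_continuous_circlepath) simp
  have "((\<lambda>\<epsilon>. contour_integral (circlepath 0 r) (\<lambda>\<zeta>. G j \<zeta> \<epsilon>)) \<longlongrightarrow>
      contour_integral (circlepath 0 r) (\<lambda>\<zeta>. G j \<zeta> 0)) (nhds 0)" for j
  proof (rule contour_integral_uniform_limit_circlepath(2))
    have "\<forall>\<^sub>F \<epsilon> in nhds 0. \<epsilon> \<in> ball (0::'e) s"
      using \<open>s > 0\<close> by (intro eventually_nhds_in_open) auto
    then show "\<forall>\<^sub>F \<epsilon> in nhds 0. (\<lambda>\<zeta>. G j \<zeta> \<epsilon>) contour_integrable_on circlepath 0 r"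
      by eventually_elim (auto intro: intG)
    show "uniform_limit (sphere 0 r) (\<lambda>\<epsilon> \<zeta>. G j \<zeta> \<epsilon>) (\<lambda>\<zeta>. G j \<zeta> 0) (nhds 0)"
      using \<open>s > 0\<close> by (intro uniform_limit_of_continuous_on_Times[OF _ _ contG]) auto
  qed (use \<open>r > 0\<close> in auto)
  then have limw: "(w j \<longlongrightarrow> w j 0) (nhds 0)" for j
    unfolding w_def[abs_def] by (intro tendsto_divide) auto
  show ?thesis
  proof (rule that[of W])
    show "degree (W \<epsilon>) \<le> k" for \<epsilon>
      by (rule degree_le) (simp add: W)
    show "((\<lambda>\<epsilon>. coeff (W \<epsilon>) j) \<longlongrightarrow> coeff (W 0) j) (nhds 0)" for j
      using limw[of j] by (simp add: W)
    fix \<epsilon> x assume \<epsilon>: "\<epsilon> \<in> cball 0 s" and x: "poly (P \<epsilon>) x = 0"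
    have nx: "norm x < r" using roots[OF \<epsilon> x] .
    have "((\<lambda>\<zeta>. \<Sum>j<k + 1. G j \<zeta> \<epsilon> * x ^ j) has_contour_integral
        (\<Sum>j<k + 1. contour_integral (circlepath 0 r) (\<lambda>\<zeta>. G j \<zeta> \<epsilon>) * x ^ j)) (circlepath 0 r)"
      by (intro has_contour_integral_sum has_contour_integral_rmul has_contour_integral_integral intG \<epsilon>) auto
    then have 1: "((\<lambda>\<zeta>. H \<zeta> \<epsilon> / (\<zeta> - x)) has_contour_integral
        (\<Sum>j<k + 1. contour_integral (circlepath 0 r) (\<lambda>\<zeta>. G j \<zeta> \<epsilon>) * x ^ j)) (circlepath 0 r)"
    proof (rule has_contour_integral_eq)
      fix \<zeta> assume "\<zeta> \<in> path_image (circlepath 0 r)"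
      then have \<zeta>: "\<zeta> \<in> sphere 0 r" using \<open>r > 0\<close> by simp
      have "(x - \<zeta>) * (\<Sum>j<k + 1. q j \<epsilon> \<zeta> * x ^ j) = - poly (P \<epsilon>) \<zeta>"
        using polyfun_diff[of "k + 1" "coeff (P \<epsilon>)" x \<zeta>] x by (simp only: Psum q_def) simp
      then have "(\<Sum>j<k + 1. q j \<epsilon> \<zeta> * x ^ j) = poly (P \<epsilon>) \<zeta> / (\<zeta> - x)"
        using \<zeta> nx by (subst eq_divide_eq) (auto simp: algebra_simps simp del: sum.lessThan_Suc)
      moreover have "(\<Sum>j<k + 1. G j \<zeta> \<epsilon> * x ^ j) = H \<zeta> \<epsilon> / poly (P \<epsilon>) \<zeta> * (\<Sum>j<k + 1. q j \<epsilon> \<zeta> * x ^ j)"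
        by (simp add: G_def sum_distrib_left mult.assoc del: sum.lessThan_Suc)
      ultimately show "(\<Sum>j<k + 1. G j \<zeta> \<epsilon> * x ^ j) = H \<zeta> \<epsilon> / (\<zeta> - x)"
        using Pnz[OF \<epsilon> \<zeta>] by simp
    qed
    have 2: "((\<lambda>\<zeta>. H \<zeta> \<epsilon> / (\<zeta> - x)) has_contour_integral (2 * of_real pi * \<i> * H x \<epsilon>)) (circlepath 0 r)"
      using Cauchy_integral_circlepath[of 0 r "\<lambda>\<zeta>. H \<zeta> \<epsilon>" x] holH[OF \<epsilon>] nx contH1[OF \<epsilon>]
      by (simp add: mult.commute mult.left_commute)
    have "poly (W \<epsilon>) x = (\<Sum>j<k + 1. w j \<epsilon> * x ^ j)"
      by (simp add: W_def poly_sum poly_monom del: sum.lessThan_Suc)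
    also have "\<dots> = (\<Sum>j<k + 1. contour_integral (circlepath 0 r) (\<lambda>\<zeta>. G j \<zeta> \<epsilon>) * x ^ j) / (2 * of_real pi * \<i>)"
      by (simp add: w_def sum_divide_distrib del: sum.lessThan_Suc)
    also have "\<dots> = H x \<epsilon>"
      unfolding has_contour_integral_unique[OF 1 2] by simp
    finally show "poly (W \<epsilon>) x = H x \<epsilon>" .
  next
    \<comment> \<open>Since P is \<open>X^(k+1)\<close> at parameter 0, only its top coefficient
      contributes to \<open>q 1\<close>, and the integrand is
      \<open>H(\<zeta>,0) / \<zeta>^2\<close>, whose integral gives the derivative.\<close>
    have "((\<lambda>\<zeta>. H \<zeta> 0 / (\<zeta> - 0) ^ Suc 1) has_contour_integral
        (2 * pi * \<i>) / fact 1 * (deriv ^^ 1) (\<lambda>\<zeta>. H \<zeta> 0) 0) (circlepath 0 r)"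
      using \<open>r > 0\<close> \<open>s > 0\<close> holH[of 0] contH1[of 0]
      by (intro Cauchy_has_contour_integral_higher_derivative_circlepath) auto
    then have "((\<lambda>\<zeta>. G 1 \<zeta> 0) has_contour_integral
        (2 * pi * \<i>) / fact 1 * (deriv ^^ 1) (\<lambda>\<zeta>. H \<zeta> 0) 0) (circlepath 0 r)"
    proof (rule has_contour_integral_eq)
      fix \<zeta> assume "\<zeta> \<in> path_image (circlepath 0 r)"
      then have \<zeta>: "\<zeta> \<noteq> 0" using \<open>r > 0\<close> by auto
      have "q 1 0 \<zeta> = (\<Sum>i\<in>{k + 1}. coeff (P 0) i * \<zeta> ^ (i - 1 - 1))"
        unfolding q_def using \<open>k > 0\<close> by (intro sum.mono_neutral_right) (auto simp: P0)
      then have "q 1 0 \<zeta> = \<zeta> ^ (k - 1)" by (simp add: P0)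
      then show "H \<zeta> 0 / (\<zeta> - 0) ^ Suc 1 = G 1 \<zeta> 0"
        using \<zeta> \<open>k > 0\<close> by (cases k) (simp_all add: G_def P0 poly_monom)
    qed
    then show "coeff (W 0) 1 = deriv (\<lambda>z. H z 0) 0"
      using \<open>k > 0\<close> by (simp add: W w_def contour_integral_unique)
  qed
qed

section \<open>Divisibility from vanishing at simple roots\<close>

lemma prod_linear_dvd:
  fixes q :: "complex poly"
  assumes "finite S" "\<And>z. z \<in> S \<Longrightarrow> poly q z = 0"
  shows "(\<Prod>z\<in>S. [:-z, 1:]) dvd q"
  using assms
proof (induction S arbitrary: q rule: finite_induct)
  case (insert z S)
  obtain q' where q: "q = [:-z, 1:] * q'"
    using insert.prems[of z] by (auto simp: poly_eq_0_iff_dvd dvd_def)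
  have "poly q' w = 0" if "w \<in> S" for w
    using insert.prems[of w] insert.hyps that by (auto simp: q)
  then have "(\<Prod>z\<in>S. [:-z, 1:]) dvd q'" by (rule insert.IH)
  then show ?case
    unfolding q prod.insert[OF insert.hyps] by (rule mult_dvd_mono[OF dvd_refl])
qed simp

lemma rsquarefree_dvd:
  fixes p q :: "complex poly"
  assumes "rsquarefree p" "\<And>z. poly p z = 0 \<Longrightarrow> poly q z = 0"
  shows "p dvd q"
proof -
  have "p \<noteq> 0" using assms(1) by (simp add: rsquarefree_def)
  then have "(\<Prod>z | poly p z = 0. [:-z, 1:]) dvd q"
    using assms(2) by (intro prod_linear_dvd poly_roots_finite) auto
  then have "smult (lead_coeff p) (\<Prod>z | poly p z = 0. [:-z, 1:]) dvd q"
    using \<open>p \<noteq> 0\<close> by (intro smult_dvd) auto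
  then show ?thesis
    by (simp only: complex_poly_decompose_rsquarefree[OF assms(1)])
qed

text \<open>At a root of \<open>p\<close> the derivative of \<open>E = p * U\<close> equals
  \<open>pderiv p * U\<close>, and \<open>pderiv p\<close> is nonzero there; so \<open>U\<close>
  vanishes at all roots as well.\<close>

lemma rsquarefree_square_dvd:
  fixes p E :: "complex poly"
  assumes p: "rsquarefree p" and E: "\<And>z. poly p z = 0 \<Longrightarrow> poly E z = 0"
    and E': "\<And>z. poly p z = 0 \<Longrightarrow> poly (pderiv E) z = 0"
  shows "p ^ 2 dvd E"
proof -
  obtain U where U: "E = p * U" using rsquarefree_dvd[OF p E] by (auto simp: dvd_def)
  have "poly U z = 0" if "poly p z = 0" for z
  proof -
    have "poly (pderiv p) z \<noteq> 0" using p that by (auto simp: rsquarefree_roots)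
    then show ?thesis using E'[OF that] that by (simp add: U pderiv_mult)
  qed
  then have "p dvd U" by (rule rsquarefree_dvd[OF p])
  then show ?thesis by (simp add: U power2_eq_square)
qed

text \<open>Divisibility and coefficient asymptotics need a polynomial object where
  \<open>param_poly\<close> is a function. The part tending to 0 with the parameter is kept apart
  from the leading monomial.\<close>

definition low_poly :: "('n::finite \<Rightarrow> nat) \<Rightarrow> real ^ 'n \<Rightarrow> complex poly" where
  "low_poly idx \<epsilon> = (\<Sum>i\<in>UNIV. monom (complex_of_real (\<epsilon> $ i)) (idx i))"

definition parameter_poly :: "('n::finite \<Rightarrow> nat) \<Rightarrow> real ^ 'n \<Rightarrow> complex poly" where
  "parameter_poly idx \<epsilon> = monom 1 (CARD('n) + 1) + low_poly idx \<epsilon>"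

lemma poly_parameter_poly: "poly (parameter_poly idx \<epsilon>) = param_poly idx \<epsilon>"
  by (simp add: fun_eq_iff parameter_poly_def low_poly_def param_poly_def poly_monom poly_sum)

lemma coeff_low_poly: "coeff (low_poly idx \<epsilon>) j = (\<Sum>i\<in>UNIV. if idx i = j then complex_of_real (\<epsilon> $ i) else 0)"
  by (simp add: low_poly_def coeff_sum)

lemma cnj_param_poly: "cnj (param_poly idx \<epsilon> z) = param_poly idx \<epsilon> (cnj z)"
  by (simp add: param_poly_def)

lemma cnj_pderiv_parameter_poly:
  "cnj (poly (pderiv (parameter_poly idx \<epsilon>)) z) = poly (pderiv (parameter_poly idx \<epsilon>)) (cnj z)"
proof -
  have "cnj (coeff (parameter_poly idx \<epsilon>) j) = coeff (parameter_poly idx \<epsilon>) j" for j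
    by (simp add: parameter_poly_def coeff_low_poly if_distrib cong: if_cong)
  then show ?thesis by (simp add: poly_altdef coeff_pderiv)
qed

lemma low_poly_0 [simp]: "low_poly idx 0 = 0"
  by (simp add: low_poly_def)

lemma continuous_coeff_parameter_poly: "continuous_on S (\<lambda>\<epsilon>. coeff (parameter_poly idx \<epsilon>) j)"
proof -
  have "continuous_on S (\<lambda>\<epsilon>. if idx i = j then complex_of_real (\<epsilon> $ i) else 0)" for i
    by (cases "idx i = j") (auto intro!: continuous_intros)
  then show ?thesis
    unfolding parameter_poly_def coeff_add coeff_low_poly by (intro continuous_intros)
qed

lemma low_poly_smallo:
  assumes "(\<phi> \<longlongrightarrow> 0) F"
  shows "(\<lambda>a. low_poly idx (\<phi> a)) \<in> coeff_smallo F (\<lambda>_. 1)"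
proof -
  have "((\<lambda>a. coeff (low_poly idx (\<phi> a)) j) \<longlongrightarrow> 0) F" for j
  proof -
    have "((\<lambda>a. if idx i = j then complex_of_real (\<phi> a $ i) else 0) \<longlongrightarrow> 0) F" for i
      using tendsto_of_real[OF tendsto_vec_nth[OF assms, of i]] by (cases "idx i = j") auto
    then show ?thesis unfolding coeff_low_poly by (intro tendsto_null_sum) auto
  qed
  then show ?thesis by (auto simp: coeff_smallo_def intro!: smalloI_tendsto)
qed

context
  fixes idx :: "'n::finite \<Rightarrow> nat"
  assumes idx: "bij_betw idx UNIV {..<CARD('n)}"
begin

lemma idx_less: "idx i < CARD('n)"
  using idx by (auto simp: bij_betw_def)

lemma degree_low_poly: "degree (low_poly idx \<epsilon>) < CARD('n)"
proof (rule le_less_trans)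
  show "degree (low_poly idx \<epsilon>) \<le> CARD('n) - 1"
    unfolding low_poly_def using idx_less
    by (intro degree_sum_le order.trans[OF degree_monom_le]) (simp_all add: Suc_leI le_diff_conv2)
qed simp

lemma degree_parameter_poly: "degree (parameter_poly idx \<epsilon>) = CARD('n) + 1"
  unfolding parameter_poly_def using degree_low_poly[of \<epsilon>]
  by (subst degree_add_eq_left) (auto simp: degree_monom_eq)

lemma low_poly_inject: "low_poly idx \<epsilon> = low_poly idx \<epsilon>' \<longleftrightarrow> \<epsilon> = \<epsilon>'"
proof
  assume eq: "low_poly idx \<epsilon> = low_poly idx \<epsilon>'"
  have inj: "idx i = idx j \<longleftrightarrow> i = j" for i j
    using idx by (auto simp: bij_betw_def inj_on_def)
  have "coeff (low_poly idx \<epsilon>) (idx i) = of_real (\<epsilon> $ i)" for \<epsilon> :: "real ^ 'n" and i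
    by (simp add: coeff_low_poly inj)
  then show "\<epsilon> = \<epsilon>'" using eq by (metis of_real_eq_iff vec_eq_iff)
qed simp

text \<open>Once the sum of the \<open>\<bar>\<epsilon> $ i\<bar>\<close> is below
  \<open>r'^(k+1)\<close>, the leading monomial strictly dominates the others wherever
  \<open>norm z \<ge> r'\<close>.\<close>

lemma param_poly_roots_small:
  assumes "r > 0"
  shows "\<forall>\<^sub>F \<epsilon> in nhds 0. \<forall>z. param_poly idx \<epsilon> z = 0 \<longrightarrow> norm z < r"
proof -
  \<comment> \<open>The cap at 1 lets the single power \<open>r' ^ (k + 1)\<close> bound all the
    powers \<open>r' ^ (k + 1 - idx i)\<close> from below.\<close>
  define r' where "r' = min r 1"
  have r': "0 < r'" "r' \<le> 1" "r' \<le> r" using assms by (auto simp: r'_def)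
  let ?k = "CARD('n)"
  have "((\<lambda>\<epsilon>::real^'n. \<Sum>i\<in>UNIV. \<bar>\<epsilon> $ i\<bar>) \<longlongrightarrow> (\<Sum>i\<in>UNIV. \<bar>(0::real^'n) $ i\<bar>)) (nhds 0)"
    by (intro tendsto_intros filterlim_ident)
  then have "\<forall>\<^sub>F \<epsilon>::real^'n in nhds 0. (\<Sum>i\<in>UNIV. \<bar>\<epsilon> $ i\<bar>) < r' ^ (?k + 1)"
    using r' by (intro order_tendstoD(2)[where y = "\<Sum>i\<in>UNIV. \<bar>(0::real^'n) $ i\<bar>"]) auto
  then show ?thesis
  proof eventually_elim
    case (elim \<epsilon>)
    show ?case
    proof (intro allI impI, rule ccontr)
      fix z assume z: "param_poly idx \<epsilon> z = 0" and "\<not> norm z < r"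
      then have nz: "r' \<le> norm z" using r' by simp
      then have "norm z > 0" using r' by linarith
      have le: "r' ^ (?k + 1) * norm z ^ idx i \<le> norm z ^ (?k + 1)" for i
      proof -
        have "r' ^ (?k + 1) \<le> r' ^ (?k + 1 - idx i)"
          using r' by (intro power_decreasing) auto
        also have "\<dots> \<le> norm z ^ (?k + 1 - idx i)"
          using r' nz by (intro power_mono) auto
        finally have "r' ^ (?k + 1) * norm z ^ idx i \<le> norm z ^ (?k + 1 - idx i) * norm z ^ idx i"
          by (rule mult_right_mono) simp
        also have "\<dots> = norm z ^ (?k + 1)"
          using idx_less[of i] by (simp flip: power_add)
        finally show ?thesis .
      qed
      have "z ^ (?k + 1) = - (\<Sum>i\<in>UNIV. of_real (\<epsilon> $ i) * z ^ idx i)"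
        using z by (simp add: param_poly_def eq_neg_iff_add_eq_0)
      then have "norm z ^ (?k + 1) = norm (\<Sum>i\<in>UNIV. complex_of_real (\<epsilon> $ i) * z ^ idx i)"
        by (metis norm_minus_cancel norm_power)
      also have "\<dots> \<le> (\<Sum>i\<in>UNIV. \<bar>\<epsilon> $ i\<bar> * norm z ^ idx i)"
        by (intro order.trans[OF norm_sum] sum_mono) (simp add: norm_mult norm_power)
      finally have "r' ^ (?k + 1) * norm z ^ (?k + 1) \<le> r' ^ (?k + 1) * (\<Sum>i\<in>UNIV. \<bar>\<epsilon> $ i\<bar> * norm z ^ idx i)"
        using r' by (intro mult_left_mono) auto
      also have "\<dots> = (\<Sum>i\<in>UNIV. \<bar>\<epsilon> $ i\<bar> * (r' ^ (?k + 1) * norm z ^ idx i))"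
        by (simp add: sum_distrib_left mult.left_commute)
      also have "\<dots> \<le> (\<Sum>i\<in>UNIV. \<bar>\<epsilon> $ i\<bar> * norm z ^ (?k + 1))"
        by (intro sum_mono mult_left_mono le) auto
      also have "\<dots> = (\<Sum>i\<in>UNIV. \<bar>\<epsilon> $ i\<bar>) * norm z ^ (?k + 1)"
        by (simp add: sum_distrib_right)
      also have "\<dots> < r' ^ (?k + 1) * norm z ^ (?k + 1)"
        using elim \<open>norm z > 0\<close> by (intro mult_strict_right_mono) auto
      finally show False by simp
    qed
  qed
qed

text \<open>Moving only the constant term: P + t has a multiple root exactly when -t is a critical
  value of P. There are finitely many critical values, so some small real t avoids them all.\<close>

lemma rsquarefree_parameter_poly_dense:
  assumes "d > 0"
  obtains \<epsilon>' where "dist \<epsilon>' \<epsilon> < d" "rsquarefree (parameter_poly idx \<epsilon>')"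
proof -
  let ?p = "parameter_poly idx \<epsilon>"
  obtain i where i: "idx i = 0"
    using idx by (metis bij_betwE bij_betw_iff_bijections lessThan_iff zero_less_card_finite)
  have shift: "parameter_poly idx (\<epsilon> + t *\<^sub>R axis i 1) = ?p + [:of_real t:]" for t
  proof -
    have "complex_of_real ((\<epsilon> + t *\<^sub>R axis i 1) $ j) = of_real (\<epsilon> $ j) + (if j = i then of_real t else 0)" for j
      by (simp add: axis_def)
    then have "low_poly idx (\<epsilon> + t *\<^sub>R axis i 1) = low_poly idx \<epsilon> + (\<Sum>j\<in>UNIV. monom (if j = i then of_real t else 0) (idx j))"
      by (simp only: low_poly_def flip: sum.distrib add_monom)
    also have "(\<Sum>j\<in>UNIV. monom (if j = i then complex_of_real t else 0) (idx j)) = [:of_real t:]"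
      by (subst sum.remove[of _ i]) (auto simp: i monom_0)
    finally show ?thesis by (simp add: parameter_poly_def)
  qed
  have "pderiv ?p \<noteq> 0"
    using degree_parameter_poly[of \<epsilon>] degree_pderiv[of ?p] by (auto simp: pderiv_eq_0_iff)
  then have fin: "finite ((\<lambda>z. - Re (poly ?p z)) ` {z. poly (pderiv ?p) z = 0})"
    by (intro finite_imageI poly_roots_finite)
  have "infinite {0<..<d}" using \<open>d > 0\<close> by simp
  then obtain t where t: "t \<in> {0<..<d}" "t \<notin> (\<lambda>z. - Re (poly ?p z)) ` {z. poly (pderiv ?p) z = 0}"
    using fin by (meson finite_subset subsetI)
  show ?thesis
  proof (rule that[of "\<epsilon> + t *\<^sub>R axis i 1"])
    show "dist (\<epsilon> + t *\<^sub>R axis i 1) \<epsilon> < d"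
      using t by (simp add: dist_norm)
    show "rsquarefree (parameter_poly idx (\<epsilon> + t *\<^sub>R axis i 1))"
      unfolding rsquarefree_roots shift
    proof (intro allI notI)
      fix z assume z: "poly (?p + [:of_real t:]) z = 0 \<and> poly (pderiv (?p + [:of_real t:])) z = 0"
      then have "poly ?p z = - of_real t" "poly (pderiv ?p) z = 0"
        by (auto simp: pderiv_add pderiv_pCons add_eq_0_iff)
      then show False using t(2) by (auto simp: image_iff)
    qed
  qed
qed

end

section \<open>Local form of prepared families\<close>

lemma eventually_nhds_prod_radius:
  fixes P :: "'a::real_normed_vector \<times> 'b::real_normed_vector \<Rightarrow> bool"
  assumes "eventually P (nhds (0, 0))"
  shows "\<exists>r>0. \<forall>x y. norm x < r \<longrightarrow> norm y < r \<longrightarrow> P (x, y)"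
proof -
  obtain d where "d > 0" and d: "\<And>p. dist p (0, 0) < d \<Longrightarrow> P p"
    using assms unfolding eventually_nhds_metric by blast
  have "P (x, y)" if "norm x < d / 2" "norm y < d / 2" for x y
    using d[of "(x, y)"] norm_Pair_le[of x y] that by (simp add: dist_norm)
  then show ?thesis using \<open>d > 0\<close> by (intro exI[of _ "d / 2"]) auto
qed

lemma pderiv_sum: "pderiv (sum f A) = (\<Sum>x\<in>A. pderiv (f x))"
  by (induction A rule: infinite_finite_induct) (auto simp: pderiv_add)

lemma tendsto_nhds_fst_snd:
  "(fst \<longlongrightarrow> x) (nhds (x, y))" "(snd \<longlongrightarrow> y) (nhds (x, y))"
  using tendsto_fst[OF filterlim_ident, of "(x, y)"] tendsto_snd[OF filterlim_ident, of "(x, y)"] by simp_all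

lemma poly_pderiv_parameter_poly:
  fixes idx :: "'n::finite \<Rightarrow> nat"
  shows "poly (pderiv (parameter_poly idx \<epsilon>)) z = of_nat (CARD('n) + 1) * z ^ CARD('n) +
    (\<Sum>i\<in>UNIV. of_nat (idx i) * complex_of_real (\<epsilon> $ i) * z ^ (idx i - 1))"
  by (simp add: parameter_poly_def low_poly_def pderiv_add pderiv_monom poly_monom pderiv_sum poly_sum)

lemma has_field_derivative_param_poly:
  "(param_poly idx \<epsilon> has_field_derivative poly (pderiv (parameter_poly idx \<epsilon>)) z) (at z within S)"
  unfolding poly_parameter_poly[symmetric] by (rule poly_DERIV[THEN has_field_derivative_at_within])

lemma holomorphic_on_param_poly: "param_poly idx \<epsilon> holomorphic_on S"
  using has_field_derivative_param_poly field_differentiable_def holomorphic_on_def by blast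

lemma tendsto_param_poly:
  fixes idx :: "'n::finite \<Rightarrow> nat"
  shows "((\<lambda>(z, \<epsilon>). param_poly idx \<epsilon> z) \<longlongrightarrow> 0) (nhds (0, 0))"
proof -
  have "((\<lambda>x::complex \<times> (real ^ 'n). param_poly idx (snd x) (fst x)) \<longlongrightarrow> param_poly idx (snd (0, 0)) (fst (0, 0))) (nhds (0, 0))"
    unfolding param_poly_def by (intro tendsto_intros) (simp_all add: tendsto_nhds_fst_snd)
  then show ?thesis by (simp add: case_prod_unfold param_poly_def)
qed

lemma tendsto_pderiv_parameter_poly:
  fixes idx :: "'n::finite \<Rightarrow> nat"
  shows "((\<lambda>(z, \<epsilon>). poly (pderiv (parameter_poly idx \<epsilon>)) z) \<longlongrightarrow> 0) (nhds (0, 0))"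
proof -
  have "((\<lambda>x::complex \<times> (real ^ 'n). poly (pderiv (parameter_poly idx (snd x))) (fst x)) \<longlongrightarrow>
      poly (pderiv (parameter_poly idx (snd (0, 0)))) (fst (0, 0))) (nhds (0, 0))"
    unfolding poly_pderiv_parameter_poly by (intro tendsto_intros) (simp_all add: tendsto_nhds_fst_snd)
  then show ?thesis by (simp add: case_prod_unfold poly_pderiv_parameter_poly zero_power)
qed

lemma has_derivative_compose_cnj:
  assumes "(F has_field_derivative D) (at (cnj z))"
  shows "((\<lambda>z. F (cnj z)) has_derivative (\<lambda>h. D * cnj h)) (at z)"
proof -
  have "(cnj has_derivative cnj) (at z)"
    by (simp add: bounded_linear_imp_has_derivative bounded_linear_cnj)
  then show ?thesis
    using assms unfolding has_field_derivative_def by (rule has_derivative_compose)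
qed

lemma wirtinger_dzbar_compose_cnj:
  assumes "(f has_derivative (\<lambda>h. D * cnj h)) (at z)"
  shows "wirtinger_dzbar f z = D"
proof -
  have "frechet_derivative f (at z) = (\<lambda>h. D * cnj h)"
    using frechet_derivative_at[OF assms] by simp
  then show ?thesis by (simp add: wirtinger_dzbar_def mult.left_commute[of \<i>])
qed

lemma deriv_canonical_field:
  fixes idx :: "'n::finite \<Rightarrow> nat"
  assumes "param_poly idx \<epsilon> z = 0" "1 + complex_of_real (b \<epsilon>) * z ^ CARD('n) \<noteq> 0"
  shows "deriv (canonical_field idx b \<epsilon>) z =
    poly (pderiv (parameter_poly idx \<epsilon>)) z / (1 + complex_of_real (b \<epsilon>) * z ^ CARD('n))"
proof -
  have D: "((\<lambda>z. 1 + complex_of_real (b \<epsilon>) * z ^ CARD('n)) has_field_derivative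
      complex_of_real (b \<epsilon>) * (of_nat CARD('n) * z ^ (CARD('n) - 1))) (at z)"
    by (auto intro!: derivative_eq_intros)
  have "(canonical_field idx b \<epsilon> has_field_derivative
      poly (pderiv (parameter_poly idx \<epsilon>)) z / (1 + complex_of_real (b \<epsilon>) * z ^ CARD('n))) (at z)"
    using DERIV_divide[OF has_field_derivative_param_poly D assms(2), of idx \<epsilon>] assms
    by (simp add: canonical_field_def[abs_def])
  then show ?thesis by (rule DERIV_imp_deriv)
qed

text \<open>The factor \<open>A\<close> is close to \<open>1/2\<close>, so that \<open>g(z) - z\<close> is \<open>P(z)\<close> times a unit close to \<open>1\<close>.\<close>

lemma fixed_point_imp_root:
  fixes idx :: "'n::finite \<Rightarrow> nat"
  assumes f: "\<And>z. norm z < \<rho> \<Longrightarrow> f z = cnj z + param_poly idx \<epsilon> (cnj z) * A (cnj z)"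
    and A: "\<And>z. norm z < \<rho> \<Longrightarrow> norm (A z - 1 / 2) < 1 / 8"
    and P': "\<And>z. norm z < \<rho> \<Longrightarrow> norm (poly (pderiv (parameter_poly idx \<epsilon>)) z) \<le> 1 / 10"
    and P: "norm (param_poly idx \<epsilon> z) < \<rho> / 2" and z: "norm z < \<rho> / 2"
    and fx: "f (f z) = z"
  shows "param_poly idx \<epsilon> z = 0"
proof -
  let ?P = "param_poly idx \<epsilon>"
  have \<rho>: "norm z < \<rho>" using z norm_ge_zero[of z] by linarith
  define a where "a = cnj (A (cnj z))"
  \<comment> \<open>P has real coefficients, so \<open>u = z + P(z) a\<close> is a small
    displacement of \<open>z\<close>, and the second application of \<open>f\<close> starts the
    formula again from \<open>u\<close>.\<close>
  define u where "u = cnj (f z)"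
  have a: "norm (a - 1 / 2) < 1 / 8"
  proof -
    have "a - 1 / 2 = cnj (A (cnj z) - 1 / 2)" by (simp add: a_def)
    then show ?thesis using A[of "cnj z"] \<rho> by (simp only: complex_mod_cnj)
  qed
  have a1: "norm a \<le> 5 / 8"
    using a norm_triangle_ineq[of "a - 1 / 2" "1 / 2"] by simp
  have u: "u = z + ?P z * a"
    using f[OF \<rho>] by (simp add: u_def a_def cnj_param_poly)
  have "norm u \<le> norm z + norm (?P z) * 1"
    unfolding u using a1 by (intro order.trans[OF norm_triangle_ineq] add_mono) (auto simp: norm_mult intro!: mult_left_le)
  then have u\<rho>: "norm u < \<rho>" using P z by simp
  have Au: "norm (A u - 1 / 2) < 1 / 8" using A[OF u\<rho>] .
  have Au1: "norm (A u) \<le> 5 / 8"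
    using Au norm_triangle_ineq[of "A u - 1 / 2" "1 / 2"] by simp
  have "norm (?P u - ?P z) \<le> 1 / 10 * norm (u - z)"
  proof (rule field_differentiable_bound[of "ball 0 \<rho>"])
    show "(?P has_field_derivative poly (pderiv (parameter_poly idx \<epsilon>)) w) (at w within ball 0 \<rho>)" for w
      by (rule has_field_derivative_param_poly)
  qed (use P' \<rho> u\<rho> in auto)
  also have "norm (u - z) \<le> norm (?P z) * (5 / 8)"
    using mult_left_mono[OF a1, of "norm (?P z)"] by (simp add: u norm_mult)
  finally have B: "norm (?P u - ?P z) \<le> norm (?P z) / 16" by simp
  have "f (f z) = u + ?P u * A u"
    using f[of "f z"] u\<rho> by (simp add: u_def)
  \<comment> \<open>The equation \<open>P(z) a + P(u) A(u) = 0\<close> regrouped around P(z). The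
    right side is at most |P(z)| / 16, where 1/16 is 1/10 times 5/8, whereas \<open>a + A u\<close>
    has modulus above 1/2; so P(z) must vanish.\<close>
  then have "?P z * (a + A u) = - ((?P u - ?P z) * A u)"
    using fx by (simp add: u algebra_simps)
  then have "norm (?P z) * norm (a + A u) = norm (?P u - ?P z) * norm (A u)"
    by (metis norm_minus_cancel norm_mult)
  also have "\<dots> \<le> norm (?P z) / 16 * 1"
    using B Au1 by (intro mult_mono) auto
  finally have le: "norm (?P z) * norm (a + A u) \<le> norm (?P z) / 16" by simp
  have "1 \<le> norm (a + A u) + norm (a - 1 / 2) + norm (A u - 1 / 2)"
  proof -
    have "norm ((a + A u) - (a - 1 / 2) - (A u - 1 / 2)) \<le> norm (a + A u) + norm (a - 1 / 2) + norm (A u - 1 / 2)"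
      using norm_triangle_ineq4[of "(a + A u) - (a - 1 / 2)" "A u - 1 / 2"]
        norm_triangle_ineq4[of "a + A u" "a - 1 / 2"] by linarith
    moreover have "(a + A u) - (a - 1 / 2) - (A u - 1 / 2) = 1" by simp
    ultimately show ?thesis by simp
  qed
  then have "norm (a + A u) > 1 / 2" using a Au by simp
  then have "norm (?P z) * (1 / 2) \<le> norm (?P z) * norm (a + A u)"
    by (intro mult_left_mono) auto
  then have "norm (?P z) \<le> 0" using le by linarith
  then show ?thesis by simp
qed

text \<open>A degree bound valid along the filter turns evaluation into a sum over a fixed range,
  for which coefficientwise convergence suffices.\<close>

lemma tendsto_poly_bounded_degree:
  fixes q :: "'a \<Rightarrow> complex poly"
  assumes "\<forall>\<^sub>F a in F. degree (q a) \<le> n" "\<And>j. ((\<lambda>a. coeff (q a) j) \<longlongrightarrow> c j) F" "(w \<longlongrightarrow> 0) F"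
  shows "((\<lambda>a. poly (q a) (w a)) \<longlongrightarrow> c 0) F"
proof -
  have "((\<lambda>a. \<Sum>j\<le>n. coeff (q a) j * w a ^ j) \<longlongrightarrow> (\<Sum>j\<le>n. c j * 0 ^ j)) F"
    by (intro tendsto_intros assms)
  moreover have "(\<Sum>j\<le>n. c j * 0 ^ j) = c 0"
    by (subst sum.mono_neutral_right[of _ "{0}"]) auto
  moreover have "\<forall>\<^sub>F a in F. (\<Sum>j\<le>n. coeff (q a) j * w a ^ j) = poly (q a) (w a)"
    using assms(1)
  proof eventually_elim
    case (elim a)
    then show ?case
      by (subst poly_altdef, intro sum.mono_neutral_right) (auto simp: coeff_eq_0)
  qed
  ultimately show ?thesis by (auto intro: Lim_transform_eventually)
qed

text \<open>All local facts with a single radius. \<open>F \<epsilon>\<close> is the holomorphic map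
  with \<open>f \<epsilon> = F \<epsilon> \<circ> cnj\<close>; the logarithm condition is stated in
  exponential form, and the bound 1 on the eigenvalue is what later allows the exponential to be
  inverted.\<close>

definition local_description ::
    "('n::finite \<Rightarrow> nat) \<Rightarrow> (real ^ 'n \<Rightarrow> complex \<Rightarrow> complex) \<Rightarrow> (real ^ 'n \<Rightarrow> complex \<Rightarrow> complex) \<Rightarrow>
      (real ^ 'n \<Rightarrow> real) \<Rightarrow> real \<Rightarrow> bool" where
  "local_description idx f F b r \<longleftrightarrow> r > 0 \<and> isCont b 0 \<and>
    (\<forall>\<epsilon>. norm \<epsilon> < r \<longrightarrow> F \<epsilon> holomorphic_on ball 0 r) \<and>
    (\<forall>\<epsilon> z. norm \<epsilon> < r \<longrightarrow> norm z < r \<longrightarrow> f \<epsilon> z = F \<epsilon> (cnj z)) \<and>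
    (\<forall>\<epsilon> z. norm \<epsilon> < r \<longrightarrow> norm z < r \<longrightarrow> param_poly idx \<epsilon> z = 0 \<longrightarrow> f \<epsilon> z = cnj z) \<and>
    (\<forall>\<epsilon> z. norm \<epsilon> < r \<longrightarrow> norm z < r \<longrightarrow> f \<epsilon> (f \<epsilon> z) = z \<longrightarrow> param_poly idx \<epsilon> z = 0) \<and>
    (\<forall>\<epsilon> z. norm \<epsilon> < r \<longrightarrow> norm z < r \<longrightarrow> 1 + complex_of_real (b \<epsilon>) * z ^ CARD('n) \<noteq> 0) \<and>
    (\<forall>\<epsilon> z. norm \<epsilon> < r \<longrightarrow> norm z < r \<longrightarrow>
      norm (poly (pderiv (parameter_poly idx \<epsilon>)) z / (1 + complex_of_real (b \<epsilon>) * z ^ CARD('n))) < 1) \<and>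
    (\<forall>\<epsilon> z. norm \<epsilon> < r \<longrightarrow> norm z < r \<longrightarrow> param_poly idx \<epsilon> z = 0 \<longrightarrow>
      deriv (F \<epsilon>) (cnj z) =
        exp (cnj (poly (pderiv (parameter_poly idx \<epsilon>)) z / (1 + complex_of_real (b \<epsilon>) * z ^ CARD('n))) / 2))"

lemma local_descriptionD:
  fixes idx :: "'n::finite \<Rightarrow> nat"
  assumes "local_description idx f F b r"
  shows "r > 0" "isCont b 0"
    and "\<And>\<epsilon>. norm \<epsilon> < r \<Longrightarrow> F \<epsilon> holomorphic_on ball 0 r"
    and "\<And>\<epsilon> z. norm \<epsilon> < r \<Longrightarrow> norm z < r \<Longrightarrow> f \<epsilon> z = F \<epsilon> (cnj z)"
    and "\<And>\<epsilon> z. norm \<epsilon> < r \<Longrightarrow> norm z < r \<Longrightarrow> param_poly idx \<epsilon> z = 0 \<Longrightarrow> f \<epsilon> z = cnj z"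
    and "\<And>\<epsilon> z. norm \<epsilon> < r \<Longrightarrow> norm z < r \<Longrightarrow> f \<epsilon> (f \<epsilon> z) = z \<Longrightarrow> param_poly idx \<epsilon> z = 0"
    and "\<And>\<epsilon> z. norm \<epsilon> < r \<Longrightarrow> norm z < r \<Longrightarrow> 1 + complex_of_real (b \<epsilon>) * z ^ CARD('n) \<noteq> 0"
    and "\<And>\<epsilon> z. norm \<epsilon> < r \<Longrightarrow> norm z < r \<Longrightarrow>
      norm (poly (pderiv (parameter_poly idx \<epsilon>)) z / (1 + complex_of_real (b \<epsilon>) * z ^ CARD('n))) < 1"
    and "\<And>\<epsilon> z. norm \<epsilon> < r \<Longrightarrow> norm z < r \<Longrightarrow> param_poly idx \<epsilon> z = 0 \<Longrightarrow>
      deriv (F \<epsilon>) (cnj z) =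
        exp (cnj (poly (pderiv (parameter_poly idx \<epsilon>)) z / (1 + complex_of_real (b \<epsilon>) * z ^ CARD('n))) / 2)"
  using assms unfolding local_description_def by blast+

text \<open>Every clause is an open condition that holds in the limit at the origin: the factor
  \<open>A\<close> tends to 1/2, the derivative of P to 0, and the denominator of the canonical
  field to 1.\<close>

lemma prepared_family_local_description:
  fixes idx :: "'n::finite \<Rightarrow> nat" and f :: "real ^ 'n \<Rightarrow> complex \<Rightarrow> complex"
  assumes pf: "prepared_family idx f"
  obtains F b r where "local_description idx f F b r"
proof -
  let ?k = "CARD('n)"
  let ?P = "param_poly idx" and ?P' = "\<lambda>\<epsilon>. poly (pderiv (parameter_poly idx \<epsilon>))"
  obtain r0 Q R where "r0 > 0"
    and degQ: "\<And>\<epsilon>. \<epsilon> \<in> ball 0 r0 \<Longrightarrow> degree (Q \<epsilon>) \<le> ?k"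
    and anaQ: "\<And>j. real_analytic_on (\<lambda>\<epsilon>. coeff (Q \<epsilon>) j) (ball 0 r0)"
    and mixR: "mix_analytic_on R (ball 0 r0 \<times> ball 0 r0)"
    and f0: "\<And>\<epsilon> z. \<epsilon> \<in> ball 0 r0 \<Longrightarrow> z \<in> ball 0 r0 \<Longrightarrow>
           f \<epsilon> z = cnj z + ?P \<epsilon> (cnj z) * (1 / 2 + poly (Q \<epsilon>) (cnj z) + ?P \<epsilon> (cnj z) * R (cnj z) \<epsilon>)"
    using pf unfolding prepared_family_def prepared_form_def by blast
  obtain b \<rho>b where "\<rho>b > 0" and anab: "real_analytic_on b (ball 0 \<rho>b)"
    and ev: "\<forall>\<^sub>F r in at_right 0. \<forall>\<^sub>F \<epsilon> in nhds 0.
           (\<forall>z\<in>fixed_points_in (f \<epsilon> \<circ> f \<epsilon>) r.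
              Ln (wirtinger_dzbar (f \<epsilon>) z) = cnj (deriv (canonical_field idx b \<epsilon>) z) / 2)"
    using pf unfolding prepared_family_def by (auto simp: eventually_conj_iff)
  define A where "A \<epsilon> w = 1 / 2 + poly (Q \<epsilon>) w + ?P \<epsilon> w * R w \<epsilon>" for \<epsilon> w
  define F where "F \<epsilon> w = w + ?P \<epsilon> w * A \<epsilon> w" for \<epsilon> w
  have fF: "f \<epsilon> z = F \<epsilon> (cnj z)" if "norm \<epsilon> < r0" "norm z < r0" for \<epsilon> z
    using f0[of \<epsilon> z] that by (simp add: F_def A_def)
  have contb: "isCont b 0"
    using real_analytic_on_isCont[OF anab] \<open>\<rho>b > 0\<close> by simp
  have holA: "A \<epsilon> holomorphic_on ball 0 r0" if "norm \<epsilon> < r0" for \<epsilon>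
  proof -
    have "(\<lambda>z. R z \<epsilon>) holomorphic_on {z. (z, \<epsilon>) \<in> ball 0 r0 \<times> ball 0 r0}"
      using mixR unfolding mix_analytic_on_def by blast
    then have "(\<lambda>z. R z \<epsilon>) holomorphic_on ball 0 r0"
      by (rule holomorphic_on_subset) (use that in auto)
    then show ?thesis
      unfolding A_def by (intro holomorphic_intros holomorphic_on_param_poly)
  qed
  have holF: "F \<epsilon> holomorphic_on ball 0 r0" if "norm \<epsilon> < r0" for \<epsilon>
    unfolding F_def by (intro holomorphic_intros holomorphic_on_param_poly holA that)
  have derivF: "(F \<epsilon> has_field_derivative 1 + ?P' \<epsilon> w * A \<epsilon> w) (at w)"
    if "norm \<epsilon> < r0" "norm w < r0" "?P \<epsilon> w = 0" for \<epsilon> w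
  proof -
    have "(A \<epsilon> has_field_derivative deriv (A \<epsilon>) w) (at w)"
      using holA[OF that(1)] that(2) by (intro holomorphic_derivI[of _ "ball 0 r0"]) auto
    then show ?thesis
      unfolding F_def[abs_def] using that(3)
      by (auto intro!: derivative_eq_intros has_field_derivative_param_poly)
  qed

  have limQ: "((\<lambda>(w, \<epsilon>). poly (Q \<epsilon>) w) \<longlongrightarrow> coeff (Q 0) 0) (nhds (0, 0))"
  proof -
    have "\<forall>\<^sub>F \<epsilon> in nhds 0. \<epsilon> \<in> ball 0 r0"
      using \<open>r0 > 0\<close> by (intro eventually_nhds_in_open) auto
    then have "\<forall>\<^sub>F x in nhds (0::complex, 0). snd x \<in> ball 0 r0"
      using tendsto_nhds_fst_snd(2) by (rule eventually_compose_filterlim)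
    then have "\<forall>\<^sub>F x in nhds (0::complex, 0). degree (Q (snd x)) \<le> ?k"
      by eventually_elim (rule degQ)
    moreover have "((\<lambda>x. coeff (Q (snd x)) j) \<longlongrightarrow> coeff (Q 0) j) (nhds (0::complex, 0))" for j
      using real_analytic_on_isCont[OF anaQ[of j], of 0] \<open>r0 > 0\<close>
      by (intro isCont_tendsto_compose[OF _ tendsto_nhds_fst_snd(2)]) auto
    ultimately show ?thesis
      unfolding case_prod_unfold using tendsto_nhds_fst_snd(1) by (rule tendsto_poly_bounded_degree)
  qed
  have limR: "((\<lambda>(w, \<epsilon>). R w \<epsilon>) \<longlongrightarrow> R 0 0) (nhds (0, 0))"
  proof -
    have "isCont (\<lambda>(w, \<epsilon>). R w \<epsilon>) (0, 0)"
      using mixR \<open>r0 > 0\<close> unfolding mix_analytic_on_def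
      by (intro real_analytic_on_isCont[of _ "ball 0 r0 \<times> ball 0 r0"]) auto
    from isCont_tendsto_nhds[OF this] show ?thesis by simp
  qed
  have limP: "((\<lambda>(w, \<epsilon>). ?P \<epsilon> w) \<longlongrightarrow> 0) (nhds (0, 0))" by (rule tendsto_param_poly)
  have limA0: "((\<lambda>(w, \<epsilon>). A \<epsilon> w) \<longlongrightarrow> 1 / 2 + coeff (Q 0) 0) (nhds (0, 0))"
    unfolding A_def case_prod_unfold
    using limQ limP limR by (auto intro!: tendsto_eq_intros simp: case_prod_unfold)
  \<comment> \<open>Continuity gives \<open>1 / 2 + coeff (Q 0) 0\<close> as the limit of
    \<open>A 0\<close>, and the normalization of \<open>f 0\<close> gives 1/2.\<close>
  have "coeff (Q 0) 0 = 0"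
  proof -
    have "filterlim (\<lambda>z. (cnj z, 0)) (nhds (0::complex, 0 :: real ^ 'n)) (at 0)"
      by (auto intro!: tendsto_eq_intros)
    from filterlim_compose[OF limA0 this]
    have 1: "((\<lambda>z. A 0 (cnj z) - 1 / 2) \<longlongrightarrow> coeff (Q 0) 0) (at 0)"
      by (auto intro!: tendsto_eq_intros)
    have "(\<lambda>z. f 0 z - (cnj z + cnj z ^ (?k + 1) / 2)) \<in> o[at 0](\<lambda>z. cnj z ^ (?k + 1))"
      using pf by (simp add: prepared_family_def)
    then have "((\<lambda>z. (f 0 z - (cnj z + cnj z ^ (?k + 1) / 2)) / cnj z ^ (?k + 1)) \<longlongrightarrow> 0) (at 0)"
      by (rule smalloD_tendsto)
    moreover have "\<forall>\<^sub>F z in at 0. (f 0 z - (cnj z + cnj z ^ (?k + 1) / 2)) / cnj z ^ (?k + 1) = A 0 (cnj z) - 1 / 2"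
    proof -
      have "\<forall>\<^sub>F z in at 0. z \<in> ball (0::complex) r0 - {0}"
        using \<open>r0 > 0\<close> by (intro eventually_at_in_open) auto
      then show ?thesis
      proof eventually_elim
        case (elim z)
        then have "f 0 z - (cnj z + cnj z ^ (?k + 1) / 2) = cnj z ^ (?k + 1) * (A 0 (cnj z) - 1 / 2)"
          using fF[of 0 z] \<open>r0 > 0\<close> by (simp add: F_def param_poly_def algebra_simps)
        then show ?case using elim by simp
      qed
    qed
    ultimately have "((\<lambda>z. A 0 (cnj z) - 1 / 2) \<longlongrightarrow> 0) (at 0)"
      by (rule Lim_transform_eventually)
    with 1 show ?thesis using tendsto_unique[OF _ 1] by (metis at_neq_bot)
  qed
  with limA0 have limA: "((\<lambda>(w, \<epsilon>). A \<epsilon> w) \<longlongrightarrow> 1 / 2) (nhds (0, 0))" by simp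
  have limb: "((\<lambda>(w, \<epsilon>). 1 + complex_of_real (b \<epsilon>) * w ^ ?k) \<longlongrightarrow> 1) (nhds (0, 0))"
  proof -
    have "((\<lambda>x. b (snd x)) \<longlongrightarrow> b 0) (nhds (0::complex, 0))"
      using contb by (rule isCont_tendsto_compose) (rule tendsto_nhds_fst_snd)
    then have "((\<lambda>x. 1 + complex_of_real (b (snd x)) * fst x ^ ?k) \<longlongrightarrow> 1 + of_real (b 0) * 0 ^ ?k) (nhds (0::complex, 0))"
      by (intro tendsto_intros tendsto_nhds_fst_snd)
    then show ?thesis by (simp add: case_prod_unfold zero_power)
  qed
  have limv: "((\<lambda>(w, \<epsilon>). ?P' \<epsilon> w / (1 + complex_of_real (b \<epsilon>) * w ^ ?k)) \<longlongrightarrow> 0) (nhds (0, 0))"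
    using tendsto_divide[OF tendsto_pderiv_parameter_poly[of idx] limb] by (simp add: case_prod_unfold)

  have "\<forall>\<^sub>F (w, \<epsilon>) in nhds (0, 0). norm (A \<epsilon> w - 1 / 2) < 1 / 8"
    using tendstoD[OF limA, of "1 / 8"] by (simp add: case_prod_unfold dist_norm)
  moreover have "\<forall>\<^sub>F (w, \<epsilon>) in nhds (0, 0). norm (?P' \<epsilon> w) < 1 / 10"
    using tendstoD[OF tendsto_pderiv_parameter_poly[of idx], of "1 / 10"] by (simp add: case_prod_unfold)
  moreover have "\<forall>\<^sub>F (w, \<epsilon>) in nhds (0, 0). norm (?P' \<epsilon> w / (1 + complex_of_real (b \<epsilon>) * w ^ ?k)) < 1"
    using tendstoD[OF limv, of 1] by (simp add: case_prod_unfold)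
  moreover have "\<forall>\<^sub>F (w, \<epsilon>) in nhds (0, 0). 1 + complex_of_real (b \<epsilon>) * w ^ ?k \<noteq> 0"
    using tendsto_imp_eventually_ne[OF limb, of 0] by (simp add: case_prod_unfold)
  ultimately have "\<forall>\<^sub>F (w, \<epsilon>) in nhds (0, 0). norm (A \<epsilon> w - 1 / 2) < 1 / 8 \<and> norm (?P' \<epsilon> w) < 1 / 10
      \<and> norm (?P' \<epsilon> w / (1 + complex_of_real (b \<epsilon>) * w ^ ?k)) < 1
      \<and> 1 + complex_of_real (b \<epsilon>) * w ^ ?k \<noteq> 0"
    unfolding case_prod_unfold by eventually_elim blast
  from eventually_nhds_prod_radius[OF this]
  obtain \<rho>1 where "\<rho>1 > 0" and \<rho>1': "\<forall>w \<epsilon>. norm w < \<rho>1 \<longrightarrow> norm \<epsilon> < \<rho>1 \<longrightarrow>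
      norm (A \<epsilon> w - 1 / 2) < 1 / 8 \<and> norm (?P' \<epsilon> w) < 1 / 10
      \<and> norm (?P' \<epsilon> w / (1 + complex_of_real (b \<epsilon>) * w ^ ?k)) < 1
      \<and> 1 + complex_of_real (b \<epsilon>) * w ^ ?k \<noteq> 0"
    unfolding prod.case by blast
  note \<rho>1 = \<rho>1'[rule_format]
  define \<rho> where "\<rho> = min r0 \<rho>1"
  have "\<rho> > 0" using \<open>r0 > 0\<close> \<open>\<rho>1 > 0\<close> by (simp add: \<rho>_def)
  have "\<forall>\<^sub>F (w, \<epsilon>) in nhds (0, 0). norm (?P \<epsilon> w) < \<rho> / 2"
    using tendstoD[OF limP, of "\<rho> / 2"] \<open>\<rho> > 0\<close> by (simp add: case_prod_unfold)
  from eventually_nhds_prod_radius[OF this]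
  obtain \<rho>2 where "\<rho>2 > 0" and \<rho>2': "\<forall>w \<epsilon>. norm w < \<rho>2 \<longrightarrow> norm \<epsilon> < \<rho>2 \<longrightarrow> norm (?P \<epsilon> w) < \<rho> / 2"
    unfolding prod.case by blast
  note \<rho>2 = \<rho>2'[rule_format]
  \<comment> \<open>The logarithm condition is available for all small disks, each with its own
    range of parameters; one disk \<open>rs\<close> and one range \<open>d\<close> are
    fixed.\<close>
  have "\<forall>\<^sub>F r in at_right 0. 0 < (r::real)"
    by (auto simp: eventually_at_filter)
  with ev have "\<forall>\<^sub>F r in at_right 0. (\<forall>\<^sub>F \<epsilon> in nhds 0.
           (\<forall>z\<in>fixed_points_in (f \<epsilon> \<circ> f \<epsilon>) r.
              Ln (wirtinger_dzbar (f \<epsilon>) z) = cnj (deriv (canonical_field idx b \<epsilon>) z) / 2)) \<and> 0 < r"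
    by (rule eventually_conj)
  from eventually_happens'[OF trivial_limit_at_right_real this]
  obtain rs where "rs > 0" and rs: "\<forall>\<^sub>F \<epsilon> in nhds 0.
           (\<forall>z\<in>fixed_points_in (f \<epsilon> \<circ> f \<epsilon>) rs.
              Ln (wirtinger_dzbar (f \<epsilon>) z) = cnj (deriv (canonical_field idx b \<epsilon>) z) / 2)"
    by blast
  then obtain d where "d > 0" and d: "\<And>\<epsilon> z. norm \<epsilon> < d \<Longrightarrow> z \<in> fixed_points_in (f \<epsilon> \<circ> f \<epsilon>) rs \<Longrightarrow>
              Ln (wirtinger_dzbar (f \<epsilon>) z) = cnj (deriv (canonical_field idx b \<epsilon>) z) / 2"
    unfolding eventually_nhds_metric by (auto simp: dist_norm)
  \<comment> \<open>\<open>\<rho> / 2\<close> and \<open>\<rho>2\<close> supply the bounds on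
    \<open>z\<close> and P(z) needed to recognize fixed points as roots; \<open>rs\<close> and
    \<open>d\<close> bring these roots within the range of the logarithm condition.\<close>
  define r where "r = Min {\<rho> / 2, \<rho>2, rs, d}"
  have r: "r \<le> \<rho> / 2" "r \<le> \<rho>2" "r \<le> rs" "r \<le> d" "r > 0" "r \<le> r0" "r \<le> \<rho>1" "r \<le> \<rho>"
    using \<open>\<rho> > 0\<close> \<open>\<rho>2 > 0\<close> \<open>rs > 0\<close> \<open>d > 0\<close> by (auto simp: r_def \<rho>_def)
  have root: "f \<epsilon> z = cnj z" if "norm \<epsilon> < r" "norm z < r" "?P \<epsilon> z = 0" for \<epsilon> z
  proof -
    have "?P \<epsilon> (cnj z) = 0" using that(3) cnj_param_poly[of idx \<epsilon> z] by simp
    then show ?thesis using fF[of \<epsilon> z] that r by (simp add: F_def)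
  qed
  show ?thesis
  proof (rule that[of F b r], unfold local_description_def, intro conjI allI impI)
    show "r > 0" "isCont b 0" by fact+
    show "f \<epsilon> z = F \<epsilon> (cnj z)" if "norm \<epsilon> < r" "norm z < r" for \<epsilon> z
      using fF that r by simp
    show "F \<epsilon> holomorphic_on ball 0 r" if "norm \<epsilon> < r" for \<epsilon>
      by (rule holomorphic_on_subset[OF holF]) (use that r in auto)
    show "f \<epsilon> z = cnj z" if "norm \<epsilon> < r" "norm z < r" "?P \<epsilon> z = 0" for \<epsilon> z
      using root that .
    show "?P \<epsilon> z = 0" if "norm \<epsilon> < r" "norm z < r" "f \<epsilon> (f \<epsilon> z) = z" for \<epsilon> z
    proof (rule fixed_point_imp_root[of \<rho> "f \<epsilon>" idx \<epsilon> "A \<epsilon>"])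
      show "f \<epsilon> w = cnj w + ?P \<epsilon> (cnj w) * A \<epsilon> (cnj w)" if "norm w < \<rho>" for w
        using fF[of \<epsilon> w] that \<open>norm \<epsilon> < r\<close> r by (simp add: F_def \<rho>_def)
      show "norm (A \<epsilon> w - 1 / 2) < 1 / 8" "norm (?P' \<epsilon> w) \<le> 1 / 10" if "norm w < \<rho>" for w
        using \<rho>1[of w \<epsilon>] that \<open>norm \<epsilon> < r\<close> r by (simp_all add: \<rho>_def)
      show "norm (?P \<epsilon> z) < \<rho> / 2" using \<rho>2[of z \<epsilon>] that r by simp
    qed (use that r in auto)
    show "1 + complex_of_real (b \<epsilon>) * z ^ ?k \<noteq> 0" and "norm (?P' \<epsilon> z / (1 + complex_of_real (b \<epsilon>) * z ^ ?k)) < 1"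
      if "norm \<epsilon> < r" "norm z < r" for \<epsilon> z
      using \<rho>1[of z \<epsilon>] that r by auto
    show "deriv (F \<epsilon>) (cnj z) = exp (cnj (?P' \<epsilon> z / (1 + complex_of_real (b \<epsilon>) * z ^ ?k)) / 2)"
      if \<epsilon>: "norm \<epsilon> < r" and z: "norm z < r" and P: "?P \<epsilon> z = 0" for \<epsilon> z
    proof -
      have Pc: "?P \<epsilon> (cnj z) = 0" using P cnj_param_poly[of idx \<epsilon> z] by simp
      have cz: "norm (cnj z) < r" using z by simp
      have "f \<epsilon> (f \<epsilon> z) = z" using root[OF \<epsilon> z P] root[OF \<epsilon> cz Pc] by simp
      then have "z \<in> fixed_points_in (f \<epsilon> \<circ> f \<epsilon>) rs"
        using z r by (simp add: fixed_points_in_def)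
      then have Ln: "Ln (wirtinger_dzbar (f \<epsilon>) z) = cnj (deriv (canonical_field idx b \<epsilon>) z) / 2"
        using d[of \<epsilon> z] \<epsilon> r by simp
      define D where "D = 1 + ?P' \<epsilon> (cnj z) * A \<epsilon> (cnj z)"
      have D: "(F \<epsilon> has_field_derivative D) (at (cnj z))"
        unfolding D_def using \<epsilon> z Pc r by (intro derivF) auto
      have "((\<lambda>z. F \<epsilon> (cnj z)) has_derivative (\<lambda>h. D * cnj h)) (at z)"
        by (rule has_derivative_compose_cnj[OF D])
      then have "(f \<epsilon> has_derivative (\<lambda>h. D * cnj h)) (at z)"
      proof (rule has_derivative_transform_within_open)
        show "z \<in> ball 0 r" using z by simp
        show "F \<epsilon> (cnj w) = f \<epsilon> w" if "w \<in> ball 0 r" for w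
          using fF[of \<epsilon> w] that \<epsilon> r by simp
      qed simp
      then have "wirtinger_dzbar (f \<epsilon>) z = D" by (rule wirtinger_dzbar_compose_cnj)
      \<comment> \<open>Needed to undo \<open>Ln\<close>; in fact \<open>D\<close> differs from 1 by
        at most 1/10.\<close>
      moreover have "D \<noteq> 0"
      proof -
        have "norm (?P' \<epsilon> (cnj z) * A \<epsilon> (cnj z)) < 1"
        proof -
          have 1: "norm (A \<epsilon> (cnj z) - 1 / 2) < 1 / 8" "norm (?P' \<epsilon> (cnj z)) < 1 / 10"
            using \<rho>1[of "cnj z" \<epsilon>] \<epsilon> z r by simp_all
          have "norm (A \<epsilon> (cnj z)) \<le> 1"
            using 1(1) norm_triangle_ineq[of "A \<epsilon> (cnj z) - 1 / 2" "1 / 2"] by simp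
          then have "norm (?P' \<epsilon> (cnj z)) * norm (A \<epsilon> (cnj z)) \<le> 1 / 10 * 1"
            using 1(2) by (intro mult_mono) auto
          then show ?thesis by (simp add: norm_mult)
        qed
        then show ?thesis unfolding D_def
          by (metis add_eq_0_iff less_irrefl norm_minus_cancel norm_one)
      qed
      ultimately have "D = exp (cnj (deriv (canonical_field idx b \<epsilon>) z) / 2)"
        using Ln exp_Ln by metis
      moreover have "deriv (canonical_field idx b \<epsilon>) z = ?P' \<epsilon> z / (1 + complex_of_real (b \<epsilon>) * z ^ ?k)"
        using \<rho>1[of z \<epsilon>] \<epsilon> z r P by (intro deriv_canonical_field) auto
      ultimately show ?thesis
        using DERIV_imp_deriv[OF D] by simp
    qed
  qed
qed

section \<open>Uniqueness of the canonical parameter\<close>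

lemma cnj_canonical_eigenvalue:
  fixes idx :: "'n::finite \<Rightarrow> nat"
  shows "cnj (poly (pderiv (parameter_poly idx \<epsilon>)) z / (1 + complex_of_real (b \<epsilon>) * z ^ CARD('n))) =
    poly (pderiv (parameter_poly idx \<epsilon>)) (cnj z) / (1 + complex_of_real (b \<epsilon>) * cnj z ^ CARD('n))"
  by (simp add: cnj_pderiv_parameter_poly)

text \<open>The chain rule relates the derivative of \<open>f1\<close> at a root to that of
  \<open>f2\<close> at its image through derivatives of \<open>H\<close> at two different points,
  \<open>z\<close> and \<open>cnj z\<close>. Combining the relations at both roots cancels the
  derivatives of \<open>H\<close>. The eigenvalue identity is stated without denominators, ready for
  polynomial divisibility.\<close>

lemma conjugacy_preserves_eigenvalues:
  fixes idx :: "'n::finite \<Rightarrow> nat" and f1 f2 :: "real ^ 'n \<Rightarrow> complex \<Rightarrow> complex"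
  assumes idx: "bij_betw idx UNIV {..<CARD('n)}"
    and pf1: "prepared_family idx f1" and pf2: "prepared_family idx f2"
    and conj: "mix_analytic_conjugacy f1 f2 H \<phi>"
  obtains r s b1 b2 where "r > 0" "s > 0" "isCont b1 0" "isCont b2 0"
    and "continuous_on (cball 0 r \<times> cball 0 s) (\<lambda>(z, \<epsilon>). H z \<epsilon>)"
    and "\<And>\<epsilon>. \<epsilon> \<in> cball 0 s \<Longrightarrow> (\<lambda>z. H z \<epsilon>) holomorphic_on ball 0 r"
    and "\<And>\<epsilon> z. \<epsilon> \<in> cball 0 s \<Longrightarrow> param_poly idx \<epsilon> z = 0 \<Longrightarrow> norm z < r"
    and "continuous_on (cball 0 s) \<phi>"
    and "deriv (\<lambda>z. H z 0) 0 \<noteq> 0" and "cnj (deriv (\<lambda>z. H z 0) 0) = deriv (\<lambda>z. H z 0) 0"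
    and "\<And>\<epsilon> z. \<epsilon> \<in> cball 0 s \<Longrightarrow> param_poly idx \<epsilon> z = 0 \<Longrightarrow> param_poly idx (\<phi> \<epsilon>) (H z \<epsilon>) = 0"
    and "\<And>\<epsilon> z. \<epsilon> \<in> cball 0 s \<Longrightarrow> param_poly idx \<epsilon> z = 0 \<Longrightarrow>
      (1 + complex_of_real (b1 \<epsilon>) * z ^ CARD('n)) * poly (pderiv (parameter_poly idx (\<phi> \<epsilon>))) (H z \<epsilon>)
      = poly (pderiv (parameter_poly idx \<epsilon>)) z * (1 + complex_of_real (b2 (\<phi> \<epsilon>)) * H z \<epsilon> ^ CARD('n))"
proof -
  let ?k = "CARD('n)"
  let ?P = "param_poly idx" and ?P' = "\<lambda>\<epsilon>. poly (pderiv (parameter_poly idx \<epsilon>))"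
  obtain F1 b1 r1 where L1: "local_description idx f1 F1 b1 r1"
    by (rule prepared_family_local_description[OF pf1])
  note r1 = local_descriptionD(1)[OF L1] and contb1 = local_descriptionD(2)[OF L1]
    and hol1 = local_descriptionD(3)[OF L1] and f1 = local_descriptionD(4)[OF L1]
    and root1 = local_descriptionD(5)[OF L1]
    and den1 = local_descriptionD(7)[OF L1] and small1 = local_descriptionD(8)[OF L1]
    and d1 = local_descriptionD(9)[OF L1]
  obtain F2 b2 r2 where L2: "local_description idx f2 F2 b2 r2"
    by (rule prepared_family_local_description[OF pf2])
  note r2 = local_descriptionD(1)[OF L2] and contb2 = local_descriptionD(2)[OF L2]
    and hol2 = local_descriptionD(3)[OF L2] and f2 = local_descriptionD(4)[OF L2]
    and root2 = local_descriptionD(5)[OF L2] and fix2 = local_descriptionD(6)[OF L2]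
    and den2 = local_descriptionD(7)[OF L2] and small2 = local_descriptionD(8)[OF L2]
    and d2 = local_descriptionD(9)[OF L2]
  obtain D where D: "(0, 0) \<in> D" and diffeo: "diffeomorphism_on (\<lambda>(z, \<eta>). (H z \<eta>, \<phi> \<eta>)) D"
    and mix: "mix_analytic_on H D" and H0: "H 0 0 = 0" and \<phi>0: "\<phi> 0 = 0"
    and ev: "\<forall>\<^sub>F (z, \<eta>) in nhds (0, 0). H (f1 \<eta> z) \<eta> = f2 (\<phi> \<eta>) (H z \<eta>)"
    using conj unfolding mix_analytic_conjugacy_def by blast
  define h where "h = (\<lambda>(z, \<eta>). (H z \<eta>, \<phi> \<eta>))"
  have "open D" using diffeo by (simp add: diffeomorphism_on_def)
  obtain h' where homeo: "homeomorphism D (h ` D) h h'"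
    using diffeo by (auto simp: diffeomorphism_on_def h_def)
  have conth: "continuous_on D h" and injh: "inj_on h D"
    using homeomorphism_cont1[OF homeo] inj_on_inverseI[of D h' h] homeomorphism_apply1[OF homeo] by blast+
  have "((\<lambda>x. h x) \<longlongrightarrow> h (0, 0)) (nhds (0, 0))"
  proof -
    have "isCont h (0, 0)"
      using conth \<open>open D\<close> D by (simp add: continuous_on_eq_continuous_at)
    from isCont_tendsto_nhds[OF this] show ?thesis .
  qed
  then have limh: "((\<lambda>x. h x) \<longlongrightarrow> (0, 0)) (nhds (0, 0))"
    by (simp add: h_def H0 \<phi>0)
  have "\<forall>\<^sub>F x in nhds (0, 0). x \<in> D"
    using \<open>open D\<close> D by (rule eventually_nhds_in_open)
  moreover have "\<forall>\<^sub>F x in nhds (0, 0). norm (H (fst x) (snd x)) < r2"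
    using tendstoD[OF tendsto_fst[OF limh] r2] by (simp add: h_def case_prod_unfold)
  moreover have "\<forall>\<^sub>F x in nhds (0 :: complex, 0). norm (\<phi> (snd x)) < r2"
    using tendstoD[OF tendsto_snd[OF limh] r2] by (simp add: h_def case_prod_unfold)
  ultimately have "\<forall>\<^sub>F (z, \<eta>) in nhds (0, 0). (z, \<eta>) \<in> D \<and> norm (H z \<eta>) < r2 \<and> norm (\<phi> \<eta>) < r2
      \<and> H (f1 \<eta> z) \<eta> = f2 (\<phi> \<eta>) (H z \<eta>)"
    using ev unfolding case_prod_unfold by eventually_elim simp
  from eventually_nhds_prod_radius[OF this]
  obtain \<rho> where "\<rho> > 0" and \<rho>': "\<forall>z \<eta>. norm z < \<rho> \<longrightarrow> norm \<eta> < \<rho> \<longrightarrow> (z, \<eta>) \<in> D \<and> norm (H z \<eta>) < r2 \<and> norm (\<phi> \<eta>) < r2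
      \<and> H (f1 \<eta> z) \<eta> = f2 (\<phi> \<eta>) (H z \<eta>)"
    unfolding prod.case by blast
  note \<rho> = \<rho>'[rule_format]
  define r where "r = min \<rho> r1 / 2"
  have r: "r > 0" "r < \<rho>" "r < r1" using \<open>\<rho> > 0\<close> r1 by (auto simp: r_def)
  obtain d where "d > 0" and d: "\<And>\<epsilon> z. norm \<epsilon> < d \<Longrightarrow> ?P \<epsilon> z = 0 \<Longrightarrow> norm z < r"
    using param_poly_roots_small[OF idx r(1)] unfolding eventually_nhds_metric by (auto simp: dist_norm)
  define s where "s = min r d / 2"
  have s: "s > 0" "s < r" "s < d" using \<open>r > 0\<close> \<open>d > 0\<close> by (auto simp: s_def)
  have inD: "cball 0 r \<times> cball 0 s \<subseteq> D"
    using \<rho> r s by force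
  have holH: "(\<lambda>z. H z \<epsilon>) holomorphic_on ball 0 r" if "\<epsilon> \<in> cball 0 s" for \<epsilon>
  proof (rule holomorphic_on_subset)
    show "(\<lambda>z. H z \<epsilon>) holomorphic_on {z. (z, \<epsilon>) \<in> D}"
      using mix by (simp add: mix_analytic_on_def)
    show "ball 0 r \<subseteq> {z. (z, \<epsilon>) \<in> D}" using inD that by auto
  qed
  \<comment> \<open>Points of one slice share the second component of \<open>h\<close>, so the
    diffeomorphism is injective on each slice, and a holomorphic injection has nonzero
    derivative.\<close>
  have H'nz: "deriv (\<lambda>z. H z \<epsilon>) z \<noteq> 0" if "\<epsilon> \<in> cball 0 s" "norm z < r" for \<epsilon> z
  proof (rule holomorphic_injective_imp_regular[OF holH[OF that(1)] open_ball])
    show "inj_on (\<lambda>z. H z \<epsilon>) (ball 0 r)"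
    proof (rule inj_onI)
      fix x y assume xy: "x \<in> ball 0 r" "y \<in> ball 0 r" "H x \<epsilon> = H y \<epsilon>"
      then have "(x, \<epsilon>) \<in> D" "(y, \<epsilon>) \<in> D" "h (x, \<epsilon>) = h (y, \<epsilon>)"
        using inD that(1) by (auto simp: h_def)
      then show "x = y" using inj_onD[OF injh] by blast
    qed
  qed (use that in auto)
  \<comment> \<open>Since \<open>f1\<close> exchanges \<open>z\<close> and \<open>cnj z\<close>,
    \<open>f2\<close> exchanges their images, which are therefore fixed by the second iterate of
    \<open>f2\<close> and so are roots; on roots \<open>f2\<close> is conjugation.\<close>
  have swap: "?P (\<phi> \<epsilon>) (H z \<epsilon>) = 0" "H (cnj z) \<epsilon> = cnj (H z \<epsilon>)"
    if \<epsilon>: "\<epsilon> \<in> cball 0 s" and z: "?P \<epsilon> z = 0" for \<epsilon> z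
  proof -
    have \<epsilon>': "norm \<epsilon> < \<rho>" "norm \<epsilon> < r1" "norm \<epsilon> < d" using \<epsilon> s r by auto
    have cz: "?P \<epsilon> (cnj z) = 0" using z cnj_param_poly[of idx \<epsilon> z] by simp
    have nz: "norm z < r" using d \<epsilon>'(3) z by blast
    have 1: "H (cnj z) \<epsilon> = f2 (\<phi> \<epsilon>) (H z \<epsilon>)"
      using \<rho>[of z \<epsilon>] root1[of \<epsilon> z] \<epsilon>' nz r z by simp
    have 2: "H z \<epsilon> = f2 (\<phi> \<epsilon>) (H (cnj z) \<epsilon>)"
      using \<rho>[of "cnj z" \<epsilon>] root1[of \<epsilon> "cnj z"] \<epsilon>' nz r cz by simp
    have small: "norm (\<phi> \<epsilon>) < r2" "norm (H z \<epsilon>) < r2"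
      using \<rho>[of z \<epsilon>] \<epsilon>' nz r by auto
    have "f2 (\<phi> \<epsilon>) (f2 (\<phi> \<epsilon>) (H z \<epsilon>)) = H z \<epsilon>"
      unfolding 1[symmetric] by (rule 2[symmetric])
    with small show P: "?P (\<phi> \<epsilon>) (H z \<epsilon>) = 0" by (rule fix2)
    show "H (cnj z) \<epsilon> = cnj (H z \<epsilon>)"
      unfolding 1 using small P by (rule root2)
  qed
  define v1 where "v1 \<epsilon> z = ?P' \<epsilon> z / (1 + complex_of_real (b1 \<epsilon>) * z ^ ?k)" for \<epsilon> z
  define v2 where "v2 \<epsilon> z = ?P' \<epsilon> z / (1 + complex_of_real (b2 \<epsilon>) * z ^ ?k)" for \<epsilon> z
  have cnjv: "cnj (v1 \<epsilon> z) = v1 \<epsilon> (cnj z)" "cnj (v2 \<epsilon> z) = v2 \<epsilon> (cnj z)" for \<epsilon> z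
    unfolding v1_def v2_def by (rule cnj_canonical_eigenvalue)+
  \<comment> \<open>The conjugacy equation is read at \<open>cnj u\<close>, where both sides are
    holomorphic in \<open>u\<close>: \<open>H\<close> after \<open>F1\<close>, and \<open>F2\<close>
    after the reflection of \<open>H\<close>. Their derivatives at \<open>u = cnj z\<close> are
    compared.\<close>
  have multiplier: "deriv (\<lambda>z. H z \<epsilon>) (cnj z) * exp (cnj (v1 \<epsilon> z) / 2) =
      exp (cnj (v2 (\<phi> \<epsilon>) (H z \<epsilon>)) / 2) * cnj (deriv (\<lambda>z. H z \<epsilon>) z)"
    if \<epsilon>: "\<epsilon> \<in> cball 0 s" and z: "?P \<epsilon> z = 0" for \<epsilon> z
  proof -
    have \<epsilon>': "norm \<epsilon> < \<rho>" "norm \<epsilon> < r1" "norm \<epsilon> < d" using \<epsilon> s r by auto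
    have nz: "norm z < r" using d \<epsilon>'(3) z by blast
    have F1z: "F1 \<epsilon> (cnj z) = cnj z"
      using root1[of \<epsilon> z] f1[of \<epsilon> z] \<epsilon>' nz r z by simp
    have H': "((\<lambda>z. H z \<epsilon>) has_field_derivative deriv (\<lambda>z. H z \<epsilon>) w) (at w)" if "norm w < r" for w
      using holH[OF \<epsilon>] that by (intro holomorphic_derivI[of _ "ball 0 r"]) auto
    have F1': "(F1 \<epsilon> has_field_derivative exp (cnj (v1 \<epsilon> z) / 2)) (at (cnj z))"
      unfolding v1_def using d1[of \<epsilon> z] hol1[of \<epsilon>] \<epsilon>' nz r z
      using holomorphic_derivI[of "F1 \<epsilon>" "ball 0 r1" "cnj z"] by simp
    have w: "norm (H z \<epsilon>) < r2" "norm (\<phi> \<epsilon>) < r2" using \<rho>[of z \<epsilon>] \<epsilon>' nz r by auto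
    have F2': "(F2 (\<phi> \<epsilon>) has_field_derivative exp (cnj (v2 (\<phi> \<epsilon>) (H z \<epsilon>)) / 2)) (at (cnj (H z \<epsilon>)))"
      unfolding v2_def using d2[OF w(2,1) swap(1)[OF \<epsilon> z]] hol2[OF w(2)] w(1)
        holomorphic_derivI[of "F2 (\<phi> \<epsilon>)" "ball 0 r2" "cnj (H z \<epsilon>)"] by simp
    have 1: "((\<lambda>u. H (F1 \<epsilon> u) \<epsilon>) has_field_derivative
        deriv (\<lambda>z. H z \<epsilon>) (cnj z) * exp (cnj (v1 \<epsilon> z) / 2)) (at (cnj z))"
      using DERIV_chain2[OF _ F1', of "\<lambda>z. H z \<epsilon>"] H'[of "cnj z"] nz F1z by simp
    have "((\<lambda>u. cnj (H (cnj u) \<epsilon>)) has_field_derivative cnj (deriv (\<lambda>z. H z \<epsilon>) z)) (at (cnj z))"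
      using has_field_derivative_cnj_cnj[of "\<lambda>z. H z \<epsilon>" _ "cnj z"] H'[of z] nz by (simp add: o_def)
    then have 2: "((\<lambda>u. F2 (\<phi> \<epsilon>) (cnj (H (cnj u) \<epsilon>))) has_field_derivative
        exp (cnj (v2 (\<phi> \<epsilon>) (H z \<epsilon>)) / 2) * cnj (deriv (\<lambda>z. H z \<epsilon>) z)) (at (cnj z))"
      using DERIV_chain2[of "F2 (\<phi> \<epsilon>)" _ "\<lambda>u. cnj (H (cnj u) \<epsilon>)" "cnj z"] F2' by simp
    have "((\<lambda>u. H (F1 \<epsilon> u) \<epsilon>) has_field_derivative
        exp (cnj (v2 (\<phi> \<epsilon>) (H z \<epsilon>)) / 2) * cnj (deriv (\<lambda>z. H z \<epsilon>) z)) (at (cnj z))"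
      using 2
    proof (rule has_field_derivative_transform_within_open)
      show "cnj z \<in> ball 0 r" using nz by simp
      show "F2 (\<phi> \<epsilon>) (cnj (H (cnj u) \<epsilon>)) = H (F1 \<epsilon> u) \<epsilon>" if "u \<in> ball 0 r" for u
        using f1[of \<epsilon> "cnj u"] f2[of "\<phi> \<epsilon>" "H (cnj u) \<epsilon>"] \<rho>[of "cnj u" \<epsilon>] that \<epsilon>' r w by simp
    qed simp
    then show ?thesis using 1 by (rule DERIV_unique[rotated])
  qed
  have eigen: "v1 \<epsilon> z = v2 (\<phi> \<epsilon>) (H z \<epsilon>)" if \<epsilon>: "\<epsilon> \<in> cball 0 s" and z: "?P \<epsilon> z = 0" for \<epsilon> z
  proof -
    have \<epsilon>': "norm \<epsilon> < \<rho>" "norm \<epsilon> < r1" "norm \<epsilon> < d" using \<epsilon> s r by auto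
    have nz: "norm z < r" using d \<epsilon>'(3) z by blast
    have cz: "?P \<epsilon> (cnj z) = 0" using z cnj_param_poly[of idx \<epsilon> z] by simp
    \<comment> \<open>The relation at \<open>z\<close>, conjugated, and the relation at
      \<open>cnj z\<close> are multiplied. What remains, \<open>e1^2 = e2^2\<close>, is the equality
      of the multipliers of the second iterates.\<close>
    define a c e1 e2 where "a = deriv (\<lambda>z. H z \<epsilon>) z" "c = cnj (deriv (\<lambda>z. H z \<epsilon>) (cnj z))"
      "e1 = exp (v1 \<epsilon> z / 2)" "e2 = exp (v2 (\<phi> \<epsilon>) (H z \<epsilon>) / 2)"
    note defs = this
    have "cnj (deriv (\<lambda>z. H z \<epsilon>) (cnj z) * exp (cnj (v1 \<epsilon> z) / 2)) =
      cnj (exp (cnj (v2 (\<phi> \<epsilon>) (H z \<epsilon>)) / 2) * cnj (deriv (\<lambda>z. H z \<epsilon>) z))"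
      by (simp only: multiplier[OF \<epsilon> z])
    then have 1: "c * e1 = e2 * a"
      by (simp add: defs exp_cnj)
    have 2: "a * e1 = e2 * c"
      using multiplier[OF \<epsilon> cz] by (simp add: defs swap(2)[OF \<epsilon> z] cnjv)
    have "a \<noteq> 0" "c \<noteq> 0" using H'nz[OF \<epsilon>, of z] H'nz[OF \<epsilon>, of "cnj z"] nz by (auto simp: defs)
    have "(a * c) * e1 ^ 2 = (c * e1) * (a * e1)" by (simp add: power2_eq_square)
    also have "\<dots> = (a * c) * e2 ^ 2" unfolding 1 2 by (simp add: power2_eq_square)
    finally have "e1 ^ 2 = e2 ^ 2" using \<open>a \<noteq> 0\<close> \<open>c \<noteq> 0\<close> by simp
    then have "exp (v1 \<epsilon> z) = exp (v2 (\<phi> \<epsilon>) (H z \<epsilon>))"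
      by (simp add: defs flip: exp_double)
    moreover have "\<bar>Im (v1 \<epsilon> z)\<bar> < 1"
      using small1[of \<epsilon> z] \<epsilon>' nz r abs_Im_le_cmod[of "v1 \<epsilon> z"] unfolding v1_def by linarith
    moreover have "\<bar>Im (v2 (\<phi> \<epsilon>) (H z \<epsilon>))\<bar> < 1"
    proof -
      have "norm (\<phi> \<epsilon>) < r2" "norm (H z \<epsilon>) < r2"
        using \<rho>[of z \<epsilon>] \<epsilon>' nz r by auto
      from small2[OF this] show ?thesis
        using abs_Im_le_cmod[of "v2 (\<phi> \<epsilon>) (H z \<epsilon>)"] unfolding v2_def by linarith
    qed
    \<comment> \<open>Both imaginary parts are below 1 in modulus, so the difference cannot be a
      nonzero multiple of the period of \<open>exp\<close>.\<close>
    ultimately have "\<bar>Im (v1 \<epsilon> z) - Im (v2 (\<phi> \<epsilon>) (H z \<epsilon>))\<bar> < 2 * pi"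
      using pi_gt3 by linarith
    then show ?thesis
      using \<open>exp (v1 \<epsilon> z) = exp (v2 (\<phi> \<epsilon>) (H z \<epsilon>))\<close> by (rule exp_complex_eqI)
  qed
  show ?thesis
  proof (rule that[of r s b1 b2])
    show "r > 0" "s > 0" "isCont b1 0" "isCont b2 0" by fact+
    have "continuous_on (cball 0 r \<times> cball 0 s) (\<lambda>x. fst (h x))"
      by (intro continuous_on_fst continuous_on_subset[OF conth inD])
    then show "continuous_on (cball 0 r \<times> cball 0 s) (\<lambda>(z, \<epsilon>). H z \<epsilon>)"
      by (simp add: h_def case_prod_unfold)
    show "(\<lambda>z. H z \<epsilon>) holomorphic_on ball 0 r" if "\<epsilon> \<in> cball 0 s" for \<epsilon>
      using holH[OF that] .
    show "norm z < r" if "\<epsilon> \<in> cball 0 s" "?P \<epsilon> z = 0" for \<epsilon> z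
      using d[of \<epsilon> z] that s by simp
    have "continuous_on (cball 0 s) (\<lambda>\<epsilon>. snd (h (0, \<epsilon>)))"
      using inD \<open>r > 0\<close> by (intro continuous_on_snd continuous_on_compose2[OF conth] continuous_intros) auto
    then show "continuous_on (cball 0 s) \<phi>" by (simp add: h_def)
    show "deriv (\<lambda>z. H z 0) 0 \<noteq> 0" using H'nz[of 0 0] r s by simp
    \<comment> \<open>At the origin both eigenvalues are 0, and the relation between derivatives
      reduces to the reality of the derivative of \<open>H\<close>.\<close>
    have "?P 0 0 = 0" "v1 0 0 = 0" "v2 0 0 = 0"
      by (simp_all add: param_poly_def v1_def v2_def poly_pderiv_parameter_poly zero_power)
    then show "cnj (deriv (\<lambda>z. H z 0) 0) = deriv (\<lambda>z. H z 0) 0"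
      using multiplier[of 0 0] s by (simp add: H0 \<phi>0)
    fix \<epsilon> z assume \<epsilon>: "\<epsilon> \<in> cball 0 s" and z: "?P \<epsilon> z = 0"
    show "?P (\<phi> \<epsilon>) (H z \<epsilon>) = 0" using swap(1)[OF \<epsilon> z] .
    have nz: "norm z < r" "norm \<epsilon> < r" using d[of \<epsilon> z] \<epsilon> z s by auto
    have "1 + complex_of_real (b1 \<epsilon>) * z ^ ?k \<noteq> 0"
      using den1[of \<epsilon> z] nz r by simp
    moreover have "1 + complex_of_real (b2 (\<phi> \<epsilon>)) * H z \<epsilon> ^ ?k \<noteq> 0"
      using den2[of "\<phi> \<epsilon>" "H z \<epsilon>"] \<rho>[of z \<epsilon>] nz r by simp
    ultimately show "(1 + complex_of_real (b1 \<epsilon>) * z ^ ?k) * ?P' (\<phi> \<epsilon>) (H z \<epsilon>)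
      = ?P' \<epsilon> z * (1 + complex_of_real (b2 (\<phi> \<epsilon>)) * H z \<epsilon> ^ ?k)"
      using eigen[OF \<epsilon> z] by (simp add: v1_def v2_def frac_eq_eq mult.commute)
  qed
qed

lemma odd_power_eq_1_real:
  fixes \<omega> :: complex
  assumes "cnj \<omega> = \<omega>" "odd k" "\<omega> ^ k = 1"
  shows "\<omega> = 1"
proof -
  obtain x where x: "\<omega> = of_real x"
    using assms(1) by (metis Reals_cnj_iff Reals_cases)
  have "x ^ k = 1"
    using assms(3) unfolding x by (metis of_real_eq_1_iff of_real_power)
  moreover from this have "\<bar>x\<bar> = 1"
    using assms(2) power_eq_1_iff[of "\<bar>x\<bar>" k] odd_pos[of k] by (metis abs_ge_zero abs_one less_not_refl power_abs power_eq_imp_eq_base power_one zero_le_one)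
  ultimately show ?thesis
    using assms(2) x by (auto simp: abs_if split: if_splits)
qed

lemma canonical_parameter_unique:
  fixes idx :: "'n::finite \<Rightarrow> nat" and f1 f2 :: "real ^ 'n \<Rightarrow> complex \<Rightarrow> complex"
  assumes idx: "bij_betw idx UNIV {..<CARD('n)}" and odd: "odd CARD('n)"
    and pf: "prepared_family idx f1" "prepared_family idx f2"
    and conj: "mix_analytic_conjugacy f1 f2 H \<phi>"
  shows "\<forall>\<^sub>F \<epsilon> in nhds 0. \<phi> \<epsilon> = \<epsilon>"
proof (rule conjugacy_preserves_eigenvalues[OF idx pf conj])
  let ?k = "CARD('n)"
  let ?P = "parameter_poly idx"
  fix r s b1 b2
  assume r: "r > 0" and s: "s > 0" and b: "isCont b1 0" "isCont b2 0"
    and contH: "continuous_on (cball 0 r \<times> cball 0 s) (\<lambda>(z, \<epsilon>). H z \<epsilon>)"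
    and holH: "\<And>\<epsilon>. \<epsilon> \<in> cball 0 s \<Longrightarrow> (\<lambda>z. H z \<epsilon>) holomorphic_on ball 0 r"
    and roots: "\<And>\<epsilon> z. \<epsilon> \<in> cball 0 s \<Longrightarrow> param_poly idx \<epsilon> z = 0 \<Longrightarrow> norm z < r"
    and cont\<phi>: "continuous_on (cball 0 s) \<phi>"
    and H': "deriv (\<lambda>z. H z 0) 0 \<noteq> 0" "cnj (deriv (\<lambda>z. H z 0) 0) = deriv (\<lambda>z. H z 0) 0"
    and Hroot: "\<And>\<epsilon> z. \<epsilon> \<in> cball 0 s \<Longrightarrow> param_poly idx \<epsilon> z = 0 \<Longrightarrow> param_poly idx (\<phi> \<epsilon>) (H z \<epsilon>) = 0"
    and eigen: "\<And>\<epsilon> z. \<epsilon> \<in> cball 0 s \<Longrightarrow> param_poly idx \<epsilon> z = 0 \<Longrightarrow>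
      (1 + complex_of_real (b1 \<epsilon>) * z ^ ?k) * poly (pderiv (?P (\<phi> \<epsilon>))) (H z \<epsilon>)
      = poly (pderiv (?P \<epsilon>)) z * (1 + complex_of_real (b2 (\<phi> \<epsilon>)) * H z \<epsilon> ^ ?k)"
  have roots': "norm z < r" if "\<epsilon> \<in> cball 0 s" "poly (?P \<epsilon>) z = 0" for \<epsilon> z
    using roots that by (simp add: poly_parameter_poly)
  have P0: "?P 0 = monom 1 (?k + 1)"
    by (simp add: parameter_poly_def)
  have \<phi>0: "\<phi> 0 = 0" using conj by (simp add: mix_analytic_conjugacy_def)
  have isCont\<phi>: "isCont \<phi> \<epsilon>" if "\<epsilon> \<in> ball 0 s" for \<epsilon>
    using continuous_on_subset[OF cont\<phi> ball_subset_cball] that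
    by (simp add: continuous_on_eq_continuous_at)
  define S where "S = {\<epsilon>. rsquarefree (?P \<epsilon>)}"
  \<comment> \<open>Neighbourhoods of 0 restricted to parameters with simple roots, the only ones
    for which divisibility by the square is derived. Density keeps this filter proper.\<close>
  define F where "F = inf (nhds (0::real^'n)) (principal S)"
  have F: "F \<le> nhds 0" by (simp add: F_def)
  have "F \<noteq> bot"
  proof
    assume "F = bot"
    then have "\<forall>\<^sub>F \<epsilon> in nhds 0. \<epsilon> \<notin> S"
      unfolding trivial_limit_def[symmetric] by (simp add: trivial_limit_def F_def eventually_inf_principal)
    then obtain d where "d > 0" "\<And>\<epsilon>. dist \<epsilon> 0 < d \<Longrightarrow> \<epsilon> \<notin> S"
      unfolding eventually_nhds_metric by blast
    then show False
      using rsquarefree_parameter_poly_dense[OF idx, of d 0] unfolding S_def by blast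
  qed
  have \<phi>lim: "(\<phi> \<longlongrightarrow> 0) F"
  proof -
    have "(\<phi> \<longlongrightarrow> \<phi> 0) (nhds 0)"
      using s by (intro isCont_tendsto_nhds isCont\<phi>) simp
    then show ?thesis using F \<phi>0 by (simp add: tendsto_mono)
  qed
  have lim_id: "((\<lambda>\<epsilon>. \<epsilon>) \<longlongrightarrow> 0) F"
    using F by (rule tendsto_mono) (rule filterlim_ident)
  have "\<forall>\<^sub>F \<epsilon> in F. low_poly idx \<epsilon> = low_poly idx (\<phi> \<epsilon>)"
  proof (rule interpolating_polynomial[OF r s zero_less_card_finite contH holH degree_parameter_poly[OF idx]
        continuous_coeff_parameter_poly roots' P0])
    fix W
    assume degW: "\<And>\<epsilon>. degree (W \<epsilon>) \<le> ?k"
      and W: "\<And>\<epsilon> z. \<epsilon> \<in> cball 0 s \<Longrightarrow> poly (?P \<epsilon>) z = 0 \<Longrightarrow> poly (W \<epsilon>) z = H z \<epsilon>"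
      and limW: "\<And>j. ((\<lambda>\<epsilon>. coeff (W \<epsilon>) j) \<longlongrightarrow> coeff (W 0) j) (nhds 0)"
      and W1: "coeff (W 0) 1 = deriv (\<lambda>z. H z 0) 0"
    show ?thesis
    proof (rule eventually_eq_of_square_dvd[OF \<open>F \<noteq> bot\<close> zero_less_card_finite[where 'a = 'n]])
      show "degree (low_poly idx \<epsilon>) < ?k" "degree (low_poly idx (\<phi> \<epsilon>)) < ?k" "degree (W \<epsilon>) \<le> ?k" for \<epsilon>
        using degree_low_poly[OF idx] degW by auto
      show "low_poly idx \<in> coeff_smallo F (\<lambda>_. 1)" "(\<lambda>\<epsilon>. low_poly idx (\<phi> \<epsilon>)) \<in> coeff_smallo F (\<lambda>_. 1)"
        using low_poly_smallo[OF lim_id] low_poly_smallo[OF \<phi>lim] by auto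
      show "((\<lambda>\<epsilon>. coeff (W \<epsilon>) j) \<longlongrightarrow> coeff (W 0) j) F" for j
        using F limW by (rule tendsto_mono)
      show "coeff (W 0) 1 \<noteq> 0" unfolding W1 by (rule H'(1))
      \<comment> \<open>The only place where oddness enters: a real k-th root of unity is 1 for odd
        k, while -1 remains possible for even k.\<close>
      show "coeff (W 0) 1 = 1" if "coeff (W 0) 1 ^ ?k = 1"
        using odd_power_eq_1_real[OF _ odd that] H'(2) by (simp only: W1)
      show "((\<lambda>\<epsilon>. complex_of_real (b1 \<epsilon>)) \<longlongrightarrow> of_real (b1 0)) F"
        using isCont_tendsto_compose[OF b(1) lim_id] by (rule tendsto_of_real)
      show "((\<lambda>\<epsilon>. complex_of_real (b2 (\<phi> \<epsilon>))) \<longlongrightarrow> of_real (b2 0)) F"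
        using isCont_tendsto_compose[OF b(2) \<phi>lim] by (rule tendsto_of_real)
      have "\<forall>\<^sub>F \<epsilon> in nhds 0. \<epsilon> \<in> ball 0 s"
        using s by (intro eventually_nhds_in_open) auto
      then have "\<forall>\<^sub>F \<epsilon> in F. \<epsilon> \<in> ball 0 s"
        using F by (rule filter_leD[rotated])
      moreover have "\<forall>\<^sub>F \<epsilon> in F. \<epsilon> \<in> S"
        by (simp add: F_def eventually_inf_principal)
      ultimately show "\<forall>\<^sub>F \<epsilon> in F. (monom 1 (?k + 1) + low_poly idx \<epsilon>) ^ 2 dvd
        (1 + monom (complex_of_real (b1 \<epsilon>)) ?k) * (W \<epsilon> ^ (?k + 1) + pcompose (low_poly idx (\<phi> \<epsilon>)) (W \<epsilon>))
          - (monom 1 (?k + 1) + low_poly idx \<epsilon>) * pderiv (W \<epsilon>) * (1 + [:complex_of_real (b2 (\<phi> \<epsilon>)):] * W \<epsilon> ^ ?k)"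
      proof eventually_elim
        case (elim \<epsilon>)
        then have \<epsilon>: "\<epsilon> \<in> cball 0 s" by simp
        define E where "E = (1 + monom (complex_of_real (b1 \<epsilon>)) ?k) * pcompose (?P (\<phi> \<epsilon>)) (W \<epsilon>)
          - ?P \<epsilon> * (pderiv (W \<epsilon>) * (1 + [:complex_of_real (b2 (\<phi> \<epsilon>)):] * W \<epsilon> ^ ?k))"
        have "?P \<epsilon> ^ 2 dvd E"
        proof (rule rsquarefree_square_dvd)
          show "rsquarefree (?P \<epsilon>)" using elim(2) by (simp add: S_def)
          fix z assume z: "poly (?P \<epsilon>) z = 0"
          then have z': "param_poly idx \<epsilon> z = 0" by (simp add: poly_parameter_poly)
          have w: "poly (?P (\<phi> \<epsilon>)) (poly (W \<epsilon>) z) = 0"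
            using Hroot[OF \<epsilon> z'] W[OF \<epsilon> z] by (simp add: poly_parameter_poly)
          show "poly E z = 0"
            using z w by (simp add: E_def poly_pcompose)
          \<comment> \<open>At a root both products lose a term. The derivative of \<open>W\<close>
            then factors out, and the bracket vanishes by the eigenvalue identity.\<close>
          have "poly (pderiv E) z = poly (pderiv (W \<epsilon>)) z *
            ((1 + complex_of_real (b1 \<epsilon>) * z ^ ?k) * poly (pderiv (?P (\<phi> \<epsilon>))) (poly (W \<epsilon>) z)
              - poly (pderiv (?P \<epsilon>)) z * (1 + complex_of_real (b2 (\<phi> \<epsilon>)) * poly (W \<epsilon>) z ^ ?k))"
            unfolding E_def pderiv_diff pderiv_mult pderiv_pcompose poly_diff poly_add poly_mult poly_pcompose z w
            by (simp add: poly_monom algebra_simps)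
          then show "poly (pderiv E) z = 0"
            using eigen[OF \<epsilon> z'] W[OF \<epsilon> z] by simp
        qed
        moreover have "pcompose (?P (\<phi> \<epsilon>)) (W \<epsilon>) = W \<epsilon> ^ (?k + 1) + pcompose (low_poly idx (\<phi> \<epsilon>)) (W \<epsilon>)"
          by (simp add: parameter_poly_def pcompose_add pcompose_altdef[of "monom _ _"] map_poly_monom poly_monom)
        ultimately show ?case by (simp only: E_def parameter_poly_def mult.assoc)
      qed
  qed
  qed
  then have "\<forall>\<^sub>F \<epsilon> in nhds 0. \<epsilon> \<in> S \<longrightarrow> \<phi> \<epsilon> = \<epsilon>"
    unfolding F_def eventually_inf_principal low_poly_inject[OF idx] by (simp add: eq_commute)
  then obtain d where "d > 0" and d: "\<And>\<epsilon>. dist \<epsilon> 0 < d \<Longrightarrow> \<epsilon> \<in> S \<Longrightarrow> \<phi> \<epsilon> = \<epsilon>"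
    unfolding eventually_nhds_metric by blast
  have "\<forall>\<^sub>F \<epsilon> in nhds 0. \<epsilon> \<in> ball 0 (min d s)"
    using \<open>d > 0\<close> s by (intro eventually_nhds_in_open) auto
  then show ?thesis
  proof eventually_elim
    case (elim \<epsilon>)
    show ?case
    proof (rule ccontr)
      \<comment> \<open>By continuity the inequality would persist near this
        \<open>\<epsilon>\<close>, which need not have simple roots itself; density around it gives
        the contradiction.\<close>
      assume ne: "\<phi> \<epsilon> \<noteq> \<epsilon>"
      have "((\<lambda>\<epsilon>. \<phi> \<epsilon> - \<epsilon>) \<longlongrightarrow> \<phi> \<epsilon> - \<epsilon>) (nhds \<epsilon>)"
      proof -
        have "(\<phi> \<longlongrightarrow> \<phi> \<epsilon>) (nhds \<epsilon>)"
          using elim by (intro isCont_tendsto_nhds isCont\<phi>) simp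
        then show ?thesis by (intro tendsto_diff filterlim_ident)
      qed
      then have "\<forall>\<^sub>F \<epsilon>' in nhds \<epsilon>. \<phi> \<epsilon>' - \<epsilon>' \<noteq> 0"
        using ne by (intro tendsto_imp_eventually_ne) auto
      moreover have "\<forall>\<^sub>F \<epsilon>' in nhds \<epsilon>. \<epsilon>' \<in> ball 0 d"
        using elim by (intro eventually_nhds_in_open) auto
      ultimately have "\<forall>\<^sub>F \<epsilon>' in nhds \<epsilon>. \<epsilon>' \<notin> S"
        by eventually_elim (use d in \<open>auto simp: dist_commute\<close>)
      then obtain e where "e > 0" "\<And>\<epsilon>'. dist \<epsilon>' \<epsilon> < e \<Longrightarrow> \<epsilon>' \<notin> S"
        unfolding eventually_nhds_metric by blast
      then show False
        using rsquarefree_parameter_poly_dense[OF idx, of e \<epsilon>] unfolding S_def by blast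
    qed
  qed
qed

section \<open>The rotation by minus one\<close>

lemma scaling_minus_one [simp]: "scaling (-1) z = - z"
  by (simp add: scaling_def)

lemma hat_param_nth: "hat_param idx \<epsilon> $ i = (-1) ^ (idx i + 1) * \<epsilon> $ i"
  by (simp add: hat_param_def)

lemma hat_param_hat_param [simp]: "hat_param idx (hat_param idx \<epsilon>) = \<epsilon>"
  by (simp add: vec_eq_iff hat_param_nth flip: mult.assoc power_add mult_2)

lemma linear_hat_param: "linear (hat_param idx)"
  by (rule linearI) (simp_all add: vec_eq_iff hat_param_nth algebra_simps)

lemma hat_param_inner_axis:
  "hat_param idx \<epsilon> \<bullet> axis i 1 = (-1) ^ (idx i + 1) * (\<epsilon> \<bullet> axis i 1)"
  by (simp add: inner_axis hat_param_nth)

lemma norm_hat_param [simp]: "norm (hat_param idx \<epsilon>) = norm \<epsilon>"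
  unfolding norm_vec_def by (simp add: hat_param_nth abs_mult power_abs)

lemma hat_param_0 [simp]: "hat_param idx 0 = 0"
  using linear_hat_param by (rule linear_0)

lemma tendsto_hat_param: "(hat_param idx \<longlongrightarrow> 0) (nhds 0)"
proof -
  have "isCont (hat_param idx) 0"
    using linear_hat_param by (intro linear_continuous_at) (simp add: linear_conv_bounded_linear)
  from isCont_tendsto_nhds[OF this] show ?thesis by simp
qed

text \<open>For even k the leading monomial is odd in z, so -P(-z) is again monic; for odd k its
  leading coefficient would be -1.\<close>

lemma param_poly_hat_param:
  fixes idx :: "'n::finite \<Rightarrow> nat"
  assumes "even CARD('n)"
  shows "param_poly idx (hat_param idx \<epsilon>) z = - param_poly idx \<epsilon> (- z)"
proof -
  have "complex_of_real (hat_param idx \<epsilon> $ i) * z ^ idx i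
      = - (complex_of_real (\<epsilon> $ i) * (- z) ^ idx i)" for i
    by (cases "even (idx i)") (simp_all add: hat_param_nth)
  then show ?thesis
    using assms by (simp add: param_poly_def sum_negf)
qed

section \<open>Derivatives and diffeomorphisms under conjugation by the rotation\<close>

lemma has_derivative_minus_compose_minus:
  fixes g :: "'a::real_normed_vector \<Rightarrow> 'b::real_normed_vector"
  assumes "(g has_derivative D) (at (- z))"
  shows "((\<lambda>z. - g (- z)) has_derivative D) (at z)"
proof -
  have "linear D"
    using assms by (rule has_derivative_linear)
  have "((\<lambda>z. - g (- z)) has_derivative (\<lambda>h. - D (- h))) (at z)"
    by (rule has_derivative_minus[OF has_derivative_compose[of uminus uminus z UNIV g]])
      (use assms in \<open>auto intro!: derivative_eq_intros\<close>)
  then show ?thesis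
    by (simp add: linear_neg[OF \<open>linear D\<close>])
qed

text \<open>The operation is an involution, so one implication used twice gives both. An equivalence
  is required because \<open>frechet_derivative\<close> and \<open>deriv\<close> are choice terms:
  they then agree with no differentiability assumption.\<close>

lemma has_derivative_minus_compose_minus_iff:
  fixes g :: "'a::real_normed_vector \<Rightarrow> 'b::real_normed_vector"
  shows "((\<lambda>z. - g (- z)) has_derivative D) (at z) \<longleftrightarrow> (g has_derivative D) (at (- z))"
  using has_derivative_minus_compose_minus[of g D z]
    has_derivative_minus_compose_minus[of "\<lambda>z. - g (- z)" D "- z"] by auto

lemma frechet_derivative_minus_compose_minus:
  fixes g :: "'a::real_normed_vector \<Rightarrow> 'b::real_normed_vector"
  shows "frechet_derivative (\<lambda>z. - g (- z)) (at z) = frechet_derivative g (at (- z))"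
  unfolding frechet_derivative_def has_derivative_minus_compose_minus_iff ..

lemma deriv_minus_compose_minus:
  "deriv (\<lambda>z. - g (- z)) z = deriv g (- z)"
  unfolding deriv_def has_field_derivative_def has_derivative_minus_compose_minus_iff ..

lemma diffeomorphism_on_minus_compose_minus:
  fixes g :: "complex \<Rightarrow> complex"
  assumes "diffeomorphism_on g (ball 0 r)"
  shows "diffeomorphism_on (\<lambda>z. - g (- z)) (ball 0 r)"
proof -
  obtain g' where g': "homeomorphism (ball 0 r) (g ` ball 0 r) g g'"
    "g' differentiable_on g ` ball 0 r"
    and op: "open (g ` ball 0 r)" and diff: "g differentiable_on ball 0 r"
    using assms unfolding diffeomorphism_on_def by blast
  have neg: "uminus ` ball 0 r = (ball 0 r :: complex set)"
    by (auto simp: image_iff intro!: bexI[of _ "- _"])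
  have im: "(\<lambda>z. - g (- z)) ` ball 0 r = uminus ` g ` ball 0 r"
    by (subst neg[symmetric]) (simp add: image_image)
  have "homeomorphism (ball 0 r) (uminus ` g ` ball 0 r) (\<lambda>z. - g (- z)) (\<lambda>z. - g' (- z))"
    unfolding homeomorphism_def
  proof (intro conjI ballI)
    show "continuous_on (ball 0 r) (\<lambda>z. - g (- z))"
      by (intro continuous_on_minus continuous_on_compose2[OF homeomorphism_cont1[OF g'(1)]])
        (simp_all add: continuous_on_minus continuous_on_id neg)
    show "continuous_on (uminus ` g ` ball 0 r) (\<lambda>z. - g' (- z))"
      by (intro continuous_on_minus continuous_on_compose2[OF homeomorphism_cont2[OF g'(1)]])
        (simp_all add: continuous_on_minus continuous_on_id image_image)
    show "(\<lambda>z. - g (- z)) ` ball 0 r = uminus ` g ` ball 0 r"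
      by (fact im)
    have "(\<lambda>z. - g' (- z)) ` uminus ` g ` ball 0 r = uminus ` g' ` g ` ball 0 r"
      by (simp add: image_image)
    then show "(\<lambda>z. - g' (- z)) ` uminus ` g ` ball 0 r = ball 0 r"
      using homeomorphism_image2[OF g'(1)] neg by simp
  next
    fix x assume "x \<in> ball (0::complex) r"
    then have "- x \<in> ball 0 r" by simp
    then show "- g' (- (- g (- x))) = x"
      using homeomorphism_apply1[OF g'(1)] by simp
  next
    fix y assume "y \<in> uminus ` g ` ball 0 r"
    then show "- g (- (- g' (- y))) = y"
      using homeomorphism_apply2[OF g'(1)] by fastforce
  qed
  moreover have "(\<lambda>z. - g' (- z)) differentiable_on uminus ` g ` ball 0 r"
    using g'(2) op
    by (simp add: differentiable_on_eq_differentiable_at open_negations differentiable_def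
        has_derivative_minus_compose_minus_iff)
  moreover have "(\<lambda>z. - g (- z)) differentiable_on ball 0 r"
    using diff by (simp add: differentiable_on_eq_differentiable_at differentiable_def
        has_derivative_minus_compose_minus_iff)
  ultimately show ?thesis
    unfolding diffeomorphism_on_def im using open_negations[OF op] open_ball by blast
qed

lemma hat_param_Basis_inner:
  assumes "i \<in> Basis"
  shows "hat_param idx h \<bullet> i = (hat_param idx i \<bullet> i) * (h \<bullet> i)" "\<bar>hat_param idx i \<bullet> i\<bar> = 1"
proof -
  obtain j where "i = axis j 1"
    using assms by (auto simp: Basis_vec_def)
  then show "hat_param idx h \<bullet> i = (hat_param idx i \<bullet> i) * (h \<bullet> i)" "\<bar>hat_param idx i \<bullet> i\<bar> = 1"
    by (simp_all add: hat_param_inner_axis inner_axis_axis abs_mult power_abs)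
qed

lemma real_analytic_on_hat_param:
  assumes "real_analytic_on f (ball 0 r)"
  shows "real_analytic_on (\<lambda>\<epsilon>. f (hat_param idx \<epsilon>)) (ball 0 r)"
  by (rule real_analytic_on_diagonal[OF assms linear_hat_param, where s = "\<lambda>i. hat_param idx i \<bullet> i"])
    (auto simp: hat_param_Basis_inner(2) intro: hat_param_Basis_inner(1))

lemma real_analytic_on_minus_hat_param:
  fixes f :: "complex \<Rightarrow> real ^ 'n::finite \<Rightarrow> 'b::euclidean_space"
  assumes "real_analytic_on (\<lambda>(z, \<epsilon>). f z \<epsilon>) (ball 0 r \<times> ball 0 r)"
  shows "real_analytic_on (\<lambda>(z, \<epsilon>). f (- z) (hat_param idx \<epsilon>)) (ball 0 r \<times> ball 0 r)"
proof -
  define L :: "complex \<times> (real ^ 'n) \<Rightarrow> complex \<times> (real ^ 'n)"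
    where "L = (\<lambda>x. (- fst x, hat_param idx (snd x)))"
  have L: "linear L"
    unfolding L_def
    by (rule linearI) (simp_all add: linear_add[OF linear_hat_param] linear_scale[OF linear_hat_param])
  have B: "L h \<bullet> i = (L i \<bullet> i) * (h \<bullet> i)" "\<bar>L i \<bullet> i\<bar> \<le> 1" if i: "i \<in> Basis" for h i
  proof -
    consider u where "i = (u, 0)" "u \<in> Basis" | v where "i = (0, v)" "v \<in> Basis"
      using i by (auto simp: Basis_prod_def)
    then have "L h \<bullet> i = (L i \<bullet> i) * (h \<bullet> i) \<and> \<bar>L i \<bullet> i\<bar> \<le> 1"
    proof cases
      case 1
      then show ?thesis by (simp add: L_def inner_prod_def inner_same_Basis)
    next
      case 2
      then show ?thesis
        using hat_param_Basis_inner(1)[of v idx "snd h"] hat_param_Basis_inner(2)[of v idx] by (simp add: L_def inner_prod_def)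
    qed
    then show "L h \<bullet> i = (L i \<bullet> i) * (h \<bullet> i)" "\<bar>L i \<bullet> i\<bar> \<le> 1" by auto
  qed
  have "real_analytic_on (\<lambda>x. (\<lambda>(z, \<epsilon>). f z \<epsilon>) (L x)) (ball 0 r \<times> ball 0 r)"
    by (rule real_analytic_on_diagonal[OF assms L _ B]) (auto simp: L_def)
  then show ?thesis
    by (simp add: L_def case_prod_unfold)
qed

text \<open>Indexed by the new parameter. As \<open>hat_param idx\<close> is its own inverse,
  evaluation at \<open>hat_param idx \<epsilon>\<close> returns the rotated
  \<open>f \<epsilon>\<close>.\<close>

definition hat_family ::
    "('n::finite \<Rightarrow> nat) \<Rightarrow> (real ^ 'n \<Rightarrow> complex \<Rightarrow> complex) \<Rightarrow> real ^ 'n \<Rightarrow> complex \<Rightarrow> complex" where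
  "hat_family idx f = (\<lambda>\<epsilon> z. - f (hat_param idx \<epsilon>) (- z))"

lemma antiholomorphic_diffeo_family_hat:
  assumes "antiholomorphic_diffeo_family f"
  shows "antiholomorphic_diffeo_family (hat_family idx f)"
proof -
  obtain r where r: "r > 0" "real_analytic_on (\<lambda>(z, \<epsilon>). f \<epsilon> z) (ball 0 r \<times> ball 0 r)"
    and anti: "\<And>\<epsilon>. \<epsilon> \<in> ball 0 r \<Longrightarrow> antiholomorphic_on (f \<epsilon>) (ball 0 r)"
    and diffeo: "\<And>\<epsilon>. \<epsilon> \<in> ball 0 r \<Longrightarrow> diffeomorphism_on (f \<epsilon>) (ball 0 r)"
    using assms unfolding antiholomorphic_diffeo_family_def by blast
  have "real_analytic_on (\<lambda>x. (- 1) *\<^sub>R (case x of (z, \<epsilon>) \<Rightarrow> f (hat_param idx \<epsilon>) (- z)))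
      (ball 0 r \<times> ball 0 r)"
    by (intro real_analytic_on_scaleR real_analytic_on_minus_hat_param r)
  then have "real_analytic_on (\<lambda>(z, \<epsilon>). hat_family idx f \<epsilon> z) (ball 0 r \<times> ball 0 r)"
    by (simp add: hat_family_def case_prod_unfold)
  moreover have "antiholomorphic_on (hat_family idx f \<epsilon>) (ball 0 r)"
    if "\<epsilon> \<in> ball 0 r" for \<epsilon>
    using anti[of "hat_param idx \<epsilon>"] that
    by (auto simp: antiholomorphic_on_def hat_family_def differentiable_def wirtinger_dz_def
        has_derivative_minus_compose_minus_iff frechet_derivative_minus_compose_minus)
  moreover have "diffeomorphism_on (hat_family idx f \<epsilon>) (ball 0 r)"
    if "\<epsilon> \<in> ball 0 r" for \<epsilon>
    using diffeo[of "hat_param idx \<epsilon>"] that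
    by (auto simp: hat_family_def intro: diffeomorphism_on_minus_compose_minus)
  ultimately show ?thesis
    using \<open>r > 0\<close> unfolding antiholomorphic_diffeo_family_def by blast
qed

lemma prepared_form_hat:
  fixes f :: "real ^ 'n::finite \<Rightarrow> complex \<Rightarrow> complex"
  assumes "even CARD('n)" "prepared_form idx f"
  shows "prepared_form idx (hat_family idx f)"
proof -
  let ?N = "hat_param idx"
  obtain r Q R where r: "r > 0"
    and deg: "\<And>\<epsilon>. \<epsilon> \<in> ball 0 r \<Longrightarrow> degree (Q \<epsilon>) \<le> CARD('n)"
    and anaQ: "\<And>j. real_analytic_on (\<lambda>\<epsilon>. coeff (Q \<epsilon>) j) (ball 0 r)"
    and mixR: "mix_analytic_on R (ball 0 r \<times> ball 0 r)"
    and f: "\<And>\<epsilon> z. \<epsilon> \<in> ball 0 r \<Longrightarrow> z \<in> ball 0 r \<Longrightarrow>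
           f \<epsilon> z = cnj z + param_poly idx \<epsilon> (cnj z) *
             (1 / 2 + poly (Q \<epsilon>) (cnj z) + param_poly idx \<epsilon> (cnj z) * R (cnj z) \<epsilon>)"
    using assms unfolding prepared_form_def by blast
  define Q' where "Q' = (\<lambda>\<epsilon>. pcompose (Q (?N \<epsilon>)) [:0, -1:])"
  \<comment> \<open>P changes sign under the rotation and \<open>1 / 2 + Q\<close> does not, so
    \<open>R\<close> must change sign to leave the product of P and \<open>R\<close>
    unchanged.\<close>
  define R' where "R' = (\<lambda>z \<epsilon>. - R (- z) (?N \<epsilon>))"
  have "degree (Q' \<epsilon>) \<le> CARD('n)" if "\<epsilon> \<in> ball 0 r" for \<epsilon>
    using deg[of "?N \<epsilon>"] that by (simp add: Q'_def degree_pcompose)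
  moreover have "real_analytic_on (\<lambda>\<epsilon>. coeff (Q' \<epsilon>) j) (ball 0 r)" for j
  proof -
    have "real_analytic_on (\<lambda>\<epsilon>. (-1) ^ j *\<^sub>R coeff (Q (?N \<epsilon>)) j) (ball 0 r)"
      by (intro real_analytic_on_scaleR real_analytic_on_hat_param[OF anaQ])
    then show ?thesis
      by (simp add: Q'_def coeff_pcompose_linear scaleR_conv_of_real)
  qed
  moreover have "mix_analytic_on R' (ball 0 r \<times> ball 0 r)"
    unfolding mix_analytic_on_def
  proof (intro conjI allI)
    have "real_analytic_on (\<lambda>x. (- 1) *\<^sub>R (case x of (z, \<epsilon>) \<Rightarrow> R (- z) (?N \<epsilon>))) (ball 0 r \<times> ball 0 r)"
      using mixR unfolding mix_analytic_on_def
      by (intro real_analytic_on_scaleR real_analytic_on_minus_hat_param) auto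
    then show "real_analytic_on (\<lambda>(z, \<epsilon>). R' z \<epsilon>) (ball 0 r \<times> ball 0 r)"
      by (simp add: R'_def case_prod_unfold)
    fix \<epsilon>
    have "(\<lambda>z. R z (?N \<epsilon>)) holomorphic_on {z. (z, ?N \<epsilon>) \<in> ball 0 r \<times> ball 0 r}"
      using mixR unfolding mix_analytic_on_def by blast
    then have "(\<lambda>z. - ((\<lambda>z. R z (?N \<epsilon>)) \<circ> uminus) z) holomorphic_on {z. (z, \<epsilon>) \<in> ball 0 r \<times> ball 0 r}"
      by (intro holomorphic_on_minus holomorphic_on_compose_gen[where g = "\<lambda>z. R z (?N \<epsilon>)"])
        (auto intro: holomorphic_intros)
    then show "(\<lambda>z. R' z \<epsilon>) holomorphic_on {z. (z, \<epsilon>) \<in> ball 0 r \<times> ball 0 r}"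
      by (simp add: R'_def o_def)
  qed
  moreover have "hat_family idx f \<epsilon> z = cnj z + param_poly idx \<epsilon> (cnj z) *
             (1 / 2 + poly (Q' \<epsilon>) (cnj z) + param_poly idx \<epsilon> (cnj z) * R' (cnj z) \<epsilon>)"
    if "\<epsilon> \<in> ball 0 r" "z \<in> ball 0 r" for \<epsilon> z
  proof -
    have "param_poly idx \<epsilon> (cnj z) = - param_poly idx (?N \<epsilon>) (- cnj z)"
      using param_poly_hat_param[OF assms(1), of idx "?N \<epsilon>"] by simp
    then show ?thesis
      using f[of "?N \<epsilon>" "- z"] that
      by (simp add: hat_family_def Q'_def R'_def poly_pcompose algebra_simps)
  qed
  ultimately show ?thesis
    using r unfolding prepared_form_def by blast
qed

text \<open>For even k the denominator is even in z, so \<open>b\<close> carries over unchanged and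
  only the numerator contributes a sign.\<close>

lemma canonical_field_hat:
  fixes idx :: "'n::finite \<Rightarrow> nat"
  assumes "even CARD('n)"
  shows "canonical_field idx (b \<circ> hat_param idx) \<epsilon> z = - canonical_field idx b (hat_param idx \<epsilon>) (- z)"
  using param_poly_hat_param[OF assms, of idx "hat_param idx \<epsilon>" z] assms
  by (simp add: canonical_field_def)

lemma fixed_points_in_minus_compose_minus:
  "fixed_points_in (\<lambda>z. - g (- z)) r = uminus ` fixed_points_in g r"
proof (intro equalityI subsetI)
  fix z assume "z \<in> fixed_points_in (\<lambda>z. - g (- z)) r"
  then have "- z \<in> fixed_points_in g r"
    by (auto simp: fixed_points_in_def) (metis minus_minus)
  then show "z \<in> uminus ` fixed_points_in g r" by (metis imageI minus_minus)
qed (auto simp: fixed_points_in_def)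

lemma prepared_family_hat:
  fixes f :: "real ^ 'n::finite \<Rightarrow> complex \<Rightarrow> complex"
  assumes "even CARD('n)" "prepared_family idx f"
  shows "prepared_family idx (hat_family idx f)"
  unfolding prepared_family_def
proof (intro conjI)
  let ?N = "hat_param idx" and ?F = "hat_family idx f"
  show "antiholomorphic_diffeo_family ?F" "prepared_form idx ?F"
    using assms antiholomorphic_diffeo_family_hat prepared_form_hat
    by (auto simp: prepared_family_def)
  have "(\<lambda>z. f 0 z - (cnj z + cnj z ^ (CARD('n) + 1) / 2)) \<in> o[at 0](\<lambda>z. cnj z ^ (CARD('n) + 1))"
    using assms(2) by (simp add: prepared_family_def)
  then have "(\<lambda>z. f 0 (- z) - (cnj (- z) + cnj (- z) ^ (CARD('n) + 1) / 2))
      \<in> o[at 0](\<lambda>z. cnj (- z) ^ (CARD('n) + 1))"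
    by (rule landau_o.small.compose) (simp add: filterlim_def filtermap_at_minus)
  then have "(\<lambda>z. - (f 0 (- z) - (cnj (- z) + cnj (- z) ^ (CARD('n) + 1) / 2)))
      \<in> o[at 0](\<lambda>z. - (cnj (- z) ^ (CARD('n) + 1)))"
    by (simp only: landau_o.small.uminus landau_o.small.uminus_in_iff)
  moreover have "- (f 0 (- z) - (cnj (- z) + cnj (- z) ^ (CARD('n) + 1) / 2))
      = ?F 0 z - (cnj z + cnj z ^ (CARD('n) + 1) / 2)" for z
    using assms(1) by (simp add: hat_family_def)
  moreover have "- (cnj (- z) ^ (CARD('n) + 1)) = cnj z ^ (CARD('n) + 1)" for z
    using assms(1) by simp
  ultimately show "(\<lambda>z. ?F 0 z - (cnj z + cnj z ^ (CARD('n) + 1) / 2)) \<in> o[at 0](\<lambda>z. cnj z ^ (CARD('n) + 1))"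
    by (simp only:)
  obtain b where b: "\<exists>\<rho>>0. real_analytic_on b (ball 0 \<rho>)"
    and ev: "\<forall>\<^sub>F r in at_right 0. \<forall>\<^sub>F \<epsilon> in nhds 0.
           (card (fixed_points_in (f \<epsilon> \<circ> f \<epsilon>) r) = CARD('n) + 1 \<longrightarrow>
              complex_of_real (b \<epsilon>) =
                (\<Sum>z\<in>fixed_points_in (f \<epsilon> \<circ> f \<epsilon>) r. 1 / Ln (deriv (f \<epsilon> \<circ> f \<epsilon>) z))) \<and>
           (\<forall>z\<in>fixed_points_in (f \<epsilon> \<circ> f \<epsilon>) r.
              Ln (wirtinger_dzbar (f \<epsilon>) z) = cnj (deriv (canonical_field idx b \<epsilon>) z) / 2)"
    using assms(2) unfolding prepared_family_def by blast
  have g: "?F \<epsilon> \<circ> ?F \<epsilon> = (\<lambda>z. - (f (?N \<epsilon>) \<circ> f (?N \<epsilon>)) (- z))" for \<epsilon>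
    by (auto simp: hat_family_def)
  have fp: "fixed_points_in (?F \<epsilon> \<circ> ?F \<epsilon>) r = uminus ` fixed_points_in (f (?N \<epsilon>) \<circ> f (?N \<epsilon>)) r" for \<epsilon> r
    unfolding g fixed_points_in_minus_compose_minus ..
  have dg: "deriv (?F \<epsilon> \<circ> ?F \<epsilon>) z = deriv (f (?N \<epsilon>) \<circ> f (?N \<epsilon>)) (- z)" for \<epsilon> z
    unfolding g deriv_minus_compose_minus ..
  have dv: "deriv (canonical_field idx (b \<circ> ?N) \<epsilon>) z = deriv (canonical_field idx b (?N \<epsilon>)) (- z)" for \<epsilon> z
    unfolding canonical_field_hat[OF assms(1), abs_def] deriv_minus_compose_minus ..
  have df: "wirtinger_dzbar (?F \<epsilon>) z = wirtinger_dzbar (f (?N \<epsilon>)) (- z)" for \<epsilon> z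
    unfolding wirtinger_dzbar_def hat_family_def frechet_derivative_minus_compose_minus ..
  show "\<exists>b. (\<exists>\<rho>>0. real_analytic_on b (ball 0 \<rho>)) \<and>
        (\<forall>\<^sub>F r in at_right 0. \<forall>\<^sub>F \<epsilon> in nhds 0.
           (card (fixed_points_in (?F \<epsilon> \<circ> ?F \<epsilon>) r) = CARD('n) + 1 \<longrightarrow>
              complex_of_real (b \<epsilon>) =
                (\<Sum>z\<in>fixed_points_in (?F \<epsilon> \<circ> ?F \<epsilon>) r. 1 / Ln (deriv (?F \<epsilon> \<circ> ?F \<epsilon>) z))) \<and>
           (\<forall>z\<in>fixed_points_in (?F \<epsilon> \<circ> ?F \<epsilon>) r.
              Ln (wirtinger_dzbar (?F \<epsilon>) z) = cnj (deriv (canonical_field idx b \<epsilon>) z) / 2))"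
  \<comment> \<open>The rotation negates the fixed points and preserves the derivatives there, so
    the sum defining \<open>b\<close> takes the same value at the corresponding parameters.\<close>
  proof (rule exI[of _ "b \<circ> ?N"], rule conjI)
    show "\<exists>\<rho>>0. real_analytic_on (b \<circ> ?N) (ball 0 \<rho>)"
      using b real_analytic_on_hat_param[of b _ idx] by (auto simp: o_def)
    show "\<forall>\<^sub>F r in at_right 0. \<forall>\<^sub>F \<epsilon> in nhds 0.
           (card (fixed_points_in (?F \<epsilon> \<circ> ?F \<epsilon>) r) = CARD('n) + 1 \<longrightarrow>
              complex_of_real ((b \<circ> ?N) \<epsilon>) =
                (\<Sum>z\<in>fixed_points_in (?F \<epsilon> \<circ> ?F \<epsilon>) r. 1 / Ln (deriv (?F \<epsilon> \<circ> ?F \<epsilon>) z))) \<and>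
           (\<forall>z\<in>fixed_points_in (?F \<epsilon> \<circ> ?F \<epsilon>) r.
              Ln (wirtinger_dzbar (?F \<epsilon>) z) = cnj (deriv (canonical_field idx (b \<circ> ?N) \<epsilon>) z) / 2)"
      using ev
    proof eventually_elim
      case (elim r)
      show ?case
        \<comment> \<open>The radius stays the same because the rotation preserves disks; only the
          parameter is transported, through the limit of \<open>hat_param\<close> at 0.\<close>
        using eventually_compose_filterlim[OF elim tendsto_hat_param[of idx]]
        by eventually_elim
          (simp add: fp dg dv df card_image sum.reindex inj_on_def del: o_apply; simp add: o_def)
    qed
  qed
qed

text \<open>The conjugating map is a linear involution of the whole product space, so the domain can
  be \<open>UNIV\<close> and the map is its own inverse.\<close>

lemma mix_analytic_conjugacy_hat:
  "mix_analytic_conjugacy f (hat_family idx f) (\<lambda>z \<epsilon>. scaling (- 1) z) (hat_param idx)"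
  unfolding mix_analytic_conjugacy_def
proof (intro conjI exI)
  let ?N = "hat_param idx"
  define L where "L = (\<lambda>(z::complex, \<eta>). (- z, ?N \<eta>))"
  have L: "linear L"
    unfolding L_def
    by (rule linearI) (auto simp: linear_add[OF linear_hat_param] linear_scale[OF linear_hat_param])
  have LL: "L (L x) = x" for x by (simp add: L_def case_prod_unfold)
  then have "surj L" by (rule surjI)
  have cont: "continuous_on UNIV L" "L differentiable_on UNIV"
    using L by (auto simp: linear_conv_bounded_linear linear_continuous_on
        bounded_linear_imp_differentiable_on)
  have "diffeomorphism_on L UNIV"
    unfolding diffeomorphism_on_def \<open>surj L\<close> using cont LL \<open>surj L\<close>
    by (auto intro!: exI[of _ L] simp: homeomorphism_def)
  then show "diffeomorphism_on (\<lambda>(z, \<eta>). (scaling (- 1) z, ?N \<eta>)) UNIV"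
    by (simp add: L_def)
  have "linear (\<lambda>(z::complex, \<eta>). - z)"
    by (rule linearI) auto
  then show "mix_analytic_on (\<lambda>z \<epsilon>. scaling (- 1) z) UNIV"
    unfolding mix_analytic_on_def by (auto intro!: real_analytic_on_linear holomorphic_intros)
qed (auto simp: hat_family_def linear_hat_param case_prod_unfold intro: real_analytic_on_linear)

theorem corollary2p14:
  fixes idx :: "'n::finite \<Rightarrow> nat"
    and f :: "real ^ 'n \<Rightarrow> complex \<Rightarrow> complex"
  assumes "bij_betw idx UNIV {..<CARD('n)}"
    and "prepared_family idx f"
  shows "(odd CARD('n) \<longrightarrow>
            (\<forall>f2 H \<phi>. prepared_family idx f2 \<and> mix_analytic_conjugacy f f2 H \<phi> \<longrightarrow>
               (\<forall>\<^sub>F \<epsilon> in nhds 0. \<phi> \<epsilon> = \<epsilon>))) \<and>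
         (even CARD('n) \<longrightarrow>
            (\<exists>fhat.
               (\<forall>\<epsilon>. fhat (hat_param idx \<epsilon>) = scaling (- 1) \<circ> f \<epsilon> \<circ> scaling (- 1)) \<and>
               prepared_family idx fhat \<and>
               mix_analytic_conjugacy f fhat (\<lambda>z \<epsilon>. scaling (- 1) z) (hat_param idx)))"
proof (intro conjI impI allI)
  fix f2 H \<phi>
  assume "odd CARD('n)" "prepared_family idx f2 \<and> mix_analytic_conjugacy f f2 H \<phi>"
  then show "\<forall>\<^sub>F \<epsilon> in nhds 0. \<phi> \<epsilon> = \<epsilon>"
    using canonical_parameter_unique[OF assms(1) _ assms(2)] by blast
next
  assume even: "even CARD('n)"
  show "\<exists>fhat. (\<forall>\<epsilon>. fhat (hat_param idx \<epsilon>) = scaling (- 1) \<circ> f \<epsilon> \<circ> scaling (- 1)) \<and>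
      prepared_family idx fhat \<and> mix_analytic_conjugacy f fhat (\<lambda>z \<epsilon>. scaling (- 1) z) (hat_param idx)"
  proof (intro exI conjI allI)
    show "hat_family idx f (hat_param idx \<epsilon>) = scaling (- 1) \<circ> f \<epsilon> \<circ> scaling (- 1)" for \<epsilon>
      by (simp add: fun_eq_iff hat_family_def)
    show "prepared_family idx (hat_family idx f)"
      using even assms(2) by (rule prepared_family_hat)
    show "mix_analytic_conjugacy f (hat_family idx f) (\<lambda>z \<epsilon>. scaling (- 1) z) (hat_param idx)"
      by (rule mix_analytic_conjugacy_hat)
  qed
qed

end
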